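(* For any $\epsilon>0$, there exist $\delta>0$ and $p_0\in\mathbb{N}$ such that for all primes $p>p_0$ and for all 1-bounded functions $f_0, f_1, f_2, f_3:\mathbb{F}_p\to\mathbb{C}$, at least one of which satisfies $\|f_i\|_{U^2}\leqslant \delta$, we have $$\left|\mathbb{E}_{x,y\in\mathbb{F}_p}f_0(x)f_1(x+y)f_2(x+y^2)f_3(x+y+y^2)\right|\leqslant \epsilon.$$
   Context: A function $f:\mathbb{F}_p\to\mathbb{C}$ is 1-bounded if $|f(x)|\leqslant 1$ for all $x$. $\mathbb{E}_{x\in X}$ denotes the average over a finite set $X$. For $s\geqslant 1$ the Gowers norm is $\|f\|_{U^s}=\left(\mathbb{E}_{x,h_1,\dots,h_s\in\mathbb{F}_p}\prod_{w\in\{0,1\}^s}\mathcal{C}^{|w|}f(x+w_1h_1+\dots+w_sh_s)\right)^{1/2^s}$, where $\mathcal{C}$ is complex conjugation and $|w|=w_1+\dots+w_s$. *)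

theory Defs
  imports Complex_Main "HOL-Library.FuncSet" "HOL-Number_Theory.Residues"
begin

text \<open>
  A prime \<open>p\<close> will be quantified inside a formula, so the field with \<open>p\<close> elements is the library's
  \<open>residue_ring p\<close>, with carrier \<open>{0..p - 1}\<close>. A function on it is a function
  \<open>int \<Rightarrow> complex\<close> of which only the values on the carrier are used.
\<close>

abbreviation prime_field :: "nat \<Rightarrow> int ring" ("\<F>")
  where "\<F> p \<equiv> residue_ring (int p)"

definition average :: "'a set \<Rightarrow> ('a \<Rightarrow> complex) \<Rightarrow> complex"
  where "average X g = (\<Sum>x\<in>X. g x) / of_nat (card X)"

definition one_bounded :: "('a, 'm) ring_scheme \<Rightarrow> ('a \<Rightarrow> complex) \<Rightarrow> bool"
  where "one_bounded R f \<longleftrightarrow> (\<forall>x\<in>carrier R. cmod (f x) \<le> 1)"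

definition gowers_average :: "('a, 'm) ring_scheme \<Rightarrow> nat \<Rightarrow> ('a \<Rightarrow> complex) \<Rightarrow> complex"
  where "gowers_average R s f =
    average (carrier R \<times> ({1..s} \<rightarrow>\<^sub>E carrier R))
      (\<lambda>(x, h). \<Prod>w\<in>{1..s} \<rightarrow>\<^sub>E {0, 1::nat}.
         (cnj ^^ (\<Sum>i\<in>{1..s}. w i)) (f (x \<oplus>\<^bsub>R\<^esub> (\<Oplus>\<^bsub>R\<^esub>i\<in>{1..s}. [w i] \<cdot>\<^bsub>R\<^esub> h i))))"

text \<open>
  For \<open>s \<ge> 1\<close> and a finite ring, the complex number \<open>gowers_average R s f\<close> is real and nonnegative, so
  \<open>Re\<close> only changes its type and \<open>root\<close> is the usual root of a nonnegative real.
\<close>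

definition gowers_norm :: "('a, 'm) ring_scheme \<Rightarrow> nat \<Rightarrow> ('a \<Rightarrow> complex) \<Rightarrow> real"
  where "gowers_norm R s f = root (2 ^ s) (Re (gowers_average R s f))"

end

theory Submission
  imports Defs "HOL-Analysis.Convex"
begin

text \<open>Two applications of the Cauchy--Schwarz inequality make the progression linear in \<open>y\<close> and bound
  the average by the \<open>U\<close>-norm of order seven of \<open>f\<^sub>3\<close>. The order is then lowered one step at a time.

  When the dual function at the last position has a large norm of order \<open>s \<ge> 3\<close>, interchanging duals
  and differences replaces \<open>f\<^sub>0, f\<^sub>1, f\<^sub>2\<close> by their derivatives of order \<open>s - 3\<close> and \<open>f\<^sub>3\<close> by a product of
  averages over \<open>k\<close> of \<open>c(k) A(x + k) e(\<phi>(k) x)\<close>, with \<open>\<phi>\<close> arbitrary. Write \<open>z = x + y\<^sup>2\<close>. Shifting \<open>k\<close> by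
  \<open>- y\<close> turns \<open>A\<close> into a function of \<open>z\<close>, so Cauchy--Schwarz removes it together with \<open>f\<^sub>2\<close>. What remains
  says that \<open>\<mu>(h, \<eta>)\<close>, the squared Fourier coefficient of \<open>f\<^sub>0(x) cnj (f\<^sub>0(x + h))\<close> at \<open>\<eta>\<close>, overlaps
  substantially with its image under lower triangular matrices with diagonal \<open>(1 + 2 d, 1 - 2 d)\<close>, for
  many \<open>d\<close>. Now \<open>\<mu>\<close> is nonnegative, positive definite, and of total mass at most one on every vertical
  line. Two quotients of such matrices with the same second diagonal entry differ by a map onto a line
  through the origin, so \<open>\<mu>\<close> is large on such a line, which means that \<open>f\<^sub>0\<close> correlates with a
  quadratic phase on the whole field. This takes the place of an inverse theorem.

  The same holds for \<open>f\<^sub>1\<close>. Once \<open>f\<^sub>0\<close> and \<open>f\<^sub>1\<close> are quadratic phases, two more applications of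
  Cauchy--Schwarz show that the average is small unless both phases are linear and cancel, and then
  \<open>f\<^sub>2\<close> has a large Fourier coefficient. So its original has a large norm of order \<open>s - 1\<close>, and the
  symmetries of the progression carry this to the other positions.\<close>

text \<open>The obstacle is that nothing is known about how the frequency \<open>\<phi>(k)\<close>
  depends on \<open>k\<close>; extracting linearity from it would amount to an inverse theorem for
  the norm of order three. The progression makes this unnecessary: after Cauchy--Schwarz a single
  frequency per difference \<open>d\<close> survives, and it enters only as the off-diagonal entry
  of a triangular matrix, about which nothing has to be known. The information sits on the diagonal,
  which is explicit.

  The matrices themselves have pairwise distinct second diagonal entries \<open>1 - 2 * d\<close>,
  so no two of them can be compared. Their quotients can: about \<open>p\<^sup>2\<close> quotients
  share at most \<open>p\<close> values of that entry, giving about \<open>p ^ 3\<close> comparable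
  pairs, of which only \<open>O(p\<^sup>2)\<close> are degenerate.

  For a dual function it does, because such a correlation is itself a value of the average with the
  phase inserted. Hence the recurring passage to dual functions.

  Exceptional parameters cost \<open>O(1 / p)\<close>, so all constants are chosen before
  \<open>p\<close>, which is then taken large.\<close>

locale prime_mod =
  fixes p :: nat
  assumes prime: "prime p" and p_gt_3: "p > 3"
begin

definition E :: "(int \<Rightarrow> 'a::real_normed_field) \<Rightarrow> 'a"  (binder "AV " 10)
  where "E f = (\<Sum>x\<in>{0..<int p}. f x) / of_nat p"

text \<open>Functions on the field are modelled as periodic functions on all integers, so that
  arguments such as \<open>x + y\<^sup>2\<close> need no reduction. The maps in \<open>cgp\<close>
  are the substitutions that preserve periodicity.\<close>

definition per :: "(int \<Rightarrow> 'a) \<Rightarrow> bool"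
  where "per f \<longleftrightarrow> (\<forall>x y. [x = y] (mod int p) \<longrightarrow> f x = f y)"

definition cgp :: "(int \<Rightarrow> int) \<Rightarrow> bool"
  where "cgp a \<longleftrightarrow> (\<forall>x y. [x = y] (mod int p) \<longrightarrow> [a x = a y] (mod int p))"

definition bd :: "(int \<Rightarrow> complex) \<Rightarrow> bool"
  where "bd f \<longleftrightarrow> per f \<and> (\<forall>x. cmod (f x) \<le> 1)"

definition ee :: "int \<Rightarrow> complex"
  where "ee x = cis (2 * pi * real_of_int x / real p)"

lemma p_pos: "p > 0" "int p > 0" "real p > 0"
  using p_gt_3 by auto

lemma p_neq_0 [simp]: "(of_nat p :: 'a::real_normed_field) \<noteq> 0"
  using p_pos by simp

subsection \<open>Periodic functions\<close>

lemma cgp_const: "cgp (\<lambda>x. c)"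
  and cgp_id: "cgp (\<lambda>x. x)"
  by (auto simp: cgp_def)

lemma cgp_add: "cgp a \<Longrightarrow> cgp b \<Longrightarrow> cgp (\<lambda>x. a x + b x)"
  and cgp_diff: "cgp a \<Longrightarrow> cgp b \<Longrightarrow> cgp (\<lambda>x. a x - b x)"
  and cgp_mult: "cgp a \<Longrightarrow> cgp b \<Longrightarrow> cgp (\<lambda>x. a x * b x)"
  and cgp_minus: "cgp a \<Longrightarrow> cgp (\<lambda>x. - a x)"
  and cgp_power: "cgp a \<Longrightarrow> cgp (\<lambda>x. a x ^ n)"
  by (auto simp: cgp_def cong_add cong_diff cong_mult cong_pow cong_minus_minus_iff)

lemma per_const: "per (\<lambda>x. c)"
  and per_comp: "per f \<Longrightarrow> cgp a \<Longrightarrow> per (\<lambda>x. f (a x))"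
  by (auto simp: per_def cgp_def)

lemma per_fun: "per f \<Longrightarrow> per (\<lambda>x. h (f x))"
  by (auto simp: per_def)

lemma per_cong: "per f \<Longrightarrow> [x = y] (mod int p) \<Longrightarrow> f x = f y"
  by (auto simp: per_def)

lemma per_mod: "per f \<Longrightarrow> f (x mod int p) = f x"
  by (erule per_cong) (simp add: cong_def)

lemma per_mult: "per f \<Longrightarrow> per g \<Longrightarrow> per (\<lambda>x. f x * g x)"
  and per_add: "per f \<Longrightarrow> per g \<Longrightarrow> per (\<lambda>x. f x + g x)"
  and per_cnj: "per f' \<Longrightarrow> per (\<lambda>x. cnj (f' x))"
  and per_cmod: "per f' \<Longrightarrow> per (\<lambda>x. cmod (f' x))"
  and per_power: "per f \<Longrightarrow> per (\<lambda>x. f x ^ n)"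
  for f :: "int \<Rightarrow> 'a::real_normed_field"
  by (auto simp: per_def)

lemma per_E: "(\<And>y. per (\<lambda>x. T x y)) \<Longrightarrow> per (\<lambda>x. E (T x))"
proof -
  assume *: "\<And>y. per (\<lambda>x. T x y)"
  show ?thesis unfolding per_def
  proof (intro allI impI)
    fix x y assume "[x = y] (mod int p)"
    then have "T x = T y" using * by (intro ext) (simp add: per_def)
    then show "E (T x) = E (T y)" by simp
  qed
qed

lemma per_sum: "(\<And>y. y \<in> S \<Longrightarrow> per (\<lambda>x. T x y)) \<Longrightarrow> per (\<lambda>x. \<Sum>y\<in>S. T x y)"
  for T :: "int \<Rightarrow> 'b \<Rightarrow> 'a::real_normed_field"
  unfolding per_def by (auto intro!: sum.cong)

lemma bd_per: "bd f \<Longrightarrow> per f" and bd_le: "bd f \<Longrightarrow> cmod (f x) \<le> 1"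
  by (auto simp: bd_def)

lemma bdc: "bd f \<Longrightarrow> cgp a \<Longrightarrow> per (\<lambda>x. f (a x))"
  by (auto simp: bd_def intro: per_comp)

lemmas cgp_intros = cgp_const cgp_id cgp_add cgp_diff cgp_mult cgp_minus cgp_power
lemmas per_intros = per_mult per_add per_cnj per_cmod per_power per_E cgp_intros

lemma bd_comp: "bd f \<Longrightarrow> cgp a \<Longrightarrow> bd (\<lambda>x. f (a x))"
  by (auto simp: bd_def intro: per_comp)

lemma bd_mult: "bd f \<Longrightarrow> bd g \<Longrightarrow> bd (\<lambda>x. f x * g x)"
  by (auto simp: bd_def norm_mult intro: per_mult mult_le_one)

lemma bd_cnj: "bd f \<Longrightarrow> bd (\<lambda>x. cnj (f x))"
  by (auto simp: bd_def intro: per_cnj)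

subsection \<open>Averages\<close>

lemma E_cong: "(\<And>x. 0 \<le> x \<Longrightarrow> x < int p \<Longrightarrow> f x = g x) \<Longrightarrow> E f = E g"
  unfolding E_def by (auto intro!: sum.cong arg_cong2[where f="(/)"])

lemma E_add: "(AV x. f x + g x) = E f + E g"
  and E_cmult_left: "(AV x. c * f x) = c * E f"
  and E_cmult_right: "(AV x. f x * c) = E f * c"
  by (simp_all add: E_def sum.distrib sum_subtractf add_divide_distrib diff_divide_distrib
      sum_distrib_left sum_distrib_right sum_negf mult.commute)

lemma E_const [simp]: "(AV x. c) = c"
  using p_pos by (simp add: E_def)

lemma E_sum: "(AV x. \<Sum>i\<in>A. T i x) = (\<Sum>i\<in>A. E (T i))"
  unfolding E_def by (subst sum.swap) (simp add: sum_divide_distrib)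

lemma E_swap: "(AV x. (AV y. T x y)) = (AV y. (AV x. T x y))"
  unfolding E_def by (simp add: sum_divide_distrib) (rule sum.swap)

lemma cnj_E: "cnj (E f) = (AV x. cnj (f x))"
  by (simp add: E_def cnj_sum)

lemma E_of_real: "(AV x. complex_of_real (f x)) = complex_of_real (E f)"
  by (simp add: E_def)

lemma cmod_E: "cmod (E f) \<le> (AV x. cmod (f x))"
  unfolding E_def by (simp add: norm_divide divide_right_mono norm_sum)

lemma E_mono: "(\<And>x. 0 \<le> x \<Longrightarrow> x < int p \<Longrightarrow> f x \<le> g x) \<Longrightarrow> E f \<le> (E g :: real)"
  unfolding E_def by (intro divide_right_mono sum_mono) auto

lemma E_nonneg: "(\<And>x. 0 \<le> f x) \<Longrightarrow> 0 \<le> (E f :: real)"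
  unfolding E_def by (intro divide_nonneg_nonneg sum_nonneg) auto

lemma E_le_const: "(\<And>x. f x \<le> c) \<Longrightarrow> E f \<le> (c :: real)"
  using E_mono[of f "\<lambda>_. c"] by simp

lemma cmod_E_le_1: "(\<And>x. cmod (f x) \<le> 1) \<Longrightarrow> cmod (E f) \<le> 1"
  by (rule order_trans[OF cmod_E]) (rule E_le_const)

lemma E_reindex:
  assumes "per f" "cgp a" "\<And>x y. [a x = a y] (mod int p) \<Longrightarrow> [x = y] (mod int p)"
  shows "(AV x. f (a x)) = E f"
proof -
  let ?Z = "{0..<int p}"
  have inj: "inj_on (\<lambda>x. a x mod int p) ?Z"
  proof (rule inj_onI)
    fix x y assume xy: "x \<in> ?Z" "y \<in> ?Z" "a x mod int p = a y mod int p"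
    then have "[a x = a y] (mod int p)" by (simp add: cong_def)
    from assms(3)[OF this] show "x = y" using xy by (simp add: cong_def)
  qed
  have sub: "(\<lambda>x. a x mod int p) ` ?Z \<subseteq> ?Z" using p_pos by auto
  have img: "(\<lambda>x. a x mod int p) ` ?Z = ?Z"
    by (rule endo_inj_surj[OF _ sub inj]) simp
  have "(\<Sum>x\<in>?Z. f (a x)) = (\<Sum>x\<in>?Z. f (a x mod int p))"
    by (simp add: per_mod[OF assms(1)])
  also have "\<dots> = sum f ((\<lambda>x. a x mod int p) ` ?Z)"
    using sum.reindex[OF inj, of f] by (simp add: o_def)
  finally show ?thesis by (simp add: E_def img)
qed

lemma E_shift: "per f \<Longrightarrow> (AV x. f (x + a)) = E f"
  by (rule E_reindex) (auto intro: cgp_intros simp: cong_add_rcancel)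

lemma E_shift': "per f \<Longrightarrow> (AV x. f (x - a)) = E f"
  using E_shift[of f "-a"] by simp

lemma E_neg: "per f \<Longrightarrow> (AV x. f (- x)) = E f"
  by (rule E_reindex) (auto intro: cgp_intros simp: cong_minus_minus_iff)

lemma coprime_p: "\<not> int p dvd a \<Longrightarrow> coprime a (int p)"
  using prime by (metis coprime_commute prime_imp_coprime prime_nat_int_transfer)

lemma E_dil: "per f \<Longrightarrow> \<not> int p dvd a \<Longrightarrow> (AV x. f (a * x)) = E f"
  by (rule E_reindex) (auto intro: cgp_intros simp: cong_mult_lcancel coprime_p)

text \<open>For each fixed \<open>y\<close> this is a translation of \<open>z\<close>, so
  \<open>a\<close> may be any function. Changes of variables such as
  \<open>z = x + y\<^sup>2\<close> are instances.\<close>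

lemma E_shear:
  assumes "\<And>y. per (\<lambda>z. T z y)"
  shows "(AV z. (AV y. T (z + a y) y)) = (AV z. (AV y. T z y))"
  using assms by (subst (1 2) E_swap) (simp add: E_shift[where f="\<lambda>z. T z _"])

subsection \<open>The Cauchy--Schwarz inequality\<close>

lemma E_CS: "((AV x. f x * g x))\<^sup>2 \<le> (AV x. (f x)\<^sup>2) * (AV x. (g x :: real)\<^sup>2)"
  using Cauchy_Schwarz_ineq_sum[of f g "{0..<int p}"] p_pos
  by (simp add: E_def power_divide power2_eq_square divide_right_mono)

lemma E_sq_le: "(E f)\<^sup>2 \<le> (AV x. (f x :: real)\<^sup>2)"
  using E_CS[of f "\<lambda>_. 1"] by simp

lemma E_pow2_le:
  assumes "\<And>x. 0 \<le> f x"
  shows "(E f) ^ (2 ^ n) \<le> (AV x. (f x :: real) ^ (2 ^ n))"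
proof (induction n)
  case (Suc n)
  have "(E f) ^ (2 ^ Suc n) = ((E f) ^ (2 ^ n))\<^sup>2" by (simp only: power_Suc power_even_eq)
  also have "\<dots> \<le> ((AV x. f x ^ (2 ^ n)))\<^sup>2"
    using Suc assms by (intro power_mono) (auto intro!: zero_le_power E_nonneg)
  also have "\<dots> \<le> (AV x. (f x ^ (2 ^ n))\<^sup>2)" by (rule E_sq_le)
  finally show ?case by (simp only: power_Suc power_even_eq)
qed simp

lemma cmod_E_sq: "per g \<Longrightarrow> complex_of_real ((cmod (E g))\<^sup>2) = (AV d. (AV y. g y * cnj (g (y + d))))"
proof -
  assume g: "per g"
  have "complex_of_real ((cmod (E g))\<^sup>2) = E g * cnj (E g)" by (rule complex_norm_square)
  also have "\<dots> = (AV y. g y * (AV y'. cnj (g y')))" by (simp add: cnj_E E_cmult_right)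
  also have "\<dots> = (AV y. g y * (AV d. cnj (g (d + y))))"
    using g by (subst E_shift[where f="\<lambda>y'. cnj (g y')"]) (auto intro: per_cnj)
  also have "\<dots> = (AV d. (AV y. g y * cnj (g (y + d))))"
    by (subst E_swap) (simp add: E_cmult_left add.commute)
  finally show ?thesis .
qed

text \<open>Cauchy--Schwarz discards the bounded weights, and the squared inner averages open up
  into correlations with shift \<open>d\<close>. The modulus stays outside the average over
  \<open>d\<close> because \<open>elimination\<close> exploits cancellation there; the index set is
  arbitrary because \<open>structured_elimination\<close> sums over pairs.\<close>

lemma vdC_sum:
  assumes "finite S" "S \<noteq> {}" and a: "\<And>s. s \<in> S \<Longrightarrow> cmod (a s) \<le> 1" and T: "\<And>s. s \<in> S \<Longrightarrow> per (T s)"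
  shows "(cmod ((\<Sum>s\<in>S. a s * E (T s)) / of_nat (card S)))\<^sup>2
    \<le> cmod ((AV d. (\<Sum>s\<in>S. (AV y. T s y * cnj (T s (y + d)))) / of_nat (card S)))"
proof -
  have c: "card S > 0" using assms by (simp add: card_gt_0_iff)
  have "cmod (\<Sum>s\<in>S. a s * E (T s)) \<le> (\<Sum>s\<in>S. cmod (a s * E (T s)))" by (rule norm_sum)
  also have "\<dots> \<le> (\<Sum>s\<in>S. cmod (E (T s)))"
    using a by (intro sum_mono) (simp add: norm_mult mult_left_le_one_le)
  finally have "(cmod (\<Sum>s\<in>S. a s * E (T s)))\<^sup>2 \<le> (\<Sum>s\<in>S. cmod (E (T s)))\<^sup>2"
    by (intro power_mono) auto
  also have "\<dots> \<le> real (card S) * (\<Sum>s\<in>S. (cmod (E (T s)))\<^sup>2)"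
    using Cauchy_Schwarz_ineq_sum[of "\<lambda>_. 1" "\<lambda>s. cmod (E (T s))" S] by simp
  finally have "(cmod ((\<Sum>s\<in>S. a s * E (T s)) / of_nat (card S)))\<^sup>2
     \<le> (\<Sum>s\<in>S. (cmod (E (T s)))\<^sup>2) / real (card S)"
    using c by (simp add: norm_divide power_divide field_simps power2_eq_square)
  also have "\<dots> = Re (complex_of_real ((\<Sum>s\<in>S. (cmod (E (T s)))\<^sup>2) / real (card S)))" by simp
  also have "complex_of_real ((\<Sum>s\<in>S. (cmod (E (T s)))\<^sup>2) / real (card S))
     = (\<Sum>s\<in>S. complex_of_real ((cmod (E (T s)))\<^sup>2)) / of_nat (card S)" by simp
  also have "\<dots> = (\<Sum>s\<in>S. (AV d. (AV y. T s y * cnj (T s (y + d))))) / of_nat (card S)"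
    using T by (simp only: cmod_E_sq cong: sum.cong)
  also have "\<dots> = (AV d. (\<Sum>s\<in>S. (AV y. T s y * cnj (T s (y + d)))) / of_nat (card S))"
    by (simp add: E_sum[symmetric] divide_inverse E_cmult_right)
  finally show ?thesis by (rule order_trans) (rule complex_Re_le_cmod)
qed

lemma vdC_strong:
  assumes a: "\<And>z. cmod (a z) \<le> 1" and T: "\<And>z. per (T z)"
  shows "(cmod ((AV z. a z * E (T z))))\<^sup>2
    \<le> cmod ((AV d. (AV z. (AV y. T z y * cnj (T z (y + d))))))"
proof -
  have "{0..<int p} \<noteq> {}" using p_pos by auto
  from vdC_sum[of "{0..<int p}" a T, OF _ this] show ?thesis
    using a T by (simp add: E_def)
qed

lemma vdC:
  assumes "\<And>z. cmod (a z) \<le> 1" and "\<And>z. per (T z)"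
  shows "(cmod ((AV z. a z * E (T z))))\<^sup>2
    \<le> (AV d. cmod ((AV z. (AV y. T z y * cnj (T z (y + d))))))"
  by (rule order_trans[OF vdC_strong[of a T, OF assms] cmod_E])

subsection \<open>Additive characters and Fourier analysis\<close>

lemma ee_add: "ee (x + y) = ee x * ee y"
  by (simp add: ee_def cis_mult add_divide_distrib ring_distribs)

lemma ee_0 [simp]: "ee 0 = 1"
  by (simp add: ee_def)

lemma norm_ee [simp]: "cmod (ee x) = 1"
  by (simp add: ee_def)

lemma cnj_ee: "cnj (ee x) = ee (- x)"
  by (simp add: ee_def cis_cnj)

lemma ee_eq_1_iff: "ee x = 1 \<longleftrightarrow> int p dvd x"
proof
  assume "ee x = 1"
  then obtain k :: int where "2 * pi * real_of_int x / real p = 2 * pi * real_of_int k"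
    unfolding ee_def by (auto simp: complex_eq_iff cos_one_2pi_int mult_ac)
  then have "real_of_int x = real_of_int (int p * k)"
    using p_pos by (simp add: field_simps)
  then have "x = int p * k" by (simp only: of_int_eq_iff)
  then show "int p dvd x" by simp
next
  assume "int p dvd x"
  then obtain k where "x = int p * k" by auto
  then have "2 * pi * real_of_int x / real p = 2 * pi * real_of_int k"
    using p_pos by simp
  then show "ee x = 1" unfolding ee_def by (simp add: cis_multiple_2pi)
qed

lemma per_ee: "per ee"
  unfolding per_def
proof (intro allI impI)
  fix x y assume "[x = y] (mod int p)"
  then have "ee (x - y) = 1" by (simp add: ee_eq_1_iff cong_iff_dvd_diff)
  then have "ee ((x - y) + y) = ee y" by (subst ee_add) simp
  then show "ee x = ee y" by simp
qed

lemma per_eec: "cgp a \<Longrightarrow> per (\<lambda>x. ee (a x))"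
  by (rule per_comp[OF per_ee])

lemma bd_ee: "cgp a \<Longrightarrow> bd (\<lambda>x. ee (a x))"
  by (simp add: bd_def per_eec)

lemma E_ee: "(AV x. ee (a * x)) = (if int p dvd a then 1 else 0)"
proof (cases "int p dvd a")
  case True
  then have "\<And>x. ee (a * x) = 1" by (simp add: ee_eq_1_iff)
  with True show ?thesis by simp
next
  case False
  have "(AV x. ee (a * (x + 1))) = (AV x. ee (a * x))"
    by (rule E_shift) (intro per_eec cgp_intros)
  then have "(AV x. ee (a * x)) * ee a = (AV x. ee (a * x))"
    by (simp add: ring_distribs ee_add E_cmult_right)
  with False show ?thesis by (simp add: ee_eq_1_iff)
qed

lemma sum_E: "(\<Sum>\<eta>\<in>{0..<int p}. f \<eta>) = of_nat p * E f"
  by (simp add: E_def)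

lemma fourier_inversion:
  assumes "per A"
  shows "(\<Sum>\<eta>\<in>{0..<int p}. (AV k. A k * ee (\<eta> * k)) * ee (- (\<eta> * l))) = A l"
proof -
  have "(AV k. A k * ee (\<eta> * k)) * ee (- (\<eta> * l)) = (AV k. A k * ee ((k - l) * \<eta>))" for \<eta>
    by (subst E_cmult_right[symmetric]) (simp add: mult.assoc ee_add[symmetric] algebra_simps)
  then have "(\<Sum>\<eta>\<in>{0..<int p}. (AV k. A k * ee (\<eta> * k)) * ee (- (\<eta> * l)))
     = of_nat p * (AV \<eta>. (AV k. A k * ee ((k - l) * \<eta>)))"
    by (simp add: sum_E)
  also have "(AV \<eta>. (AV k. A k * ee ((k - l) * \<eta>))) = (AV k. A k * (if int p dvd k - l then 1 else 0))"
    by (subst E_swap) (simp only: E_cmult_left E_ee)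
  also have "\<dots> = (AV k. A (k + l) * (if int p dvd k then 1 else 0))"
  proof -
    have "(AV k. A (k + l) * (if int p dvd (k + l) - l then 1 else 0)) = (AV k. A k * (if int p dvd k - l then 1 else 0 :: complex))"
    proof (rule E_shift[where f="\<lambda>k. A k * (if int p dvd k - l then 1 else 0)"], rule per_mult[OF assms])
      show "per (\<lambda>x. if int p dvd x - l then 1 else 0 :: complex)"
        unfolding per_def by (metis cong_diff cong_dvd_iff cong_refl)
    qed
    then show ?thesis by simp
  qed
  also have "\<dots> = A l / of_nat p"
  proof -
    have "(\<Sum>k\<in>{0..<int p}. A (k + l) * (if int p dvd k then 1 else 0)) = (\<Sum>k\<in>{0..<int p}. if k = 0 then A l else 0)"
      by (intro sum.cong refl) (auto dest: zdvd_not_zless simp: order_le_less)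
    then show ?thesis using p_pos unfolding E_def by simp
  qed
  finally show ?thesis using p_pos by simp
qed

definition four_sq :: "(int \<Rightarrow> complex) \<Rightarrow> int \<Rightarrow> real"
  where "four_sq g \<eta> = (cmod ((AV x. g x * ee (- (\<eta> * x)))))\<^sup>2"

lemma four_sq_nonneg [simp]: "0 \<le> four_sq g \<eta>"
  by (simp add: four_sq_def)

lemma per_four_sq: "per (four_sq g)"
  unfolding four_sq_def
  by (intro per_power per_cmod per_E per_mult per_const per_eec cgp_intros)

text \<open>Squared Fourier coefficients form the Fourier transform of the autocorrelation: in the
  opened square the two characters combine to a phase in the shift alone.\<close>

lemma four_sq_eq:
  assumes g: "per g"
  shows "complex_of_real (four_sq g \<eta>) = (AV k. (AV x. g x * cnj (g (x + k))) * ee (\<eta> * k))"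
proof -
  have "complex_of_real (four_sq g \<eta>) = (AV d. (AV y. (g y * ee (- (\<eta> * y))) * cnj (g (y + d) * ee (- (\<eta> * (y + d))))))"
    unfolding four_sq_def by (rule cmod_E_sq) (intro per_mult g per_eec cgp_intros)
  also have "(\<lambda>d y. (g y * ee (- (\<eta> * y))) * cnj (g (y + d) * ee (- (\<eta> * (y + d))))) = (\<lambda>d y. g y * cnj (g (y + d)) * ee (\<eta> * d))"
  proof (intro ext)
    fix d y
    have "ee (- (\<eta> * y)) * ee (\<eta> * (y + d)) = ee (\<eta> * d)"
      by (simp add: ee_add[symmetric] ring_distribs)
    then show "(g y * ee (- (\<eta> * y))) * cnj (g (y + d) * ee (- (\<eta> * (y + d)))) = g y * cnj (g (y + d)) * ee (\<eta> * d)"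
      by (simp add: cnj_ee mult_ac)
  qed
  finally show ?thesis by (simp add: E_cmult_right)
qed

lemma sum_four_sq_ee:
  assumes g: "per g"
  shows "(\<Sum>\<eta>\<in>{0..<int p}. complex_of_real (four_sq g \<eta>) * ee (- (\<eta> * k))) = (AV x. g x * cnj (g (x + k)))"
  unfolding four_sq_eq[OF g]
  by (rule fourier_inversion) (intro per_intros per_comp[OF g])

lemma sum_four_sq: "per g \<Longrightarrow> (\<Sum>\<eta>\<in>{0..<int p}. four_sq g \<eta>) = (AV x. (cmod (g x))\<^sup>2)"
proof -
  assume g: "per g"
  have "complex_of_real (\<Sum>\<eta>\<in>{0..<int p}. four_sq g \<eta>) = complex_of_real ((AV x. (cmod (g x))\<^sup>2))"
    using sum_four_sq_ee[OF g, of 0] by (simp add: E_of_real[symmetric] complex_norm_square[symmetric] del: of_real_power)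
  then show ?thesis by (simp only: of_real_eq_iff)
qed

lemma sum_four_sq_le_1: "bd g \<Longrightarrow> (\<Sum>\<eta>\<in>{0..<int p}. four_sq g \<eta>) \<le> 1"
  by (auto simp: sum_four_sq bd_per bd_le power_le_one intro!: E_le_const)

lemma four_sq_le_1: "bd g \<Longrightarrow> four_sq g \<eta> \<le> 1"
  unfolding four_sq_def by (auto simp: norm_mult bd_le intro!: power_le_one cmod_E_le_1)

subsection \<open>Gowers norms\<close>

text \<open>\<open>gowers n f\<close> is the power with exponent \<open>2 ^ (n + 1)\<close> of the \<open>U\<close>-norm of order \<open>n + 1\<close>.\<close>

primrec gowers :: "nat \<Rightarrow> (int \<Rightarrow> complex) \<Rightarrow> real" where
  "gowers 0 f = (cmod (E f))\<^sup>2"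
| "gowers (Suc n) f = (AV h. gowers n (\<lambda>x. f x * cnj (f (x + h))))"

lemma bd_deriv:
  assumes f: "bd f" shows "bd (\<lambda>x. f x * cnj (f (x + h)))"
  by (intro bd_mult bd_cnj f bd_comp[OF f] cgp_intros)

lemma gowers_nonneg: "0 \<le> gowers n f"
  by (induction n arbitrary: f) (auto intro: E_nonneg)

lemma gowers_shift: "per f \<Longrightarrow> gowers n (\<lambda>x. f (x + a)) = gowers n f"
proof (induction n arbitrary: f)
  case 0 then show ?case by (simp add: E_shift)
next
  case (Suc n)
  have "gowers n (\<lambda>x. f (x + a) * cnj (f (x + a + h))) = gowers n (\<lambda>x. f x * cnj (f (x + h)))" for h
  proof -
    have "per (\<lambda>x. f x * cnj (f (x + h)))"
      by (intro per_mult per_cnj Suc.prems per_comp[OF Suc.prems] cgp_intros)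
    from Suc.IH[OF this] show ?thesis .
  qed
  then show ?case by (simp add: add.commute add.left_commute add.assoc)
qed

lemma per_gowers:
  assumes "\<And>x. per (\<lambda>t. T t x)"
  shows "per (\<lambda>t. gowers n (T t))"
  unfolding per_def
proof (intro allI impI)
  fix t t' assume "[t = t'] (mod int p)"
  then have "T t = T t'" using assms by (intro ext) (simp add: per_def)
  then show "gowers n (T t) = gowers n (T t')" by simp
qed

text \<open>Parseval for the autocorrelation \<open>A\<close>, whose Fourier coefficients are the
  numbers \<open>four_sq f \<eta>\<close>.\<close>

lemma gowers_1: "per f \<Longrightarrow> gowers 1 f = (\<Sum>\<eta>\<in>{0..<int p}. (four_sq f \<eta>)\<^sup>2)"
proof -
  assume f: "per f"
  define A where "A k = (AV x. f x * cnj (f (x + k)))" for k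
  have "complex_of_real (gowers 1 f) = (AV k. A k * cnj (A k))"
    by (simp add: A_def complex_norm_square[symmetric] E_of_real[symmetric] del: of_real_power)
  also have "\<dots> = (AV k. A k * cnj (\<Sum>\<eta>\<in>{0..<int p}. complex_of_real (four_sq f \<eta>) * ee (- (\<eta> * k))))"
    unfolding sum_four_sq_ee[OF f] A_def ..
  also have "\<dots> = (AV k. \<Sum>\<eta>\<in>{0..<int p}. complex_of_real (four_sq f \<eta>) * (A k * ee (\<eta> * k)))"
    by (simp add: cnj_sum cnj_ee sum_distrib_left mult_ac)
  also have "\<dots> = (\<Sum>\<eta>\<in>{0..<int p}. complex_of_real (four_sq f \<eta>) * (AV k. A k * ee (\<eta> * k)))"
    by (simp add: E_sum E_cmult_left)
  also have "\<dots> = (\<Sum>\<eta>\<in>{0..<int p}. complex_of_real (four_sq f \<eta>) * complex_of_real (four_sq f \<eta>))"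
    unfolding A_def four_sq_eq[OF f] ..
  finally have "complex_of_real (gowers 1 f) = complex_of_real (\<Sum>\<eta>\<in>{0..<int p}. (four_sq f \<eta>)\<^sup>2)"
    by (simp add: power2_eq_square)
  then show ?thesis by (simp only: of_real_eq_iff)
qed

text \<open>A sum of squares is at most the maximum times the sum, and the sum is at most one by
  Parseval. This is the inverse theorem for the norm of order two.\<close>

lemma gowers_1_le_four_sq:
  assumes f: "bd f"
  obtains \<beta> where "gowers 1 f \<le> four_sq f \<beta>"
proof -
  let ?Z = "{0..<int p}"
  have "finite ?Z" "?Z \<noteq> {}" using p_pos by auto
  \<comment> \<open>A minimum of the negated values is a maximum of
    \<open>four_sq f\<close>.\<close>
  from ex_min_if_finite[of "(\<lambda>\<eta>. - four_sq f \<eta>) ` ?Z"] this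
  obtain \<beta> where "\<beta> \<in> ?Z" "\<not> (\<exists>\<eta>\<in>?Z. - four_sq f \<eta> < - four_sq f \<beta>)"
    by auto
  then have le: "four_sq f \<eta> \<le> four_sq f \<beta>" if "\<eta> \<in> ?Z" for \<eta>
    using that by force
  have "(\<Sum>\<eta>\<in>?Z. (four_sq f \<eta>)\<^sup>2) \<le> (\<Sum>\<eta>\<in>?Z. four_sq f \<beta> * four_sq f \<eta>)"
    using le by (intro sum_mono) (simp add: power2_eq_square mult_right_mono)
  moreover have "(\<Sum>\<eta>\<in>?Z. four_sq f \<beta> * four_sq f \<eta>) = four_sq f \<beta> * (\<Sum>\<eta>\<in>?Z. four_sq f \<eta>)"
    by (rule sum_distrib_left[symmetric])
  moreover have "four_sq f \<beta> * (\<Sum>\<eta>\<in>?Z. four_sq f \<eta>) \<le> four_sq f \<beta>"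
    using sum_four_sq_le_1[OF f] four_sq_nonneg by (rule mult_left_le)
  ultimately have "gowers 1 f \<le> four_sq f \<beta>" using gowers_1[OF bd_per[OF f]] by linarith
  then show ?thesis by (rule that)
qed

lemma four_sq_le_gowers_1:
  assumes f: "per f"
  shows "(four_sq f \<beta>)\<^sup>2 \<le> gowers 1 f"
proof -
  have "four_sq f \<beta> = four_sq f (\<beta> mod int p)" by (simp add: per_mod[OF per_four_sq])
  also have "(four_sq f (\<beta> mod int p))\<^sup>2 \<le> (\<Sum>\<eta>\<in>{0..<int p}. (four_sq f \<eta>)\<^sup>2)"
    using p_pos by (intro member_le_sum) auto
  finally show ?thesis using gowers_1[OF f] by simp
qed

subsection \<open>Linear forms in two variables\<close>

lemma linear_forms_2:
  assumes g0: "bd g0" and g1: "per g1" and c: "\<not> int p dvd c0 - c1"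
  shows "(AV x. (AV y. g0 (x + c0 * y) * g1 (x + c1 * y))) = E g0 * E g1"
proof -
  have "per (\<lambda>x. g0 (x + c0 * y) * g1 (x + c1 * y))" for y
    by (intro per_mult bdc[OF g0] per_comp[OF g1] cgp_intros)
  from E_shear[of "\<lambda>x y. g0 (x + c0 * y) * g1 (x + c1 * y)" "\<lambda>y. - (c1 * y)", OF this]
  have "(AV x. (AV y. g0 (x + c0 * y) * g1 (x + c1 * y)))
    = (AV x. (AV y. g0 (x - c1 * y + c0 * y) * g1 x))"
    by simp
  also have "\<dots> = (AV x. (AV y. g0 ((c0 - c1) * y + x) * g1 x))"
    by (simp only: left_diff_distrib diff_add_eq add.commute add_diff_eq)
  also have "\<dots> = (AV x. E g0 * g1 x)"
  proof -
    have "(AV y. g0 ((c0 - c1) * y + x)) = E g0" for x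
      using E_dil[OF bdc[OF g0 cgp_add[OF cgp_id cgp_const]] c] E_shift[OF bd_per[OF g0]] by simp
    then show ?thesis by (simp only: E_cmult_right)
  qed
  also have "\<dots> = E g0 * E g1"
    by (simp only: E_cmult_left)
  finally show ?thesis .
qed

text \<open>A shear makes \<open>z + c * y\<close> the outer variable, so that Cauchy--Schwarz
  removes \<open>a\<close>. Shearing back turns the shift into \<open>(- c * t, t)\<close>, the
  direction along which \<open>z + c * y\<close> is constant.\<close>

lemma vdC_2_strong:
  assumes a: "\<And>z. cmod (a z) \<le> 1" and T: "\<And>z. per (T z)" and T': "\<And>y. per (\<lambda>z. T z y)" and pa: "per a"
  shows "(cmod ((AV z. (AV y. a (z + c * y) * T z y))))\<^sup>2
    \<le> cmod ((AV t. (AV z. (AV y. T z y * cnj (T (z - c * t) (y + t))))))"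
proof -
  have pT: "per (\<lambda>y. T (b y) (d y))" if "cgp b" "cgp d" for b d
    unfolding per_def
  proof (intro allI impI)
    fix x y assume xy: "[x = y] (mod int p)"
    from that xy have "[b x = b y] (mod int p)" "[d x = d y] (mod int p)" by (auto simp: cgp_def)
    then show "T (b x) (d x) = T (b y) (d y)"
      using per_cong[OF T'[of "d x"], of "b x" "b y"] per_cong[OF T[of "b y"], of "d x" "d y"] by simp
  qed
  have "(AV z. (AV y. a (z + c * y) * T z y)) = (AV z. (AV y. a ((z - c * y) + c * y) * T (z - c * y) y))"
  proof -
    have "per (\<lambda>z. a (z + c * y) * T z y)" for y
      by (intro per_mult per_comp[OF pa] T' cgp_intros)
    from E_shear[of "\<lambda>z y. a (z + c * y) * T z y" "\<lambda>y. - (c * y)", OF this] show ?thesis by simp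
  qed
  also have "\<dots> = (AV z. a z * (AV y. T (z - c * y) y))" by (simp add: E_cmult_left)
  finally have "(cmod ((AV z. (AV y. a (z + c * y) * T z y))))\<^sup>2 = (cmod ((AV z. a z * (AV y. T (z - c * y) y))))\<^sup>2" by simp
  also have "\<dots> \<le> cmod ((AV t. (AV z. (AV y. T (z - c * y) y * cnj (T (z - c * (y + t)) (y + t))))))"
    by (rule vdC_strong[OF a]) (intro pT cgp_intros)
  also have "\<dots> = cmod ((AV t. (AV z. (AV y. T z y * cnj (T (z - c * t) (y + t))))))"
  proof -
    have "(AV z. (AV y. T (z - c * y) y * cnj (T (z - c * (y + t)) (y + t))))
      = (AV z. (AV y. T z y * cnj (T (z - c * t) (y + t))))" for t
    proof -
      have "per (\<lambda>z. T z y * cnj (T (z - c * t) (y + t)))" for y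
        by (intro per_mult per_cnj pT cgp_intros)
      from E_shear[of "\<lambda>z y. T z y * cnj (T (z - c * t) (y + t))" "\<lambda>y. - (c * y)", OF this]
      show ?thesis by (simp add: algebra_simps)
    qed
    then show ?thesis by simp
  qed
  finally show ?thesis .
qed

lemma vdC_2:
  assumes "\<And>z. cmod (a z) \<le> 1" and "\<And>z. per (T z)" and "\<And>y. per (\<lambda>z. T z y)" and "per a"
  shows "(cmod ((AV z. (AV y. a (z + c * y) * T z y))))\<^sup>2
    \<le> (AV t. cmod ((AV z. (AV y. T z y * cnj (T (z - c * t) (y + t))))))"
  by (rule order_trans[OF vdC_2_strong[of a T, OF assms] cmod_E])

lemma per_forms:
  assumes "\<forall>(c, g)\<in>set gs. bd g"
  shows "per (\<lambda>x. \<Prod>(c, g)\<leftarrow>gs. g (x + c * y))" "per (\<lambda>y. \<Prod>(c, g)\<leftarrow>gs. g (x + c * y))"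
proof -
  have "per (\<lambda>x. \<Prod>(c, g)\<leftarrow>gs. g (x + c * y)) \<and> per (\<lambda>y. \<Prod>(c, g)\<leftarrow>gs. g (x + c * y))"
    using assms
  proof (induction gs)
    case Nil then show ?case by (simp add: per_const)
  next
    case (Cons a gs)
    obtain c g where a: "a = (c, g)" by (cases a)
    from Cons.prems a have g: "bd g" by auto
    from Cons a show ?case by (auto intro!: per_mult bdc[OF g] cgp_intros)
  qed
  then show "per (\<lambda>x. \<Prod>(c, g)\<leftarrow>gs. g (x + c * y))" "per (\<lambda>y. \<Prod>(c, g)\<leftarrow>gs. g (x + c * y))" by auto
qed

text \<open>Each Cauchy--Schwarz step removes one form and replaces the other functions by
  multiplicative derivatives. The derivative of \<open>g0\<close> has step
  \<open>(c0 - c) * t\<close>; as \<open>c0 - c\<close> is invertible, this runs over all shifts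
  when \<open>t\<close> does, which is what the recursion of \<open>gowers\<close> requires.\<close>

lemma linear_forms:
  assumes "bd g0" "\<forall>(c, g)\<in>set gs. bd g \<and> \<not> int p dvd c0 - c" "length gs = Suc n"
  shows "cmod ((AV x. (AV y. g0 (x + c0 * y) * (\<Prod>(c, g)\<leftarrow>gs. g (x + c * y))))) ^ (2 ^ Suc n) \<le> gowers n g0"
  using assms
proof (induction n arbitrary: g0 gs)
  case 0
  then obtain c g where gs: "gs = [(c, g)]" by (auto simp: length_Suc_conv)
  with 0 have g: "bd g" "\<not> int p dvd c0 - c" by auto
  have "(AV x. (AV y. g0 (x + c0 * y) * (\<Prod>(c, g)\<leftarrow>gs. g (x + c * y)))) = E g0 * E g"
    using linear_forms_2[OF 0(1) bd_per[OF g(1)] g(2)] by (simp add: gs)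
  moreover have "cmod (E g0 * E g) \<le> cmod (E g0)"
    using cmod_E_le_1[of g] g(1) by (simp add: norm_mult bd_le mult_left_le)
  ultimately show ?case by (simp add: power_mono)
next
  case (Suc n)
  from Suc.prems(3) obtain c g gs' where gs: "gs = (c, g) # gs'" and len: "length gs' = Suc n"
    by (cases gs) auto
  from Suc.prems gs have g: "bd g" and c: "\<not> int p dvd c0 - c"
    and gs': "\<forall>(c, g)\<in>set gs'. bd g \<and> \<not> int p dvd c0 - c" by auto
  then have bgs': "\<forall>(c, g)\<in>set gs'. bd g" by auto
  note g0 = Suc.prems(1)
  define T where "T x y = g0 (x + c0 * y) * (\<Prod>(c, g)\<leftarrow>gs'. g (x + c * y))" for x y
  have pT: "per (T z)" "per (\<lambda>z. T z y)" for z y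
    unfolding T_def by (intro per_mult bdc[OF g0] per_forms[OF bgs'] cgp_intros)+
  define D where "D t gj = (fst gj, \<lambda>x. snd gj x * cnj (snd gj (x + (fst gj - c) * t)))"
    for t and gj :: "int \<times> (int \<Rightarrow> complex)"
  define g0t where "g0t t x = g0 x * cnj (g0 (x + (c0 - c) * t))" for t x
  \<comment> \<open>The name \<open>c'\<close> stands for the coefficient of the removed form, which
    inside the product is shadowed by the bound \<open>c\<close>.\<close>
  have prodD: "(\<Prod>(c, g)\<leftarrow>map (D t) gs'. g (z + c * y))
    = (\<Prod>(c, g)\<leftarrow>gs'. g (z + c * y)) * cnj (\<Prod>(c, g)\<leftarrow>gs'. g (z - c' * t + c * (y + t)))" if "c' = c" for t z y c'
    using that
  proof (induction gs')
    case (Cons gj gs')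
    then show ?case by (cases gj) (simp add: D_def algebra_simps)
  qed simp
  have eq: "T z y * cnj (T (z - c * t) (y + t)) = g0t t (z + c0 * y) * (\<Prod>(c, g)\<leftarrow>map (D t) gs'. g (z + c * y))" for z y t
    unfolding prodD[OF refl] by (simp add: T_def g0t_def algebra_simps)
  have bg0t: "bd (g0t t)" for t
    unfolding g0t_def by (intro bd_mult bd_cnj g0 bd_comp[OF g0] cgp_intros)
  have bD: "\<forall>(c, g)\<in>set (map (D t) gs'). bd g \<and> \<not> int p dvd c0 - c" for t
  proof safe
    fix c' g' assume "(c', g') \<in> set (map (D t) gs')"
    then obtain h where h: "(c', h) \<in> set gs'" "g' = (\<lambda>x. h x * cnj (h (x + (c' - c) * t)))"
      by (auto simp: D_def)
    with gs' have bh: "bd h" by auto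
    show "bd g'" unfolding h(2) by (intro bd_mult bd_cnj bh bd_comp[OF bh] cgp_intros)
    assume "int p dvd c0 - c'" then show False using gs' h(1) by auto
  qed
  let ?X = "cmod ((AV x. (AV y. g0 (x + c0 * y) * (\<Prod>(c, g)\<leftarrow>gs. g (x + c * y)))))"
  let ?Xt = "\<lambda>t. cmod ((AV z. (AV y. T z y * cnj (T (z - c * t) (y + t)))))"
  have "?X = cmod ((AV x. (AV y. g (x + c * y) * T x y)))"
    by (simp add: gs T_def mult_ac)
  then have "?X\<^sup>2 \<le> E ?Xt"
    using vdC_2[of g T c] bd_le[OF g] pT bd_per[OF g] by simp
  then have "(?X\<^sup>2) ^ (2 ^ Suc n) \<le> (E ?Xt) ^ (2 ^ Suc n)"
    by (intro power_mono) auto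
  also have "\<dots> \<le> (AV t. ?Xt t ^ (2 ^ Suc n))" by (rule E_pow2_le) simp
  also have "\<dots> \<le> (AV t. gowers n (g0t t))"
    unfolding eq using Suc.IH[OF bg0t bD] len by (intro E_mono) simp
  also have "\<dots> = (AV t. gowers n (\<lambda>x. g0 x * cnj (g0 (x + t))))"
  proof -
    have "per (\<lambda>t. gowers n (\<lambda>x. g0 x * cnj (g0 (x + t))))"
      by (intro per_gowers per_mult per_const per_cnj bdc[OF g0] cgp_intros)
    from E_dil[OF this c] show ?thesis by (simp add: g0t_def[abs_def])
  qed
  finally show ?case by (simp add: power_mult[symmetric])
qed

section \<open>Control by the \<open>U\<close>-norm of order seven\<close>

lemma box_bound:
  assumes a: "bd a" and b: "bd b" and T: "\<And>z. per (T z)" "\<And>y. per (\<lambda>z. T z y)"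
  shows "cmod ((AV z. (AV y. a z * b (z + y) * T z y))) ^ 4
    \<le> (AV k. (AV l. cmod ((AV z. (AV y. T z y * cnj (T z (y + k)) * cnj (T (z - l) (y + l)) * T (z - l) (y + l + k))))))"
proof -
  \<comment> \<open>Shifting \<open>y\<close> by \<open>k\<close> removes \<open>a\<close>. Shifting
    \<open>(z, y)\<close> by \<open>(- l, l)\<close> preserves \<open>z + y\<close> and removes both
    copies of \<open>b\<close>. Four copies of \<open>T\<close> remain, at the corners of a
    parallelogram.\<close>
  let ?Y = "\<lambda>k. cmod ((AV z. (AV y. (b (z + y) * cnj (b (z + y + k))) * (T z y * cnj (T z (y + k))))))"
  have pc: "per (\<lambda>y. T z (a y))" "per (\<lambda>z. T (a z) y)" if "cgp a" for z y a
    using T that by (auto intro: per_comp)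
  have "(cmod ((AV z. a z * (AV y. b (z + y) * T z y))))\<^sup>2 \<le>
     (AV d. cmod ((AV z. (AV y. (b (z + y) * T z y) * cnj (b (z + (y + d)) * T z (y + d))))))"
    by (rule vdC[OF bd_le[OF a]]) (intro per_mult bdc[OF b] T cgp_intros)
  then have 1: "(cmod ((AV z. (AV y. a z * b (z + y) * T z y))))\<^sup>2 \<le> E ?Y"
    by (simp add: E_cmult_left mult_ac add_ac)
  have 2: "(?Y k)\<^sup>2 \<le> (AV l. cmod ((AV z. (AV y. T z y * cnj (T z (y + k)) * cnj (T (z - l) (y + l)) * T (z - l) (y + l + k)))))" for k
  proof -
    have "(cmod ((AV z. (AV y. (\<lambda>w. b w * cnj (b (w + k))) (z + 1 * y) * (T z y * cnj (T z (y + k)))))))\<^sup>2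
      \<le> (AV l. cmod ((AV z. (AV y. (T z y * cnj (T z (y + k))) * cnj (T (z - 1 * l) (y + l) * cnj (T (z - 1 * l) (y + l + k)))))))"
      by (rule vdC_2)
        (auto intro!: bd_le[OF bd_deriv[OF b]] bd_per[OF bd_deriv[OF b]] per_mult per_cnj T pc cgp_intros)
    then show ?thesis by (simp add: mult_ac)
  qed
  have "cmod ((AV z. (AV y. a z * b (z + y) * T z y))) ^ 4 = ((cmod ((AV z. (AV y. a z * b (z + y) * T z y))))\<^sup>2)\<^sup>2"
    by simp
  also have "\<dots> \<le> (E ?Y)\<^sup>2" using 1 by (intro power_mono) auto
  also have "\<dots> \<le> (AV k. (?Y k)\<^sup>2)" by (rule E_sq_le)
  also have "\<dots> \<le> (AV k. (AV l. cmod ((AV z. (AV y. T z y * cnj (T z (y + k)) * cnj (T (z - l) (y + l)) * T (z - l) (y + l + k))))))"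
    by (intro E_mono 2)
  finally show ?thesis .
qed

lemma E_dvd:
  assumes "\<not> int p dvd a"
  shows "(AV l. if int p dvd a * l + b then 1 else 0 :: real) = 1 / real p"
proof -
  obtain c where c: "[a * c = b] (mod int p)"
    using cong_solve_coprime_int[OF coprime_p[OF assms]] by (metis cong_scalar_right mult.assoc mult_1)
  have per: "per (\<lambda>l. if int p dvd l then 1 else 0 :: real)"
    unfolding per_def by (auto simp: cong_dvd_iff)
  have "(AV l. if int p dvd a * l + b then 1 else 0 :: real) = (AV l. if int p dvd a * (l + c) then 1 else 0 :: real)"
  proof (rule E_cong)
    fix l
    have "[a * l + b = a * (l + c)] (mod int p)"
      using c by (simp add: ring_distribs cong_add_lcancel cong_sym)
    then have "int p dvd a * l + b \<longleftrightarrow> int p dvd a * (l + c)" by (rule cong_dvd_iff)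
    then show "(if int p dvd a * l + b then 1 else 0 :: real) = (if int p dvd a * (l + c) then 1 else 0)" by simp
  qed
  also have "\<dots> = (AV l. if int p dvd l then 1 else 0 :: real)"
  proof -
    have "per (\<lambda>l. if int p dvd a * l then 1 else 0 :: real)"
      by (rule per_comp[OF per]) (intro cgp_intros)
    from E_shift[OF this, of c] E_dil[OF per assms] show ?thesis by simp
  qed
  also have "\<dots> = 1 / real p"
  proof -
    have "(\<Sum>l\<in>{0..<int p}. if int p dvd l then 1 else 0 :: real) = (\<Sum>l\<in>{0..<int p}. if l = 0 then 1 else 0)"
      by (intro sum.cong refl) (auto dest: zdvd_not_zless simp: order_le_less)
    then show ?thesis using p_pos unfolding E_def by simp
  qed
  finally show ?thesis .
qed

definition pavg :: "(int \<Rightarrow> complex) \<Rightarrow> (int \<Rightarrow> complex) \<Rightarrow> (int \<Rightarrow> complex) \<Rightarrow> (int \<Rightarrow> complex) \<Rightarrow> complex"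
  where "pavg f0 f1 f2 f3 = (AV x. (AV y. f0 x * f1 (x + y) * f2 (x + y\<^sup>2) * f3 (x + y + y\<^sup>2)))"

lemma not_dvd_2: "\<not> int p dvd 2" and not_dvd_1: "\<not> int p dvd 1" and not_dvd_3: "\<not> int p dvd 3" and not_dvd_4: "\<not> int p dvd 4"
proof -
  show 2: "\<not> int p dvd 2" "\<not> int p dvd 1" "\<not> int p dvd 3" using p_gt_3 by (auto dest: zdvd_imp_le)
  have "int p dvd 2 * 2 \<Longrightarrow> int p dvd 2" using prime prime_dvd_mult_iff[of "int p" 2 2] by simp
  with 2 show "\<not> int p dvd 4" by auto
qed

text \<open>Once \<open>z\<close> is replaced by \<open>z - y\<^sup>2\<close>, the four corners of
  \<open>box_bound\<close> differ from each other by terms linear in \<open>y\<close>, so the eight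
  functions sit at forms \<open>x + c * y\<close>. For generic \<open>k\<close> and \<open>l\<close>
  the coefficient 1 belonging to one copy of \<open>f3\<close> differs from the other seven, and
  \<open>linear_forms\<close> applies with exponent \<open>2 ^ 7\<close>.\<close>

lemma gowers_control:
  assumes f: "bd f0" "bd f1" "bd f2" "bd f3" and d: "0 \<le> \<delta>" "gowers 6 f3 \<le> \<delta> ^ 128"
  shows "cmod (pavg f0 f1 f2 f3) ^ 4 \<le> \<delta> + 6 / real p"
proof -
  define T where "T x y = f2 (x + y\<^sup>2) * f3 (x + y + y\<^sup>2)" for x y
  have pT: "per (T z)" "per (\<lambda>z. T z y)" for z y
    unfolding T_def by (intro per_mult bdc[OF f(3)] bdc[OF f(4)] cgp_intros)+
  define Y where "Y k l = (AV z. (AV y. T z y * cnj (T z (y + k)) * cnj (T (z - l) (y + l)) * T (z - l) (y + l + k)))" for k l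
  define i :: "int \<Rightarrow> real" where "i n = (if int p dvd n then 1 else 0)" for n
  have pavg: "cmod (pavg f0 f1 f2 f3) ^ 4 \<le> (AV k. (AV l. cmod (Y k l)))"
    using box_bound[OF f(1,2) pT] by (simp add: pavg_def T_def Y_def mult.assoc)
  have Yle1: "cmod (Y k l) \<le> 1" for k l
    unfolding Y_def T_def
    by (intro cmod_E_le_1) (auto simp: norm_mult bd_le f intro!: mult_le_one)
  have good: "cmod (Y k l) \<le> \<delta>" if good: "\<not> int p dvd 2 * k" "\<not> int p dvd 2 * l" "\<not> int p dvd 2 * l + 2 * k"
      "\<not> int p dvd 2 * k - 1" "\<not> int p dvd 2 * l - 1" "\<not> int p dvd 2 * l + (2 * k - 1)" for k l
  proof -
    define gs where "gs =
       [(1 + 2 * k, \<lambda>x. cnj (f3 (x + k + k\<^sup>2))), (1 + 2 * l, \<lambda>x. cnj (f3 (x + l\<^sup>2))),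
        (1 + 2 * k + 2 * l, \<lambda>x. f3 (x + k + (k + l)\<^sup>2)),
        (0, f2), (2 * k, \<lambda>x. cnj (f2 (x + k\<^sup>2))), (2 * l, \<lambda>x. cnj (f2 (x - l + l\<^sup>2))),
        (2 * k + 2 * l, \<lambda>x. f2 (x - l + (k + l)\<^sup>2))]"
    have *: "int p dvd - (k * 2) - l * 2 \<longleftrightarrow> int p dvd 2 * l + 2 * k" "int p dvd 1 - k * 2 \<longleftrightarrow> int p dvd 2 * k - 1"
      "int p dvd 1 - l * 2 \<longleftrightarrow> int p dvd 2 * l - 1" "int p dvd 1 - k * 2 - l * 2 \<longleftrightarrow> int p dvd 2 * l + (2 * k - 1)"
      "int p dvd 1 - (k * 2 + l * 2) \<longleftrightarrow> int p dvd 2 * l + (2 * k - 1)"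
      by (subst dvd_minus_iff[symmetric], simp add: algebra_simps)+
    have "Y k l = (AV z. (AV y. T (z - y\<^sup>2) y * cnj (T (z - y\<^sup>2) (y + k)) * cnj (T (z - y\<^sup>2 - l) (y + l)) * T (z - y\<^sup>2 - l) (y + l + k)))"
    proof -
      have "per (\<lambda>z. T z y * cnj (T z (y + k)) * cnj (T (z - l) (y + l)) * T (z - l) (y + l + k))" for y
        by (intro per_mult per_cnj per_comp[OF pT(2)] cgp_intros)
      from E_shear[OF this, of "\<lambda>y. - y\<^sup>2"] show ?thesis by (simp add: Y_def)
    qed
    also have "\<dots> = (AV x. (AV y. f3 (x + 1 * y) * (\<Prod>(c, g)\<leftarrow>gs. g (x + c * y))))"
      by (simp add: T_def gs_def algebra_simps power2_eq_square)
    finally have "cmod (Y k l) ^ (2 ^ Suc 6) \<le> gowers 6 f3"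
    proof (simp only:, intro linear_forms f(4))
      show "\<forall>(c, g)\<in>set gs. bd g \<and> \<not> int p dvd 1 - c"
        unfolding gs_def using good good[folded *] not_dvd_1
        by (auto intro!: bd_cnj f bd_comp[OF f(4)] bd_comp[OF f(3)] cgp_intros simp: algebra_simps)
    qed (simp add: gs_def)
    then have "cmod (Y k l) ^ 128 \<le> gowers 6 f3" by simp
    from order_trans[OF this d(2)] have "cmod (Y k l) ^ 128 \<le> \<delta> ^ 128" .
    then show ?thesis using d(1) power_mono_iff[of "cmod (Y k l)" \<delta> 128] by simp
  qed
  \<comment> \<open>Coincidence of the coefficient 1 with another one is a linear condition of
    density \<open>1 / p\<close>, and six such conditions can occur. The summands \<open>0\<close>
    and \<open>-1\<close> give all of them the shape of \<open>ind\<close>.\<close>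
  have "cmod (Y k l) \<le> \<delta> + (i (2 * k + 0) + i (2 * l + 0) + i (2 * l + 2 * k) + i (2 * k + (-1)) + i (2 * l + (-1)) + i (2 * l + (2 * k - 1)))" for k l
    using good[of k l] Yle1[of k l] d(1) unfolding i_def by (auto split: if_splits)
  then have "(AV k. (AV l. cmod (Y k l))) \<le> (AV k. (AV l. \<delta> + (i (2 * k + 0) + i (2 * l + 0) + i (2 * l + 2 * k) + i (2 * k + (-1)) + i (2 * l + (-1)) + i (2 * l + (2 * k - 1)))))"
    by (intro E_mono)
  moreover have ind: "(AV l. i (2 * l + b)) = 1 / real p" for b
    unfolding i_def by (rule E_dvd[OF not_dvd_2])
  have "(AV k. (AV l. \<delta> + (i (2 * k + 0) + i (2 * l + 0) + i (2 * l + 2 * k) + i (2 * k + (-1)) + i (2 * l + (-1)) + i (2 * l + (2 * k - 1)))))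
     = \<delta> + 6 / real p"
    by (simp only: E_add E_const ind)
  ultimately show ?thesis using pavg by linarith
qed

subsection \<open>The Fourier coefficients of multiplicative derivatives\<close>

definition mu :: "(int \<Rightarrow> complex) \<Rightarrow> int \<Rightarrow> int \<Rightarrow> real"
  where "mu u h \<eta> = four_sq (\<lambda>x. u x * cnj (u (x + h))) \<eta>"

text \<open>The mean of a second multiplicative derivative, grouped as the autocorrelation of a
  first derivative.\<close>

definition bb :: "(int \<Rightarrow> complex) \<Rightarrow> int \<Rightarrow> int \<Rightarrow> complex"
  where "bb u h k = (AV x. u x * cnj (u (x + h)) * cnj (u (x + k) * cnj (u (x + k + h))))"

lemma mu_nonneg [simp]: "0 \<le> mu u h \<eta>"
  by (simp add: mu_def)

lemma mu_le_1: "bd u \<Longrightarrow> mu u h \<eta> \<le> 1"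
  unfolding mu_def by (intro four_sq_le_1 bd_deriv)

lemma sum_mu_le_1: "bd u \<Longrightarrow> (\<Sum>\<eta>\<in>{0..<int p}. mu u h \<eta>) \<le> 1"
  unfolding mu_def by (intro sum_four_sq_le_1 bd_deriv)

lemma per_mu_2: "per (mu u h)"
  unfolding mu_def by (rule per_four_sq)

lemma per_mu_1: assumes u: "bd u" shows "per (\<lambda>h. mu u h \<eta>)"
  unfolding mu_def four_sq_def
  by (intro per_power per_cmod per_E per_mult per_const per_cnj bdc[OF u] cgp_intros)

lemma bb_eq: "bd u \<Longrightarrow> bb u h k = (\<Sum>\<eta>\<in>{0..<int p}. complex_of_real (mu u h \<eta>) * ee (- (\<eta> * k)))"
  unfolding bb_def mu_def by (rule sum_four_sq_ee[OF bd_per[OF bd_deriv], symmetric])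

lemma bb_commute: "bb u h k = bb u k h"
  unfolding bb_def by (simp add: mult_ac add_ac)

text \<open>Positive definiteness: the symmetry of \<open>bb\<close> makes \<open>mu\<close> its own symplectic Fourier transform.\<close>

lemma mu_self_dual:
  assumes u: "bd u"
  shows "complex_of_real (mu u h \<eta>) = (AV k. \<Sum>\<zeta>\<in>{0..<int p}. complex_of_real (mu u k \<zeta>) * ee (\<eta> * k - \<zeta> * h))"
proof -
  have "complex_of_real (mu u h \<eta>) = (AV k. bb u h k * ee (\<eta> * k))"
    unfolding mu_def bb_def by (rule four_sq_eq[OF bd_per[OF bd_deriv[OF u]]])
  also have "\<dots> = (AV k. bb u k h * ee (\<eta> * k))"
    by (subst bb_commute) (rule refl)
  also have "\<dots> = (AV k. \<Sum>\<zeta>\<in>{0..<int p}. complex_of_real (mu u k \<zeta>) * ee (\<eta> * k - \<zeta> * h))"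
    unfolding bb_eq[OF u] sum_distrib_right mult.assoc ee_add[symmetric] by (simp add: add.commute)
  finally show ?thesis .
qed

lemma sum_delta:
  assumes g: "per (g :: int \<Rightarrow> complex)"
  shows "(\<Sum>\<zeta>\<in>{0..<int p}. g \<zeta> * (if int p dvd c - \<zeta> then 1 else 0)) = g c"
proof -
  have "int p dvd c - \<zeta> \<longleftrightarrow> \<zeta> = c mod int p" if "\<zeta> \<in> {0..<int p}" for \<zeta>
    using that by (metis atLeastLessThan_iff mod_eq_dvd_iff mod_pos_pos_trivial)
  then have "(\<Sum>\<zeta>\<in>{0..<int p}. g \<zeta> * (if int p dvd c - \<zeta> then 1 else 0)) = (\<Sum>\<zeta>\<in>{0..<int p}. if \<zeta> = c mod int p then g (c mod int p) else 0)"
    by (intro sum.cong) auto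
  also have "\<dots> = g c" using p_pos by (simp add: per_mod[OF g])
  finally show ?thesis .
qed

text \<open>Two applications of the Cauchy--Schwarz inequality remove \<open>a\<close> and \<open>b\<close>; what is left only
  depends on \<open>mu u\<close>, and averaging the remaining quadratic phase over one of the two shifts turns it
  into a linear condition on frequencies.\<close>

lemma elimination:
  assumes u: "bd u" and a: "bd a" and b: "bd b" and D: "\<not> int p dvd 2 * D"
  shows "cmod ((AV z. (AV y. u z * cnj (u (z - 2 * D * y + \<delta>)) * a (z + y) * b (z + (1 - 2 * D) * y) * ee (\<xi> * (z + \<kappa> * y + y\<^sup>2))))) ^ 4
    \<le> (AV t. \<Sum>\<eta>\<in>{0..<int p}. mu u t \<eta> * mu u ((1 + 2 * D) * t) ((1 - 2 * D) * \<eta> - 2 * \<xi> * t))"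
proof -
  let ?X = "cmod ((AV z. (AV y. u z * cnj (u (z - 2 * D * y + \<delta>)) * a (z + y) * b (z + (1 - 2 * D) * y) * ee (\<xi> * (z + \<kappa> * y + y\<^sup>2)))))"
  define T where "T z y = u z * cnj (u (z - 2 * D * y + \<delta>)) * b (z + (1 - 2 * D) * y) * ee (\<xi> * (z + \<kappa> * y + y\<^sup>2))" for z y
  have pT: "per (T z)" "per (\<lambda>z. T z y)" for z y
    unfolding T_def by (intro per_mult per_cnj per_const bdc[OF u] bdc[OF b] per_eec cgp_intros)+
  \<comment> \<open>Removing \<open>a\<close> pairs the point \<open>(z, y)\<close> with
    \<open>(z - t, y + t)\<close>. The two copies of \<open>u\<close> become \<open>U\<close> and
    \<open>W\<close>, and \<open>b\<close> becomes \<open>B\<close>, a function of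
    \<open>z + (1 - 2 * D) * y\<close> which the next application removes. The quadratic phase
    becomes linear in \<open>y\<close>.\<close>
  define U where "U t z = u z * cnj (u (z - t))" for t z
  define W where "W t w = cnj (u (w + \<delta>)) * u (w + \<delta> - (1 + 2 * D) * t)" for t w
  define B where "B t v = b v * cnj (b (v - 2 * D * t))" for t v
  define S where "S t z y = U t z * W t (z - 2 * D * y) * ee (\<xi> * (t - \<kappa> * t - t\<^sup>2 - 2 * y * t))" for t z y
  have bU: "bd (U t)" for t
    unfolding U_def by (intro bd_mult bd_cnj u bd_comp[OF u] cgp_intros)
  have bW: "bd (W t)" for t
    unfolding W_def by (intro bd_mult bd_cnj u bd_comp[OF u] cgp_intros)
  have bB: "bd (B t)" for t
    unfolding B_def by (intro bd_mult bd_cnj b bd_comp[OF b] cgp_intros)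
  have pS: "per (S t z)" "per (\<lambda>z. S t z y)" for t z y
    unfolding S_def by (intro per_mult per_const bdc[OF bU] bdc[OF bW] per_eec cgp_intros)+
  have TS: "T z y * cnj (T (z - 1 * t) (y + t)) = B t (z + (1 - 2 * D) * y) * S t z y" for z y t
  proof -
    have e1: "ee (\<xi> * (z + \<kappa> * y + y\<^sup>2)) * cnj (ee (\<xi> * (z - t + \<kappa> * (y + t) + (y + t)\<^sup>2))) = ee (\<xi> * (t - \<kappa> * t - t\<^sup>2 - 2 * y * t))"
      by (simp add: cnj_ee ee_add[symmetric] algebra_simps power2_eq_square)
    have e2: "z - t - 2 * D * (y + t) + \<delta> = z - 2 * D * y + \<delta> - (1 + 2 * D) * t"
      "z - t + (1 - 2 * D) * (y + t) = z + (1 - 2 * D) * y - 2 * D * t" by (simp_all add: algebra_simps)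
    show ?thesis
      unfolding T_def B_def S_def U_def W_def mult_1 e2 e1[symmetric] complex_cnj_mult complex_cnj_cnj
      by (simp only: mult_ac)
  qed
  have 1: "?X\<^sup>2 \<le> (AV t. cmod ((AV z. (AV y. B t (z + (1 - 2 * D) * y) * S t z y))))"
    using vdC_2[of a T 1] bd_le[OF a] pT bd_per[OF a] unfolding TS by (simp add: T_def mult_ac)
  define F where "F t = (\<Sum>\<eta>\<in>{0..<int p}. mu u (- t) \<eta> * mu u ((1 + 2 * D) * (- t)) ((1 - 2 * D) * \<eta> - 2 * \<xi> * (- t)))" for t
  have 2: "(cmod ((AV z. (AV y. B t (z + (1 - 2 * D) * y) * S t z y))))\<^sup>2 \<le> F t" for t
  proof -
    have SS: "S t z y * cnj (S t (z - (1 - 2 * D) * t') (y + t'))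
       = (U t (z + 0 * y) * cnj (U t (z + 0 * y - (1 - 2 * D) * t'))) * (W t (z + (- (2 * D)) * y) * cnj (W t (z + (- (2 * D)) * y - t'))) * ee (2 * \<xi> * t * t')" for z y t'
    proof -
      have e1: "ee (\<xi> * (t - \<kappa> * t - t\<^sup>2 - 2 * y * t)) * cnj (ee (\<xi> * (t - \<kappa> * t - t\<^sup>2 - 2 * (y + t') * t))) = ee (2 * \<xi> * t * t')"
        by (simp add: cnj_ee ee_add[symmetric] algebra_simps)
      have e2: "z - (1 - 2 * D) * t' - 2 * D * (y + t') = z - 2 * D * y - t'" "z + (- (2 * D)) * y = z - 2 * D * y" "z + 0 * y = z"
        by (simp_all add: algebra_simps)
      show ?thesis unfolding S_def e2 e1[symmetric] complex_cnj_mult by (simp only: mult_ac)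
    qed
    have EUU: "(AV z. U t z * cnj (U t (z - (1 - 2 * D) * t'))) = bb u (- t) (- ((1 - 2 * D) * t'))" for t'
      by (simp add: U_def bb_def algebra_simps)
    have EWW: "(AV w. W t w * cnj (W t (w - t'))) = cnj (bb u ((1 + 2 * D) * (- t)) (- t'))" for t'
    proof -
      have "per (\<lambda>x. u x * cnj (u (x + (1 + 2 * D) * (- t))) * cnj (u (x + (- t')) * cnj (u (x + (- t') + (1 + 2 * D) * (- t)))))"
        by (intro per_mult per_cnj bdc[OF u] cgp_intros)
      from E_shift[OF this, of \<delta>]
      have "bb u ((1 + 2 * D) * (- t)) (- t') = (AV x. u (x + \<delta>) * cnj (u (x + \<delta> + (1 + 2 * D) * (- t))) * cnj (u (x + \<delta> + (- t')) * cnj (u (x + \<delta> + (- t') + (1 + 2 * D) * (- t)))))"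
        by (simp only: bb_def)
      then show ?thesis by (simp add: W_def cnj_E algebra_simps)
    qed
    \<comment> \<open>\<open>U\<close> sits at the form \<open>z\<close> and \<open>W\<close> at
      \<open>z - 2 * D * y\<close>. These are independent because \<open>p\<close> does not divide
      \<open>2 * D\<close>, so the average factors.\<close>
    have fac: "(AV z. (AV y. S t z y * cnj (S t (z - (1 - 2 * D) * t') (y + t'))))
       = bb u (- t) (- ((1 - 2 * D) * t')) * cnj (bb u ((1 + 2 * D) * (- t)) (- t')) * ee (2 * \<xi> * t * t')" for t'
    proof -
      have bUU: "bd (\<lambda>z. U t z * cnj (U t (z - (1 - 2 * D) * t')))" and bWW: "bd (\<lambda>w. W t w * cnj (W t (w - t')))"
        by (intro bd_mult bd_cnj bU bW bd_comp[OF bU] bd_comp[OF bW] cgp_intros)+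
      show ?thesis unfolding SS E_cmult_right
        using linear_forms_2[OF bUU bd_per[OF bWW], of 0 "- (2 * D)"] D by (simp add: EUU EWW)
    qed
    have "(AV t'. bb u (- t) (- ((1 - 2 * D) * t')) * cnj (bb u ((1 + 2 * D) * (- t)) (- t')) * ee (2 * \<xi> * t * t'))
      = (AV t'. \<Sum>\<eta>\<in>{0..<int p}. \<Sum>\<zeta>\<in>{0..<int p}. complex_of_real (mu u (- t) \<eta>) * complex_of_real (mu u ((1 + 2 * D) * (- t)) \<zeta>) * ee (((1 - 2 * D) * \<eta> - 2 * \<xi> * (- t) - \<zeta>) * t'))"
    proof (rule E_cong)
      fix t'
      have *: "ee (- (\<eta> * - ((1 - 2 * D) * t'))) * cnj (ee (- (\<zeta> * - t'))) * ee (2 * \<xi> * t * t') = ee (((1 - 2 * D) * \<eta> - 2 * \<xi> * (- t) - \<zeta>) * t')" for \<eta> \<zeta>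
        by (simp add: cnj_ee ee_add[symmetric] algebra_simps)
      show "bb u (- t) (- ((1 - 2 * D) * t')) * cnj (bb u ((1 + 2 * D) * (- t)) (- t')) * ee (2 * \<xi> * t * t')
        = (\<Sum>\<eta>\<in>{0..<int p}. \<Sum>\<zeta>\<in>{0..<int p}. complex_of_real (mu u (- t) \<eta>) * complex_of_real (mu u ((1 + 2 * D) * (- t)) \<zeta>) * ee (((1 - 2 * D) * \<eta> - 2 * \<xi> * (- t) - \<zeta>) * t'))"
        unfolding bb_eq[OF u] cnj_sum *[symmetric]
        unfolding sum_product
        unfolding sum_distrib_right
        by (intro sum.cong refl) (simp add: mult_ac)
    qed
    also have "\<dots> = (\<Sum>\<eta>\<in>{0..<int p}. complex_of_real (mu u (- t) \<eta>) * (\<Sum>\<zeta>\<in>{0..<int p}. complex_of_real (mu u ((1 + 2 * D) * (- t)) \<zeta>) * (if int p dvd (1 - 2 * D) * \<eta> - 2 * \<xi> * (- t) - \<zeta> then 1 else 0)))"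
      unfolding E_sum E_cmult_left E_ee sum_distrib_left mult.assoc ..
    also have "\<dots> = complex_of_real (F t)"
    proof -
      have "per (\<lambda>\<zeta>. complex_of_real (mu u ((1 + 2 * D) * (- t)) \<zeta>))"
        by (intro per_fun[OF per_mu_2])
      from sum_delta[OF this] show ?thesis unfolding F_def by simp
    qed
    finally have eq: "(AV t'. bb u (- t) (- ((1 - 2 * D) * t')) * cnj (bb u ((1 + 2 * D) * (- t)) (- t')) * ee (2 * \<xi> * t * t')) = complex_of_real (F t)" .
    have F0: "0 \<le> F t" unfolding F_def by (intro sum_nonneg mult_nonneg_nonneg mu_nonneg)
    have "(cmod ((AV z. (AV y. B t (z + (1 - 2 * D) * y) * S t z y))))\<^sup>2
      \<le> cmod ((AV t'. (AV z. (AV y. S t z y * cnj (S t (z - (1 - 2 * D) * t') (y + t'))))))"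
      by (rule vdC_2_strong) (intro bd_le[OF bB] pS bd_per[OF bB])+
    also have "\<dots> = F t" unfolding fac eq using F0 by simp
    finally show ?thesis .
  qed
  have "?X ^ 4 = (?X\<^sup>2)\<^sup>2" by simp
  also have "\<dots> \<le> ((AV t. cmod ((AV z. (AV y. B t (z + (1 - 2 * D) * y) * S t z y)))))\<^sup>2"
    using 1 by (rule power_mono) simp
  also have "\<dots> \<le> (AV t. (cmod ((AV z. (AV y. B t (z + (1 - 2 * D) * y) * S t z y))))\<^sup>2)"
    by (rule E_sq_le)
  also have "\<dots> \<le> E F" by (intro E_mono 2)
  also have "E F = (AV t. \<Sum>\<eta>\<in>{0..<int p}. mu u t \<eta> * mu u ((1 + 2 * D) * t) ((1 - 2 * D) * \<eta> - 2 * \<xi> * t))"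
  proof -
    have "per (\<lambda>t. \<Sum>\<eta>\<in>{0..<int p}. mu u t \<eta> * mu u ((1 + 2 * D) * t) ((1 - 2 * D) * \<eta> - 2 * \<xi> * t))"
    proof (intro per_sum per_mult per_mu_1 u)
      fix \<eta>
      show "per (\<lambda>t. mu u ((1 + 2 * D) * t) ((1 - 2 * D) * \<eta> - 2 * \<xi> * t))"
        unfolding mu_def four_sq_def
        by (intro per_power per_cmod per_E per_mult per_const per_cnj bdc[OF u] per_eec cgp_intros)
    qed
    from E_neg[OF this] show ?thesis by (simp only: F_def[abs_def])
  qed
  finally show ?thesis .
qed

end

section \<open>Positive definiteness and lines through the origin\<close>

lemma weighted_CS:
  fixes w x :: "'a \<Rightarrow> real"
  assumes "finite S" "\<And>s. s \<in> S \<Longrightarrow> 0 \<le> w s" "(\<Sum>s\<in>S. w s) \<le> 1"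
  shows "(\<Sum>s\<in>S. w s * x s)\<^sup>2 \<le> (\<Sum>s\<in>S. w s * (x s)\<^sup>2)"
proof -
  have "(\<Sum>s\<in>S. w s * x s)\<^sup>2 = (\<Sum>s\<in>S. sqrt (w s) * (sqrt (w s) * x s))\<^sup>2"
    using assms(2) by (intro arg_cong[where f="\<lambda>t. t\<^sup>2"] sum.cong) (auto simp: mult.assoc[symmetric])
  also have "\<dots> \<le> (\<Sum>s\<in>S. (sqrt (w s))\<^sup>2) * (\<Sum>s\<in>S. (sqrt (w s) * x s)\<^sup>2)"
    by (rule Cauchy_Schwarz_ineq_sum)
  also have "\<dots> = (\<Sum>s\<in>S. w s) * (\<Sum>s\<in>S. w s * (x s)\<^sup>2)"
    using assms(2) by (simp add: power_mult_distrib)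
  also have "\<dots> \<le> 1 * (\<Sum>s\<in>S. w s * (x s)\<^sup>2)"
    using assms by (intro mult_right_mono sum_nonneg) auto
  finally show ?thesis by simp
qed

context prime_mod begin

text \<open>A mean in the shift and a sum in the frequency: the normalization in which
  \<open>mu u\<close> has mass at most one, so that \<open>psum_CS\<close> loses no power of
  \<open>p\<close>.\<close>

definition psum :: "(int \<Rightarrow> int \<Rightarrow> real) \<Rightarrow> real"
  where "psum f = (AV v. \<Sum>\<eta>\<in>{0..<int p}. f v \<eta>)"

lemma psum_eq: "psum f = (\<Sum>z\<in>{0..<int p} \<times> {0..<int p}. f (fst z) (snd z) / real p)"
  unfolding psum_def E_def by (simp add: sum.cartesian_product case_prod_unfold sum_divide_distrib)

lemma psum_mono: "(\<And>v \<eta>. f v \<eta> \<le> g v \<eta>) \<Longrightarrow> psum f \<le> psum g"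
  unfolding psum_def by (intro E_mono sum_mono) auto

lemma psum_nonneg: "(\<And>v \<eta>. 0 \<le> f v \<eta>) \<Longrightarrow> 0 \<le> psum f"
  unfolding psum_def by (intro E_nonneg sum_nonneg) auto

lemma psum_sum: "psum (\<lambda>v \<eta>. \<Sum>i\<in>I. f i v \<eta>) = (\<Sum>i\<in>I. psum (f i))"
  unfolding psum_def by (subst sum.swap) (rule E_sum)

lemma psum_cmult: "psum (\<lambda>v \<eta>. c * f v \<eta>) = c * psum f"
  unfolding psum_def by (simp add: sum_distrib_left[symmetric] E_cmult_left)

lemma psum_mu_le_1: "bd u \<Longrightarrow> psum (mu u) \<le> 1"
  unfolding psum_def by (intro E_le_const sum_mu_le_1)

lemma psum_CS:
  assumes u: "bd u"
  shows "(psum (\<lambda>v \<eta>. mu u v \<eta> * f v \<eta>))\<^sup>2 \<le> psum (\<lambda>v \<eta>. mu u v \<eta> * (f v \<eta>)\<^sup>2)"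
  using weighted_CS[of "{0..<int p} \<times> {0..<int p}" "\<lambda>z. mu u (fst z) (snd z) / real p" "\<lambda>z. f (fst z) (snd z)"]
    psum_mu_le_1[OF u] by (simp add: psum_eq)

text \<open>An invertible lower triangular matrix permutes the points \<open>(v, \<eta>)\<close>
  modulo \<open>p\<close>.\<close>

lemma psum_subst:
  assumes f1: "\<And>\<eta>. per (\<lambda>v. f v \<eta>)" and f2: "\<And>v. per (f v)" and m: "\<not> int p dvd m" and r: "\<not> int p dvd r"
  shows "psum (\<lambda>v \<eta>. f (m * v) (r * \<eta> + t * v)) = psum f"
proof -
  have "(AV \<eta>. f (m * v) (r * \<eta> + t * v)) = E (f (m * v))" for v
  proof -
    have "per (\<lambda>\<eta>. f (m * v) (\<eta> + t * v))" by (rule per_comp[OF f2]) (intro cgp_intros)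
    from E_dil[OF this r] E_shift[OF f2] show ?thesis by simp
  qed
  moreover have "(AV v. E (f (m * v))) = (AV v. E (f v))"
    by (rule E_dil[OF per_E[OF f1] m])
  ultimately show ?thesis by (simp add: psum_def sum_E E_cmult_left)
qed

text \<open>By \<open>mu_self_dual\<close> the left-hand sum is the integral of a combination
  \<open>S'\<close> of characters against the measure \<open>mu u\<close>, and a quadratic form in
  differences is the integral of a squared modulus. Splitting \<open>S'\<close> by the value of
  \<open>r\<close> and applying Cauchy--Schwarz to the \<open>p\<close> classes restricts the form
  to pairs within a class, at the cost of a factor \<open>p\<close>.\<close>

lemma mu_pos_def:
  assumes u: "bd u" and I: "finite I" and r: "\<And>i. i \<in> I \<Longrightarrow> r i \<in> {0..<int p}"
  shows "(\<Sum>i\<in>I. a i * mu u (h i) (\<eta> i))\<^sup>2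
    \<le> real p * (\<Sum>i\<in>I. \<Sum>j\<in>{j\<in>I. r j = r i}. a i * a j * mu u (h i - h j) (\<eta> i - \<eta> j))"
proof -
  let ?Z = "{0..<int p}"
  define \<phi> where "\<phi> i k \<zeta> = ee (\<eta> i * k - \<zeta> * h i)" for i k \<zeta>
  define S where "S c k \<zeta> = (\<Sum>i\<in>{i\<in>I. r i = c}. complex_of_real (a i) * \<phi> i k \<zeta>)" for c k \<zeta>
  define S' where "S' k \<zeta> = (\<Sum>i\<in>I. complex_of_real (a i) * \<phi> i k \<zeta>)" for k \<zeta>
  have S': "S' k \<zeta> = (\<Sum>c\<in>?Z. S c k \<zeta>)" for k \<zeta>
    unfolding S'_def S_def using r by (intro sum.group[symmetric] I) auto
  have msd: "complex_of_real (mu u (h i) (\<eta> i)) = (AV k. \<Sum>\<zeta>\<in>?Z. complex_of_real (mu u k \<zeta>) * \<phi> i k \<zeta>)" for i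
    unfolding \<phi>_def by (rule mu_self_dual[OF u])
  have msd2: "complex_of_real (mu u (h i - h j) (\<eta> i - \<eta> j)) = (AV k. \<Sum>\<zeta>\<in>?Z. complex_of_real (mu u k \<zeta>) * ee ((\<eta> i - \<eta> j) * k - \<zeta> * (h i - h j)))" for i j
    by (rule mu_self_dual[OF u])
  have 1: "complex_of_real (\<Sum>i\<in>I. a i * mu u (h i) (\<eta> i)) = (AV k. \<Sum>\<zeta>\<in>?Z. complex_of_real (mu u k \<zeta>) * S' k \<zeta>)"
  proof -
    have "complex_of_real (\<Sum>i\<in>I. a i * mu u (h i) (\<eta> i)) = (\<Sum>i\<in>I. complex_of_real (a i) * (AV k. \<Sum>\<zeta>\<in>?Z. complex_of_real (mu u k \<zeta>) * \<phi> i k \<zeta>))"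
      by (simp only: of_real_sum of_real_mult msd)
    also have "\<dots> = (AV k. \<Sum>i\<in>I. \<Sum>\<zeta>\<in>?Z. complex_of_real (mu u k \<zeta>) * (complex_of_real (a i) * \<phi> i k \<zeta>))"
      by (simp only: E_sum E_cmult_left[symmetric] sum_distrib_left mult.left_commute)
    also have "\<dots> = (AV k. \<Sum>\<zeta>\<in>?Z. \<Sum>i\<in>I. complex_of_real (mu u k \<zeta>) * (complex_of_real (a i) * \<phi> i k \<zeta>))"
      by (subst sum.swap) (rule refl)
    finally show ?thesis by (simp add: S'_def sum_distrib_left)
  qed
  have 2: "complex_of_real (\<Sum>i\<in>I. \<Sum>j\<in>{j\<in>I. r j = r i}. a i * a j * mu u (h i - h j) (\<eta> i - \<eta> j))
    = (AV k. \<Sum>\<zeta>\<in>?Z. complex_of_real (mu u k \<zeta>) * (\<Sum>c\<in>?Z. complex_of_real ((cmod (S c k \<zeta>))\<^sup>2)))"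
  proof -
    have SS: "(\<Sum>c\<in>?Z. complex_of_real ((cmod (S c k \<zeta>))\<^sup>2)) = (\<Sum>i\<in>I. \<Sum>j\<in>{j\<in>I. r j = r i}. complex_of_real (a i * a j) * ee ((\<eta> i - \<eta> j) * k - \<zeta> * (h i - h j)))" for k \<zeta>
    proof -
      have ph: "\<phi> i k \<zeta> * cnj (\<phi> j k \<zeta>) = ee ((\<eta> i - \<eta> j) * k - \<zeta> * (h i - h j))" for i j
        by (simp add: \<phi>_def cnj_ee ee_add[symmetric] algebra_simps)
      have "(\<Sum>c\<in>?Z. complex_of_real ((cmod (S c k \<zeta>))\<^sup>2)) = (\<Sum>c\<in>?Z. S c k \<zeta> * cnj (S c k \<zeta>))"
        by (simp only: complex_norm_square)
      also have "\<dots> = (\<Sum>c\<in>?Z. \<Sum>i\<in>{i\<in>I. r i = c}. \<Sum>j\<in>{j\<in>I. r j = c}. complex_of_real (a i * a j) * (\<phi> i k \<zeta> * cnj (\<phi> j k \<zeta>)))"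
        unfolding S_def cnj_sum sum_product by (intro sum.cong refl) (simp add: mult_ac)
      also have "\<dots> = (\<Sum>c\<in>?Z. \<Sum>i\<in>{i\<in>I. r i = c}. \<Sum>j\<in>{j\<in>I. r j = r i}. complex_of_real (a i * a j) * (\<phi> i k \<zeta> * cnj (\<phi> j k \<zeta>)))"
        by (intro sum.cong refl) auto
      also have "\<dots> = (\<Sum>i\<in>I. \<Sum>j\<in>{j\<in>I. r j = r i}. complex_of_real (a i * a j) * (\<phi> i k \<zeta> * cnj (\<phi> j k \<zeta>)))"
        using r by (intro sum.group I) auto
      finally show ?thesis unfolding ph .
    qed
    have "complex_of_real (\<Sum>i\<in>I. \<Sum>j\<in>{j\<in>I. r j = r i}. a i * a j * mu u (h i - h j) (\<eta> i - \<eta> j))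
      = (\<Sum>i\<in>I. \<Sum>j\<in>{j\<in>I. r j = r i}. (AV k. \<Sum>\<zeta>\<in>?Z. complex_of_real (mu u k \<zeta>) * (complex_of_real (a i * a j) * ee ((\<eta> i - \<eta> j) * k - \<zeta> * (h i - h j)))))"
      by (simp only: of_real_sum of_real_mult msd2 E_cmult_left[symmetric] sum_distrib_left mult_ac)
    also have "\<dots> = (AV k. \<Sum>i\<in>I. \<Sum>j\<in>{j\<in>I. r j = r i}. \<Sum>\<zeta>\<in>?Z. complex_of_real (mu u k \<zeta>) * (complex_of_real (a i * a j) * ee ((\<eta> i - \<eta> j) * k - \<zeta> * (h i - h j))))"
      by (simp only: E_sum)
    also have "\<dots> = (AV k. \<Sum>i\<in>I. \<Sum>\<zeta>\<in>?Z. \<Sum>j\<in>{j\<in>I. r j = r i}. complex_of_real (mu u k \<zeta>) * (complex_of_real (a i * a j) * ee ((\<eta> i - \<eta> j) * k - \<zeta> * (h i - h j))))"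
      by (intro E_cong sum.cong refl sum.swap)
    also have "\<dots> = (AV k. \<Sum>\<zeta>\<in>?Z. \<Sum>i\<in>I. \<Sum>j\<in>{j\<in>I. r j = r i}. complex_of_real (mu u k \<zeta>) * (complex_of_real (a i * a j) * ee ((\<eta> i - \<eta> j) * k - \<zeta> * (h i - h j))))"
      by (intro E_cong sum.swap)
    also have "\<dots> = (AV k. \<Sum>\<zeta>\<in>?Z. complex_of_real (mu u k \<zeta>) * (\<Sum>i\<in>I. \<Sum>j\<in>{j\<in>I. r j = r i}. complex_of_real (a i * a j) * ee ((\<eta> i - \<eta> j) * k - \<zeta> * (h i - h j))))"
      by (simp only: sum_distrib_left)
    finally show ?thesis unfolding SS .
  qed
  have "(cmod (S' k \<zeta>))\<^sup>2 \<le> real p * (\<Sum>c\<in>?Z. (cmod (S c k \<zeta>))\<^sup>2)" for k \<zeta>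
  proof -
    have "(cmod (S' k \<zeta>))\<^sup>2 \<le> (\<Sum>c\<in>?Z. 1 * cmod (S c k \<zeta>))\<^sup>2"
      unfolding S' by (intro power_mono) (simp_all add: norm_sum)
    also have "\<dots> \<le> (\<Sum>c\<in>?Z. 1\<^sup>2) * (\<Sum>c\<in>?Z. (cmod (S c k \<zeta>))\<^sup>2)"
      by (rule Cauchy_Schwarz_ineq_sum)
    finally show ?thesis by simp
  qed
  then have 3: "psum (\<lambda>k \<zeta>. mu u k \<zeta> * (cmod (S' k \<zeta>))\<^sup>2) \<le> psum (\<lambda>k \<zeta>. mu u k \<zeta> * (real p * (\<Sum>c\<in>?Z. (cmod (S c k \<zeta>))\<^sup>2)))"
    by (intro psum_mono mult_left_mono) auto
  have "\<bar>\<Sum>i\<in>I. a i * mu u (h i) (\<eta> i)\<bar> = cmod (complex_of_real (\<Sum>i\<in>I. a i * mu u (h i) (\<eta> i)))"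
    by (simp only: norm_of_real)
  also have "\<dots> \<le> psum (\<lambda>k \<zeta>. mu u k \<zeta> * cmod (S' k \<zeta>))"
    unfolding 1 psum_def
    by (rule order_trans[OF cmod_E], rule E_mono, rule order_trans[OF norm_sum]) (simp add: norm_mult)
  finally have "\<bar>\<Sum>i\<in>I. a i * mu u (h i) (\<eta> i)\<bar>\<^sup>2 \<le> (psum (\<lambda>k \<zeta>. mu u k \<zeta> * cmod (S' k \<zeta>)))\<^sup>2"
    by (rule power_mono) simp
  also have "\<dots> \<le> psum (\<lambda>k \<zeta>. mu u k \<zeta> * (cmod (S' k \<zeta>))\<^sup>2)" by (rule psum_CS[OF u])
  also have "\<dots> \<le> psum (\<lambda>k \<zeta>. mu u k \<zeta> * (real p * (\<Sum>c\<in>?Z. (cmod (S c k \<zeta>))\<^sup>2)))" by (rule 3)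
  finally have 4: "(\<Sum>i\<in>I. a i * mu u (h i) (\<eta> i))\<^sup>2 \<le> real p * psum (\<lambda>k \<zeta>. mu u k \<zeta> * (\<Sum>c\<in>?Z. (cmod (S c k \<zeta>))\<^sup>2))"
    by (simp add: psum_cmult[symmetric] mult_ac)
  have "complex_of_real (\<Sum>i\<in>I. \<Sum>j\<in>{j\<in>I. r j = r i}. a i * a j * mu u (h i - h j) (\<eta> i - \<eta> j))
     = complex_of_real (psum (\<lambda>k \<zeta>. mu u k \<zeta> * (\<Sum>c\<in>?Z. (cmod (S c k \<zeta>))\<^sup>2)))"
    unfolding 2 psum_def E_of_real[symmetric] by simp
  then have "(\<Sum>i\<in>I. \<Sum>j\<in>{j\<in>I. r j = r i}. a i * a j * mu u (h i - h j) (\<eta> i - \<eta> j)) = psum (\<lambda>k \<zeta>. mu u k \<zeta> * (\<Sum>c\<in>?Z. (cmod (S c k \<zeta>))\<^sup>2))"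
    by (simp only: of_real_eq_iff)
  with 4 show ?thesis by simp
qed

text \<open>Pairs of maps that agree on the fibres differ by a map onto a line through the origin, so
  positive definiteness forces \<open>mu u\<close> to be large on such lines.\<close>

lemma lines:
  assumes u: "bd u" and I: "finite I" and r: "\<And>i. i \<in> I \<Longrightarrow> r i \<in> {0..<int p} \<and> \<not> int p dvd r i"
  shows "(\<Sum>i\<in>I. psum (\<lambda>v \<eta>. mu u v \<eta> * mu u (m i * v) (r i * \<eta> + t i * v))) ^ 4
    \<le> real p * (real (card I))\<^sup>2 * (\<Sum>i\<in>I. \<Sum>j\<in>{j\<in>I. r j = r i}. (AV v. mu u ((m i - m j) * v) ((t i - t j) * v)))"
proof -
  define M where "M i v \<eta> = mu u (m i * v) (r i * \<eta> + t i * v)" for i v \<eta>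
  define L where "L i j v = mu u ((m i - m j) * v) ((t i - t j) * v)" for i j v
  have M: "0 \<le> M i v \<eta>" "M i v \<eta> \<le> 1" for i v \<eta>
    unfolding M_def by (simp_all add: mu_le_1[OF u])
  have L: "0 \<le> L i j v" for i j v unfolding L_def by simp
  define Y where "Y v \<eta> = (\<Sum>i\<in>I. M i v \<eta>)" for v \<eta>
  define N where "N = (real (card I))\<^sup>2 * real p"
  have Y: "(Y v \<eta>) ^ 4 \<le> N * (\<Sum>i\<in>I. \<Sum>j\<in>{j\<in>I. r j = r i}. M i v \<eta> * L i j v)" for v \<eta>
  proof -
    have "(Y v \<eta>)\<^sup>2 \<le> real (card I) * (\<Sum>i\<in>I. M i v \<eta> * M i v \<eta>)"
      using Cauchy_Schwarz_ineq_sum[of "\<lambda>_. 1" "\<lambda>i. M i v \<eta>" I] by (simp add: Y_def power2_eq_square)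
    then have "((Y v \<eta>)\<^sup>2)\<^sup>2 \<le> (real (card I) * (\<Sum>i\<in>I. M i v \<eta> * M i v \<eta>))\<^sup>2"
      by (rule power_mono) simp
    also have "\<dots> = (real (card I))\<^sup>2 * (\<Sum>i\<in>I. M i v \<eta> * M i v \<eta>)\<^sup>2" by (rule power_mult_distrib)
    \<comment> \<open>The values \<open>M i v \<eta>\<close> serve as weights as well: the sum of
      their squares is then linear in \<open>mu u\<close>, as positive definiteness
      requires.\<close>
    also have "\<dots> \<le> (real (card I))\<^sup>2 * (real p * (\<Sum>i\<in>I. \<Sum>j\<in>{j\<in>I. r j = r i}. M i v \<eta> * M j v \<eta> * mu u (m i * v - m j * v) (r i * \<eta> + t i * v - (r j * \<eta> + t j * v))))"
      using mu_pos_def[OF u I, of r "\<lambda>i. M i v \<eta>" "\<lambda>i. m i * v" "\<lambda>i. r i * \<eta> + t i * v"] r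
      by (intro mult_left_mono) (simp_all add: M_def)
    also have "\<dots> \<le> (real (card I))\<^sup>2 * (real p * (\<Sum>i\<in>I. \<Sum>j\<in>{j\<in>I. r j = r i}. M i v \<eta> * L i j v))"
    proof (intro mult_left_mono sum_mono)
      \<comment> \<open>Within a class \<open>\<eta>\<close> cancels from the difference of the two
        images, which leaves a point of a line through the origin.\<close>
      fix i j assume "j \<in> {j\<in>I. r j = r i}"
      then have "mu u (m i * v - m j * v) (r i * \<eta> + t i * v - (r j * \<eta> + t j * v)) = L i j v"
        by (simp add: L_def left_diff_distrib)
      moreover have "M i v \<eta> * M j v \<eta> * L i j v \<le> M i v \<eta> * 1 * L i j v"
        using M L by (intro mult_right_mono mult_left_mono) auto
      ultimately show "M i v \<eta> * M j v \<eta> * mu u (m i * v - m j * v) (r i * \<eta> + t i * v - (r j * \<eta> + t j * v)) \<le> M i v \<eta> * L i j v"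
        by simp
    qed auto
    finally show ?thesis by (simp add: N_def mult.assoc)
  qed
  have "(\<Sum>i\<in>I. psum (\<lambda>v \<eta>. mu u v \<eta> * mu u (m i * v) (r i * \<eta> + t i * v))) ^ 4 = ((psum (\<lambda>v \<eta>. mu u v \<eta> * Y v \<eta>))\<^sup>2)\<^sup>2"
    by (simp add: Y_def M_def psum_sum[symmetric] sum_distrib_left)
  also have "\<dots> \<le> (psum (\<lambda>v \<eta>. mu u v \<eta> * (Y v \<eta>)\<^sup>2))\<^sup>2"
    by (intro power_mono psum_CS u) simp
  also have "\<dots> \<le> psum (\<lambda>v \<eta>. mu u v \<eta> * ((Y v \<eta>)\<^sup>2)\<^sup>2)" by (rule psum_CS[OF u])
  also have "\<dots> \<le> psum (\<lambda>v \<eta>. N * (\<Sum>i\<in>I. \<Sum>j\<in>{j\<in>I. r j = r i}. M i v \<eta> * L i j v))"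
  proof (rule psum_mono)
    fix v \<eta>
    have "mu u v \<eta> * ((Y v \<eta>)\<^sup>2)\<^sup>2 \<le> 1 * ((Y v \<eta>)\<^sup>2)\<^sup>2" by (intro mult_right_mono mu_le_1 u) simp
    with Y[of v \<eta>] show "mu u v \<eta> * ((Y v \<eta>)\<^sup>2)\<^sup>2 \<le> N * (\<Sum>i\<in>I. \<Sum>j\<in>{j\<in>I. r j = r i}. M i v \<eta> * L i j v)" by simp
  qed
  also have "\<dots> = N * (\<Sum>i\<in>I. \<Sum>j\<in>{j\<in>I. r j = r i}. psum (\<lambda>v \<eta>. M i v \<eta> * L i j v))"
    by (simp only: psum_cmult psum_sum)
  also have "\<dots> \<le> N * (\<Sum>i\<in>I. \<Sum>j\<in>{j\<in>I. r j = r i}. E (L i j))"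
  proof (intro mult_left_mono sum_mono)
    fix i j assume i: "i \<in> I"
    \<comment> \<open>Only \<open>M i\<close> still depends on \<open>\<eta>\<close>. As
      \<open>r i\<close> is invertible, its sum over \<open>\<eta>\<close> is the mass of
      \<open>mu u\<close> on one vertical line.\<close>
    have "(\<Sum>\<eta>\<in>{0..<int p}. M i v \<eta>) \<le> 1" for v
    proof -
      have "per (\<lambda>\<eta>. mu u (m i * v) (\<eta> + t i * v))"
        by (rule per_comp[OF per_mu_2]) (intro cgp_intros)
      from E_dil[OF this] E_shift[OF per_mu_2] i r have "E (M i v) = E (mu u (m i * v))"
        by (simp add: M_def[abs_def])
      then have "(\<Sum>\<eta>\<in>{0..<int p}. M i v \<eta>) = (\<Sum>\<eta>\<in>{0..<int p}. mu u (m i * v) \<eta>)"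
        by (simp add: sum_E)
      then show ?thesis using sum_mu_le_1[OF u] by simp
    qed
    then have "(\<Sum>\<eta>\<in>{0..<int p}. M i v \<eta>) * L i j v \<le> 1 * L i j v" for v
      using L by (intro mult_right_mono)
    then show "psum (\<lambda>v \<eta>. M i v \<eta> * L i j v) \<le> E (L i j)"
      unfolding psum_def sum_distrib_right[symmetric] by (intro E_mono) simp
  qed (simp add: N_def)
  finally show ?thesis by (simp add: N_def L_def[abs_def] mult_ac)
qed

section \<open>Quotients of the triangular matrices\<close>

lemma prime_int_p: "prime (int p)"
  using prime by simp

lemma ex_inverse: "\<not> int p dvd a \<Longrightarrow> \<exists>b. [a * b = 1] (mod int p)"
  using cong_solve_coprime_int[OF coprime_p] by simp

definition inv_mod :: "int \<Rightarrow> int" where "inv_mod a = (SOME b. [a * b = 1] (mod int p))"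

lemma inv_mod: "\<not> int p dvd a \<Longrightarrow> [a * inv_mod a = 1] (mod int p)"
  unfolding inv_mod_def by (rule someI_ex[OF ex_inverse])

text \<open>The differences whose triangular matrix in \<open>elimination\<close> is
  invertible.\<close>

definition goodset :: "int set"
  where "goodset = {d \<in> {0..<int p}. \<not> int p dvd 1 + 2 * d \<and> \<not> int p dvd 1 - 2 * d}"

lemma goodset: "finite goodset" "goodset \<subseteq> {0..<int p}" "card goodset \<le> p"
proof -
  show sub: "goodset \<subseteq> {0..<int p}" by (auto simp: goodset_def)
  then show "finite goodset" by (rule finite_subset) simp
  have "card goodset \<le> card {0..<int p}" by (rule card_mono[OF _ sub]) simp
  then show "card goodset \<le> p" by simp
qed

text \<open>For a pair of differences, \<open>ratio\<close> and \<open>slope\<close> are the second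
  and first diagonal entries of the quotient of their matrices. Only \<open>ratio\<close> is reduced
  modulo \<open>p\<close>, because it serves as the class label in \<open>lines\<close>.\<close>

definition ratio :: "int \<times> int \<Rightarrow> int"
  where "ratio i = ((1 - 2 * fst i) * inv_mod (1 - 2 * snd i)) mod int p"

definition slope :: "int \<times> int \<Rightarrow> int"
  where "slope i = (1 + 2 * fst i) * inv_mod (1 + 2 * snd i)"

lemma cong_eqD: "x \<in> {0..<int p} \<Longrightarrow> y \<in> {0..<int p} \<Longrightarrow> int p dvd x - y \<Longrightarrow> x = y"
  by (auto simp: mod_eq_dvd_iff[symmetric])

lemma cross_mult:
  assumes "\<not> int p dvd b" "\<not> int p dvd d" "[a * inv_mod b = c * inv_mod d] (mod int p)"
  shows "[a * d = c * b] (mod int p)"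
proof -
  have "[(a * inv_mod b) * (b * d) = (c * inv_mod d) * (b * d)] (mod int p)"
    using assms(3) by (rule cong_mult) (rule cong_refl)
  moreover have "[(a * d) * (b * inv_mod b) = (a * d) * 1] (mod int p)"
    by (rule cong_mult[OF cong_refl inv_mod[OF assms(1)]])
  moreover have "[(c * b) * (d * inv_mod d) = (c * b) * 1] (mod int p)"
    by (rule cong_mult[OF cong_refl inv_mod[OF assms(2)]])
  ultimately show ?thesis by (simp add: cong_def mult_ac)
qed

lemma ratio_eqD:
  assumes "i \<in> goodset \<times> goodset" "j \<in> goodset \<times> goodset" "ratio i = ratio j"
  shows "[(1 - 2 * fst i) * (1 - 2 * snd j) = (1 - 2 * fst j) * (1 - 2 * snd i)] (mod int p)"
  by (rule cross_mult) (use assms in \<open>auto simp: goodset_def ratio_def cong_def\<close>)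

lemma dvd_cancel: "int p dvd a * b \<Longrightarrow> \<not> int p dvd a \<Longrightarrow> int p dvd b"
  using prime_int_p prime_dvd_mult_iff by blast

text \<open>For pairs \<open>(a, b)\<close> and \<open>(c, d)\<close> of equal ratio,
  \<open>c\<close> is determined by \<open>a\<close>, \<open>b\<close>, \<open>d\<close>: it solves
  a linear congruence with invertible leading coefficient.\<close>

lemma card_ratio_eq:
  "card {(i, j). i \<in> goodset \<times> goodset \<and> j \<in> goodset \<times> goodset \<and> ratio i = ratio j} \<le> p ^ 3"
    (is "card ?P \<le> _")
proof -
  define f :: "(int \<times> int) \<times> (int \<times> int) \<Rightarrow> int \<times> int \<times> int" where "f x = (fst (fst x), snd (fst x), snd (snd x))" for x
  have inj: "inj_on f ?P"
  proof (rule inj_onI)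
    fix x y assume xy: "x \<in> ?P" "y \<in> ?P" "f x = f y"
    obtain a b c d a' b' c' d' where abcd: "x = ((a, b), (c, d))" "y = ((a', b'), (c', d'))"
      by (metis surj_pair)
    from xy have D: "a \<in> goodset" "b \<in> goodset" "c \<in> goodset" "d \<in> goodset" "a' \<in> goodset" "b' \<in> goodset" "c' \<in> goodset" "d' \<in> goodset"
      and r: "ratio (a, b) = ratio (c, d)" "ratio (a', b') = ratio (c', d')"
      by (auto simp: abcd)
    from xy have eq: "a = a'" "b = b'" "d = d'" by (auto simp: f_def abcd)
    have e: "[(1 - 2 * a) * (1 - 2 * d) = (1 - 2 * c) * (1 - 2 * b)] (mod int p)"
      "[(1 - 2 * a) * (1 - 2 * d) = (1 - 2 * c') * (1 - 2 * b)] (mod int p)"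
      using ratio_eqD[of "(a, b)" "(c, d)"] ratio_eqD[of "(a', b')" "(c', d')"] D r eq by auto
    have "[(1 - 2 * c) * (1 - 2 * b) = (1 - 2 * c') * (1 - 2 * b)] (mod int p)"
      by (rule cong_trans[OF cong_sym[OF e(1)] e(2)])
    then have "int p dvd (1 - 2 * c) * (1 - 2 * b) - (1 - 2 * c') * (1 - 2 * b)" by (simp only: cong_iff_dvd_diff)
    then have c1: "int p dvd (1 - 2 * b) * (2 * (c' - c))" by (simp add: algebra_simps)
    have c2: "\<not> int p dvd 1 - 2 * b" using D(2) by (simp add: goodset_def)
    have "int p dvd c' - c" by (rule dvd_cancel[OF dvd_cancel[OF c1 c2] not_dvd_2])
    then have "c' = c" using D goodset(2) by (intro cong_eqD) auto
    with eq show "x = y" by (simp add: abcd)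
  qed
  have sub: "f ` ?P \<subseteq> goodset \<times> goodset \<times> goodset" by (auto simp: f_def)
  have "card ?P = card (f ` ?P)" using inj by (rule card_image[symmetric])
  also have "\<dots> \<le> card (goodset \<times> goodset \<times> goodset)" by (rule card_mono[OF _ sub]) (simp add: goodset)
  also have "\<dots> = card goodset * (card goodset * card goodset)" by (simp add: card_cartesian_product)
  also have "\<dots> \<le> p * (p * p)" by (intro mult_le_mono goodset)
  finally show ?thesis by (simp add: power3_eq_cube)
qed

text \<open>If both diagonal entries of the quotients for \<open>(a, b)\<close> and
  \<open>(c, d)\<close> agree, the sum and difference of the two relations give
  \<open>a + d = b + c\<close> and \<open>a * d = b * c\<close> modulo \<open>p\<close>. So either
  the two pairs are equal or both lie on the diagonal. Such pairs must be discarded: the difference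
  of their quotients maps into the vertical axis, where \<open>mu u\<close> may be large.\<close>

lemma card_degenerate:
  "card {(i, j). i \<in> goodset \<times> goodset \<and> j \<in> goodset \<times> goodset \<and> ratio i = ratio j \<and> int p dvd slope i - slope j} \<le> 2 * p\<^sup>2"
    (is "card ?P \<le> _")
proof -
  have "?P \<subseteq> (\<lambda>i. (i, i)) ` (goodset \<times> goodset) \<union> (\<lambda>(a, b). ((a, a), (b, b))) ` (goodset \<times> goodset)"
  proof
    fix x assume x: "x \<in> ?P"
    obtain a b c d where abcd: "x = ((a, b), (c, d))" by (metis surj_pair)
    from x have D: "a \<in> goodset" "b \<in> goodset" "c \<in> goodset" "d \<in> goodset"
      and r: "ratio (a, b) = ratio (c, d)" and s: "int p dvd slope (a, b) - slope (c, d)"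
      by (auto simp: abcd)
    have 1: "int p dvd (1 - 2 * a) * (1 - 2 * d) - (1 - 2 * c) * (1 - 2 * b)"
      using ratio_eqD[of "(a, b)" "(c, d)"] D r by (auto simp: cong_iff_dvd_diff)
    have "[(1 + 2 * a) * (1 + 2 * d) = (1 + 2 * c) * (1 + 2 * b)] (mod int p)"
      by (rule cross_mult) (use s D in \<open>auto simp: goodset_def slope_def cong_iff_dvd_diff\<close>)
    then have 2: "int p dvd (1 + 2 * a) * (1 + 2 * d) - (1 + 2 * c) * (1 + 2 * b)"
      by (simp only: cong_iff_dvd_diff)
    have "int p dvd 4 * (a + d - c - b)"
      using dvd_diff[OF 2 1] by (simp add: algebra_simps)
    then have 3: "int p dvd a + d - c - b" by (rule dvd_cancel[OF _ not_dvd_4])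
    have "int p dvd 4 * (2 * (a * d - c * b))"
      using dvd_add[OF 2 1] by (simp add: algebra_simps)
    then have 4: "int p dvd a * d - c * b" by (metis dvd_cancel not_dvd_4 not_dvd_2)
    have "int p dvd (a * d - c * b) - a * (a + d - c - b)"
      by (rule dvd_diff[OF 4 dvd_mult[OF 3]])
    then have "int p dvd (a - c) * (b - a)" by (simp add: algebra_simps)
    then consider "int p dvd a - c" | "int p dvd b - a" using dvd_cancel by blast
    then show "x \<in> (\<lambda>i. (i, i)) ` (goodset \<times> goodset) \<union> (\<lambda>(a, b). ((a, a), (b, b))) ` (goodset \<times> goodset)"
    proof cases
      case 1
      then have "a = c" using D goodset(2) by (intro cong_eqD) auto
      moreover from this 3 D goodset(2) have "d = b" by (intro cong_eqD) auto
      ultimately show ?thesis using D by (auto simp: abcd)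
    next
      case 2
      then have "b = a" using D goodset(2) by (intro cong_eqD) auto
      moreover from this 3 D goodset(2) have "d = c" by (intro cong_eqD) auto
      ultimately show ?thesis using D by (auto simp: abcd)
    qed
  qed
  then have "card ?P \<le> card ((\<lambda>i. (i, i)) ` (goodset \<times> goodset) \<union> (\<lambda>(a, b). ((a, a), (b, b))) ` (goodset \<times> goodset))"
    by (rule card_mono[rotated]) (simp add: goodset)
  also have "\<dots> \<le> card (goodset \<times> goodset) + card (goodset \<times> goodset)"
    by (rule order_trans[OF card_Un_le add_mono]; rule card_image_le) (simp_all add: goodset)
  also have "\<dots> \<le> p * p + p * p"
    unfolding card_cartesian_product by (intro add_mono mult_le_mono goodset)
  finally show ?thesis by (simp add: power2_eq_square)
qed

text \<open>Here \<open>R d\<close> is the overlap of \<open>mu u\<close> with its image under the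
  matrix of \<open>d\<close>. Squaring the sum over \<open>d\<close> and substituting the inverse of
  one of the two matrices produces overlaps with quotients, to which \<open>lines\<close> applies.
  The powers of \<open>p\<close> balance: \<open>p\<close> classes, the square of
  \<open>p\<^sup>2\<close> indices and \<open>p ^ 3\<close> pairs give \<open>p ^ 8\<close>, and the
  \<open>2 * p\<^sup>2\<close> degenerate pairs contribute the error \<open>2 / p\<close>.\<close>

lemma mu_dilates_le:
  assumes u: "bd u"
    and R: "\<And>d. R d = psum (\<lambda>v \<eta>. mu u v \<eta> * mu u ((1 + 2 * d) * v) ((1 - 2 * d) * \<eta> + t d * v))"
    and lam: "0 \<le> \<Lambda>" "\<And>m s. \<not> int p dvd m \<Longrightarrow> (AV v. mu u (m * v) (s * v)) \<le> \<Lambda>"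
  shows "(\<Sum>d\<in>goodset. R d) ^ 8 \<le> real p ^ 8 * (\<Lambda> + 2 / real p)"
proof -
  let ?Z = "{0..<int p}"
  define M where "M d v \<eta> = mu u ((1 + 2 * d) * v) ((1 - 2 * d) * \<eta> + t d * v)" for d v \<eta>
  define m where "m = slope"
  \<comment> \<open>The off-diagonal entry of the quotient matrix.\<close>
  define \<theta> where "\<theta> i = inv_mod (1 + 2 * snd i) * (t (fst i) - ratio i * t (snd i))" for i
  define I where "I = goodset \<times> goodset"
  have I: "finite I" "card I \<le> p * p"
    unfolding I_def card_cartesian_product by (auto intro!: mult_le_mono goodset)
  have R0: "0 \<le> R d" for d unfolding R by (intro psum_nonneg mult_nonneg_nonneg mu_nonneg)
  have rat: "ratio i \<in> ?Z \<and> \<not> int p dvd ratio i" if "i \<in> I" for i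
  proof -
    have g: "\<not> int p dvd 1 - 2 * fst i" "\<not> int p dvd 1 - 2 * snd i" using that by (auto simp: I_def goodset_def)
    have "\<not> int p dvd inv_mod (1 - 2 * snd i)"
    proof
      assume "int p dvd inv_mod (1 - 2 * snd i)"
      then have "int p dvd (1 - 2 * snd i) * inv_mod (1 - 2 * snd i)" by simp
      with inv_mod[OF g(2)] not_dvd_1 show False using cong_dvd_iff by blast
    qed
    with g have "\<not> int p dvd (1 - 2 * fst i) * inv_mod (1 - 2 * snd i)" using dvd_cancel by blast
    then show ?thesis using p_pos by (simp add: ratio_def dvd_mod_iff)
  qed
  have sub: "psum (\<lambda>v \<eta>. M d v \<eta> * M d' v \<eta>) = psum (\<lambda>v \<eta>. mu u v \<eta> * mu u (m (d, d') * v) (ratio (d, d') * \<eta> + \<theta> (d, d') * v))"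
    if d: "d \<in> goodset" "d' \<in> goodset" for d d'
  proof -
    define f where "f v \<eta> = mu u v \<eta> * mu u (m (d, d') * v) (ratio (d, d') * \<eta> + \<theta> (d, d') * v)" for v \<eta>
    have pf: "per (\<lambda>v. f v \<eta>)" "per (f v)" for v \<eta>
    proof -
      have "per (\<lambda>v. mu u (m (d, d') * v) (ratio (d, d') * \<eta> + \<theta> (d, d') * v))"
        unfolding mu_def four_sq_def
        by (intro per_power per_cmod per_E per_mult per_const per_cnj bdc[OF u] per_eec cgp_intros)
      then show "per (\<lambda>v. f v \<eta>)" unfolding f_def by (intro per_mult per_mu_1 u)
      show "per (f v)" unfolding f_def by (intro per_mult per_mu_2 per_comp[OF per_mu_2] cgp_intros)
    qed
    have g: "\<not> int p dvd 1 + 2 * d'" "\<not> int p dvd 1 - 2 * d'" using d by (auto simp: goodset_def)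
    have i1: "[inv_mod (1 + 2 * d') * (1 + 2 * d') = 1] (mod int p)" and i2: "[inv_mod (1 - 2 * d') * (1 - 2 * d') = 1] (mod int p)"
      using inv_mod g by (simp_all add: mult.commute)
    have rm: "[ratio (d, d') * (1 - 2 * d') = 1 - 2 * d] (mod int p)"
    proof -
      have "[ratio (d, d') * (1 - 2 * d') = ((1 - 2 * d) * inv_mod (1 - 2 * d')) * (1 - 2 * d')] (mod int p)"
        unfolding ratio_def by (intro cong_mult) simp_all
      moreover have "[(1 - 2 * d) * (inv_mod (1 - 2 * d') * (1 - 2 * d')) = (1 - 2 * d) * 1] (mod int p)"
        by (intro cong_mult cong_refl i2)
      ultimately show ?thesis by (simp add: mult.assoc cong_trans)
    qed
    have fM: "f ((1 + 2 * d') * v) ((1 - 2 * d') * \<eta> + t d' * v) = M d v \<eta> * M d' v \<eta>" for v \<eta>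
    proof -
      have c1: "[m (d, d') * ((1 + 2 * d') * v) = (1 + 2 * d) * v] (mod int p)"
        using cong_mult[OF i1 cong_refl[of "(1 + 2 * d) * v"]] by (simp add: m_def slope_def mult_ac)
      have h: "[\<theta> (d, d') * ((1 + 2 * d') * v) = (t d - ratio (d, d') * t d') * v] (mod int p)"
        using cong_mult[OF i1 cong_refl[of "(t d - ratio (d, d') * t d') * v"]] by (simp add: \<theta>_def mult_ac)
      have "[(ratio (d, d') * (1 - 2 * d')) * \<eta> + ratio (d, d') * t d' * v + \<theta> (d, d') * ((1 + 2 * d') * v) = (1 - 2 * d) * \<eta> + ratio (d, d') * t d' * v + (t d - ratio (d, d') * t d') * v] (mod int p)"
        by (rule cong_add[OF cong_add[OF cong_mult[OF rm cong_refl] cong_refl] h])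
      then have c2: "[ratio (d, d') * ((1 - 2 * d') * \<eta> + t d' * v) + \<theta> (d, d') * ((1 + 2 * d') * v) = (1 - 2 * d) * \<eta> + t d * v] (mod int p)"
        by (simp add: algebra_simps)
      show ?thesis
        unfolding f_def M_def per_cong[OF per_mu_1[OF u] c1] per_cong[OF per_mu_2 c2] by (rule mult.commute)
    qed
    have "psum f = psum (\<lambda>v \<eta>. f ((1 + 2 * d') * v) ((1 - 2 * d') * \<eta> + t d' * v))"
      by (rule psum_subst[OF pf g, symmetric])
    also have "\<dots> = psum (\<lambda>v \<eta>. M d v \<eta> * M d' v \<eta>)" by (simp only: fM)
    finally show ?thesis by (simp add: f_def[abs_def])
  qed
  have "(\<Sum>d\<in>goodset. R d)\<^sup>2 = (psum (\<lambda>v \<eta>. mu u v \<eta> * (\<Sum>d\<in>goodset. M d v \<eta>)))\<^sup>2"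
    by (simp add: R M_def psum_sum[symmetric] sum_distrib_left)
  also have "\<dots> \<le> psum (\<lambda>v \<eta>. mu u v \<eta> * (\<Sum>d\<in>goodset. M d v \<eta>)\<^sup>2)" by (rule psum_CS[OF u])
  also have "\<dots> \<le> psum (\<lambda>v \<eta>. \<Sum>d\<in>goodset. \<Sum>d'\<in>goodset. M d v \<eta> * M d' v \<eta>)"
  proof (rule psum_mono)
    fix v \<eta>
    have "mu u v \<eta> * (\<Sum>d\<in>goodset. M d v \<eta>)\<^sup>2 \<le> 1 * (\<Sum>d\<in>goodset. M d v \<eta>)\<^sup>2" by (intro mult_right_mono mu_le_1 u) simp
    then show "mu u v \<eta> * (\<Sum>d\<in>goodset. M d v \<eta>)\<^sup>2 \<le> (\<Sum>d\<in>goodset. \<Sum>d'\<in>goodset. M d v \<eta> * M d' v \<eta>)"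
      by (simp add: power2_eq_square sum_product)
  qed
  also have "\<dots> = (\<Sum>d\<in>goodset. \<Sum>d'\<in>goodset. psum (\<lambda>v \<eta>. M d v \<eta> * M d' v \<eta>))" by (simp only: psum_sum)
  also have "\<dots> = (\<Sum>i\<in>I. psum (\<lambda>v \<eta>. mu u v \<eta> * mu u (m i * v) (ratio i * \<eta> + \<theta> i * v)))"
    by (simp add: sub I_def sum.cartesian_product case_prod_unfold)
  finally have 1: "(\<Sum>d\<in>goodset. R d)\<^sup>2 \<le> (\<Sum>i\<in>I. psum (\<lambda>v \<eta>. mu u v \<eta> * mu u (m i * v) (ratio i * \<eta> + \<theta> i * v)))" .
  define L where "L i j = (AV v. mu u ((m i - m j) * v) ((\<theta> i - \<theta> j) * v))" for i j
  have L: "L i j \<le> \<Lambda> + (if int p dvd m i - m j then 1 else 0)" for i j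
  proof (cases "int p dvd m i - m j")
    case True
    have "L i j \<le> 1" unfolding L_def by (intro E_le_const mu_le_1 u)
    with True lam show ?thesis by simp
  qed (simp add: L_def lam)
  have "(\<Sum>i\<in>I. \<Sum>j\<in>{j\<in>I. ratio j = ratio i}. L i j) \<le> (\<Sum>i\<in>I. \<Sum>j\<in>{j\<in>I. ratio j = ratio i}. \<Lambda> + (if int p dvd m i - m j then 1 else 0))"
    by (intro sum_mono L)
  also have "\<dots> = (\<Sum>x\<in>Sigma I (\<lambda>i. {j\<in>I. ratio j = ratio i}). \<Lambda> + (if int p dvd m (fst x) - m (snd x) then 1 else 0))"
    using I by (subst sum.Sigma) (auto simp: case_prod_unfold)
  also have "Sigma I (\<lambda>i. {j\<in>I. ratio j = ratio i}) = {(i, j). i \<in> goodset \<times> goodset \<and> j \<in> goodset \<times> goodset \<and> ratio i = ratio j}"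
    by (auto simp: I_def)
  also have "(\<Sum>x\<in>{(i, j). i \<in> goodset \<times> goodset \<and> j \<in> goodset \<times> goodset \<and> ratio i = ratio j}. \<Lambda> + (if int p dvd m (fst x) - m (snd x) then 1 else 0))
    \<le> real (p ^ 3) * \<Lambda> + real (2 * p\<^sup>2)"
  proof -
    let ?P = "{(i, j). i \<in> goodset \<times> goodset \<and> j \<in> goodset \<times> goodset \<and> ratio i = ratio j}"
    have fin: "finite ?P" by (rule finite_subset[of _ "I \<times> I"]) (auto simp: I_def goodset)
    have "(\<Sum>x\<in>?P. \<Lambda> + (if int p dvd m (fst x) - m (snd x) then 1 else 0)) = real (card ?P) * \<Lambda> + real (card {x\<in>?P. int p dvd m (fst x) - m (snd x)})"
      using fin by (simp add: sum.distrib sum.If_cases Int_def)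
    also have "{x\<in>?P. int p dvd m (fst x) - m (snd x)} = {(i, j). i \<in> goodset \<times> goodset \<and> j \<in> goodset \<times> goodset \<and> ratio i = ratio j \<and> int p dvd slope i - slope j}"
      by (auto simp: m_def)
    also have "real (card ?P) * \<Lambda> + real (card {(i, j). i \<in> goodset \<times> goodset \<and> j \<in> goodset \<times> goodset \<and> ratio i = ratio j \<and> int p dvd slope i - slope j})
      \<le> real (p ^ 3) * \<Lambda> + real (2 * p\<^sup>2)"
      by (intro add_mono mult_right_mono lam of_nat_mono card_ratio_eq card_degenerate)
    finally show ?thesis .
  qed
  finally have 2: "(\<Sum>i\<in>I. \<Sum>j\<in>{j\<in>I. ratio j = ratio i}. L i j) \<le> real (p ^ 3) * \<Lambda> + real (2 * p\<^sup>2)" .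
  have "(\<Sum>d\<in>goodset. R d) ^ 8 = ((\<Sum>d\<in>goodset. R d)\<^sup>2) ^ 4" by simp
  also have "\<dots> \<le> (\<Sum>i\<in>I. psum (\<lambda>v \<eta>. mu u v \<eta> * mu u (m i * v) (ratio i * \<eta> + \<theta> i * v))) ^ 4"
    by (rule power_mono[OF 1]) simp
  also have "\<dots> \<le> real p * (real (card I))\<^sup>2 * (\<Sum>i\<in>I. \<Sum>j\<in>{j\<in>I. ratio j = ratio i}. L i j)"
    unfolding L_def by (rule lines[OF u I(1) rat])
  also have "\<dots> \<le> real p * (real (p * p))\<^sup>2 * (real (p ^ 3) * \<Lambda> + real (2 * p\<^sup>2))"
  proof -
    have "0 \<le> (\<Sum>i\<in>I. \<Sum>j\<in>{j\<in>I. ratio j = ratio i}. L i j)"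
      unfolding L_def by (intro sum_nonneg E_nonneg mu_nonneg)
    then show ?thesis using I(2) by (intro mult_mono 2 power_mono mult_left_mono) (auto simp del: of_nat_mult)
  qed
  also have "\<dots> = real p ^ 8 * (\<Lambda> + 2 / real p)"
    using p_pos by (simp add: field_simps power_numeral_reduce)
  finally show ?thesis .
qed

text \<open>Multiplying \<open>u\<close> by \<open>ee (\<omega> * x\<^sup>2)\<close> shifts the
  frequencies of its derivative with step \<open>a\<close> by \<open>2 * \<omega> * a\<close>. With
  \<open>2 * \<omega> * m = s\<close> the line becomes the axis of frequency zero, where the average
  of \<open>mu\<close> is the \<open>U\<close>-norm of order two of the product, and
  \<open>gowers_1_le_four_sq\<close> supplies the linear term.\<close>

lemma mu_line_quadratic:
  assumes u: "bd u" and m: "\<not> int p dvd m"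
  obtains \<omega> \<beta> where "(AV v. mu u (m * v) (s * v)) \<le> (cmod ((AV x. u x * ee (\<omega> * x\<^sup>2 + \<beta> * x))))\<^sup>2"
proof -
  have "\<not> int p dvd 2 * m" using dvd_cancel not_dvd_2 m by blast
  then obtain b where b: "[2 * m * b = 1] (mod int p)" using ex_inverse by blast
  define \<omega> where "\<omega> = b * s"
  have \<omega>: "[2 * \<omega> * m = s] (mod int p)"
    using cong_mult[OF b cong_refl[of s]] by (simp add: \<omega>_def mult_ac)
  define g where "g x = u x * ee (\<omega> * x\<^sup>2)" for x
  have g: "bd g" unfolding g_def by (intro bd_mult u bd_ee cgp_intros)
  have mu: "mu u a (2 * \<omega> * a) = (cmod ((AV x. g x * cnj (g (x + a)))))\<^sup>2" for a
  proof -
    have "g x * cnj (g (x + a)) = (u x * cnj (u (x + a)) * ee (- (2 * \<omega> * a * x))) * ee (- (\<omega> * a\<^sup>2))" for x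
    proof -
      have "ee (\<omega> * x\<^sup>2) * cnj (ee (\<omega> * (x + a)\<^sup>2)) = ee (- (2 * \<omega> * a * x)) * ee (- (\<omega> * a\<^sup>2))"
        by (simp add: cnj_ee ee_add[symmetric] algebra_simps power2_eq_square)
      then show ?thesis unfolding g_def complex_cnj_mult by (simp only: mult_ac)
    qed
    then show ?thesis by (simp add: mu_def four_sq_def E_cmult_right norm_mult)
  qed
  have "(AV v. mu u (m * v) (s * v)) = (AV v. mu u (m * v) (2 * \<omega> * (m * v)))"
  proof (rule E_cong)
    fix v
    have "[s * v = 2 * \<omega> * m * v] (mod int p)" by (rule cong_mult[OF cong_sym[OF \<omega>] cong_refl])
    then show "mu u (m * v) (s * v) = mu u (m * v) (2 * \<omega> * (m * v))"
      using per_cong[OF per_mu_2] by (simp add: mult.assoc)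
  qed
  also have "\<dots> = (AV a. mu u a (2 * \<omega> * a))"
  proof (rule E_dil[where f="\<lambda>a. mu u a (2 * \<omega> * a)", OF _ m])
    show "per (\<lambda>a. mu u a (2 * \<omega> * a))"
      unfolding mu_def four_sq_def
      by (intro per_power per_cmod per_E per_mult per_const per_cnj bdc[OF u] per_eec cgp_intros)
  qed
  also have "\<dots> = gowers 1 g" by (simp add: mu)
  finally have eq: "(AV v. mu u (m * v) (s * v)) = gowers 1 g" .
  from gowers_1_le_four_sq[OF g] obtain \<beta> where "gowers 1 g \<le> four_sq g \<beta>" .
  moreover have "four_sq g \<beta> = (cmod ((AV x. u x * ee (\<omega> * x\<^sup>2 + (- \<beta>) * x))))\<^sup>2"
    unfolding four_sq_def g_def ee_add by (simp add: mult.assoc)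
  ultimately have "(AV v. mu u (m * v) (s * v)) \<le> (cmod ((AV x. u x * ee (\<omega> * x\<^sup>2 + (- \<beta>) * x))))\<^sup>2"
    by (simp only: eq)
  then show ?thesis by (rule that)
qed

text \<open>The fourth power comes from \<open>elimination\<close> and the eighth from
  \<open>mu_dilates_le\<close>. One halving absorbs the \<open>3 / p\<close> of exceptional
  \<open>d\<close>, the other the \<open>2 / p\<close> of degenerate pairs. If no phase reached the
  bound, \<open>mu_line_quadratic\<close> would make every admissible line average small.\<close>

lemma quadratic_phase:
  assumes u: "bd u" and a: "\<And>d. bd (a d)" and b: "\<And>d. bd (b d)" and c0: "0 \<le> c"
    and c: "c \<le> (AV d. cmod ((AV z. (AV y. u z * cnj (u (z - 2 * d * y + \<delta> d)) * a d (z + y) * b d (z + (1 - 2 * d) * y) * ee (\<xi> d * (z + \<kappa> * y + y\<^sup>2))))))"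
    and p: "6 / real p \<le> c ^ 4" "4 / real p < (c ^ 4 / 2) ^ 8"
  shows "\<exists>\<omega> \<beta>. (c ^ 4 / 2) ^ 8 / 2 \<le> (cmod ((AV x. u x * ee (\<omega> * x\<^sup>2 + \<beta> * x))))\<^sup>2"
proof (rule ccontr)
  assume neg: "\<not> ?thesis"
  define l where "l = (c ^ 4 / 2) ^ 8 / 2"
  have small: "(AV v. mu u (m * v) (s * v)) \<le> l" if m: "\<not> int p dvd m" for m s
  proof -
    obtain \<omega> \<beta> where *: "(AV v. mu u (m * v) (s * v)) \<le> (cmod ((AV x. u x * ee (\<omega> * x\<^sup>2 + \<beta> * x))))\<^sup>2"
      using mu_line_quadratic[OF u m] .
    have "(cmod ((AV x. u x * ee (\<omega> * x\<^sup>2 + \<beta> * x))))\<^sup>2 < l" using neg by (auto simp: l_def not_le)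
    with * show ?thesis by linarith
  qed
  have l0: "0 \<le> l" using c0 by (simp add: l_def)
  define t where "t d = - (2 * \<xi> d)" for d
  define R where "R d = psum (\<lambda>v \<eta>. mu u v \<eta> * mu u ((1 + 2 * d) * v) ((1 - 2 * d) * \<eta> + t d * v))" for d
  define X where "X d = cmod ((AV z. (AV y. u z * cnj (u (z - 2 * d * y + \<delta> d)) * a d (z + y) * b d (z + (1 - 2 * d) * y) * ee (\<xi> d * (z + \<kappa> * y + y\<^sup>2)))))" for d
  have upper: "(\<Sum>d\<in>goodset. R d) ^ 8 \<le> real p ^ 8 * (l + 2 / real p)"
    by (rule mu_dilates_le[OF u R_def l0 small])
  define i :: "int \<Rightarrow> real" where "i n = (if int p dvd n then 1 else 0)" for n
  have R0: "0 \<le> R d" for d unfolding R_def by (intro psum_nonneg mult_nonneg_nonneg mu_nonneg)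
  have X01: "0 \<le> X d" "X d \<le> 1" for d
    unfolding X_def by (auto intro!: cmod_E_le_1 simp: norm_mult bd_le u a b mult_le_one)
  have XR: "X d ^ 4 \<le> R d" if "\<not> int p dvd 2 * d" for d
    using elimination[OF u a b that, of "\<delta> d" d d "\<xi> d" \<kappa>] unfolding X_def R_def psum_def t_def
    by (simp add: mult.assoc)
  \<comment> \<open>The exceptional \<open>d\<close> are those with \<open>2 * d = 0\<close>, where
    \<open>elimination\<close> fails, and those with a vanishing diagonal entry.\<close>
  have "X d ^ 4 \<le> (if d \<in> goodset then R d else 0) + (i (2 * d + 0) + i (2 * d + 1) + i (2 * d + (-1)))"
    if "0 \<le> d" "d < int p" for d
  proof (cases "int p dvd 2 * d \<or> int p dvd 2 * d + 1 \<or> int p dvd 2 * d - 1")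
    case True
    then have "1 \<le> i (2 * d + 0) + i (2 * d + 1) + i (2 * d + (-1))" by (auto simp: i_def)
    moreover have "X d ^ 4 \<le> 1" using X01 by (intro power_le_one)
    moreover have "0 \<le> (if d \<in> goodset then R d else 0)" using R0 by simp
    ultimately show ?thesis by linarith
  next
    case False
    have "d \<in> goodset" using False that dvd_minus_iff[of "int p" "2 * d - 1"] by (auto simp: goodset_def add.commute)
    moreover have "0 \<le> i (2 * d + 0) + i (2 * d + 1) + i (2 * d + (-1))" by (auto simp: i_def)
    ultimately show ?thesis using XR[of d] False by auto
  qed
  then have "(AV d. X d ^ 4) \<le> (AV d. (if d \<in> goodset then R d else 0) + (i (2 * d + 0) + i (2 * d + 1) + i (2 * d + (-1))))"
    by (intro E_mono)
  moreover have "(AV l. i (2 * l + b)) = 1 / real p" for b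
    unfolding i_def by (rule E_dvd[OF not_dvd_2])
  moreover have "(AV d. if d \<in> goodset then R d else 0) = (\<Sum>d\<in>goodset. R d) / real p"
  proof -
    have "{0..<int p} \<inter> goodset = goodset" using goodset(2) by blast
    then show ?thesis by (simp add: E_def sum.If_cases Int_def[symmetric])
  qed
  ultimately have "(AV d. X d ^ 4) \<le> (\<Sum>d\<in>goodset. R d) / real p + 3 / real p"
    by (simp only: E_add)
  moreover have "c ^ 4 \<le> (AV d. X d ^ 4)"
  proof -
    have "c ^ 4 \<le> (E X) ^ 4" using c c0 unfolding X_def by (intro power_mono)
    also have "\<dots> \<le> (AV d. X d ^ 4)" using E_pow2_le[of X 2] X01 by simp
    finally show ?thesis .
  qed
  ultimately have "c ^ 4 - 3 / real p \<le> (\<Sum>d\<in>goodset. R d) / real p" by linarith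
  with p(1) have "c ^ 4 / 2 \<le> (\<Sum>d\<in>goodset. R d) / real p" by linarith
  then have "real p * (c ^ 4 / 2) \<le> (\<Sum>d\<in>goodset. R d)" using p_pos by (simp add: field_simps)
  then have "(real p * (c ^ 4 / 2)) ^ 8 \<le> (\<Sum>d\<in>goodset. R d) ^ 8" using c0 by (intro power_mono) auto
  with upper have "real p ^ 8 * (c ^ 4 / 2) ^ 8 \<le> real p ^ 8 * (l + 2 / real p)" by (simp only: power_mult_distrib)
  then have "(c ^ 4 / 2) ^ 8 \<le> l + 2 / real p" using p_pos by (simp add: mult_le_cancel_left_pos)
  with p(2) show False unfolding l_def by (simp add: field_simps)
qed

subsection \<open>Structured functions\<close>

definition shiftl :: "int \<Rightarrow> int list \<Rightarrow> int list"
  where "shiftl y ks = map (\<lambda>a. (a + y) mod int p) ks"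

definition vectors :: "nat \<Rightarrow> int list set"
  where "vectors J = {ks. set ks \<subseteq> {0..<int p} \<and> length ks = J}"

text \<open>Linear phases times translates of bounded functions, averaged over the translation, are what
  a large \<open>U\<close>-norm of order three correlates with. Lists of translations make the class closed under
  products.\<close>

definition structured :: "(int \<Rightarrow> complex) \<Rightarrow> bool"
  where "structured G \<longleftrightarrow> (\<exists>J c A \<phi>. (\<forall>ks. cmod (c ks) \<le> 1) \<and> (\<forall>ks. cmod (A ks) \<le> 1) \<and>
    G = (\<lambda>w. (\<Sum>ks\<in>vectors J. c ks * A (shiftl w ks) * ee (\<phi> ks * w)) / of_nat (card (vectors J))))"

lemma finite_vectors: "finite (vectors J)" and vectors_ne: "vectors J \<noteq> {}" and card_vectors: "card (vectors J) > 0"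
proof -
  show f: "finite (vectors J)" unfolding vectors_def by (rule finite_lists_length_eq) simp
  have "replicate J 0 \<in> vectors J" using p_pos by (auto simp: vectors_def)
  then show "vectors J \<noteq> {}" by auto
  with f show "card (vectors J) > 0" by (simp add: card_gt_0_iff)
qed

lemma shiftl_vectors: "ks \<in> vectors J \<Longrightarrow> shiftl y ks \<in> vectors J"
  using p_pos by (auto simp: vectors_def shiftl_def)

lemma shiftl_shiftl: "shiftl y (shiftl z ks) = shiftl (z + y) ks"
  by (simp add: shiftl_def mod_simps add.assoc)

lemma shiftl_0: "ks \<in> vectors J \<Longrightarrow> shiftl 0 ks = ks"
  by (auto simp: vectors_def shiftl_def intro!: map_idI)

lemma per_shiftl: "cgp a \<Longrightarrow> per (\<lambda>w. shiftl (a w) ks)"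
proof (rule per_comp[of "\<lambda>w. shiftl w ks"])
  show "per (\<lambda>w. shiftl w ks)"
    unfolding per_def shiftl_def by (auto simp: cong_def intro: mod_add_cong)
qed

lemma sum_shiftl: "(\<Sum>ks\<in>vectors J. f (shiftl y ks)) = sum f (vectors J)"
  by (rule sum.reindex_bij_witness[where i="shiftl (- y)" and j="shiftl y"])
    (auto simp: shiftl_vectors shiftl_shiftl shiftl_0)

lemma avg_vectors_le: "(\<And>ks. cmod (f ks) \<le> 1) \<Longrightarrow> cmod ((\<Sum>ks\<in>vectors J. f ks) / of_nat (card (vectors J))) \<le> 1"
  using card_vectors[of J] order_trans[OF norm_sum sum_bounded_above[of "vectors J" "\<lambda>ks. cmod (f ks)" 1]]
  by (simp add: norm_divide)

lemma structured_bd: "structured G \<Longrightarrow> bd G"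
proof -
  assume "structured G"
  then obtain J c A \<phi> where c: "\<And>ks. cmod (c ks) \<le> 1" and A: "\<And>ks. cmod (A ks) \<le> 1"
    and G: "G = (\<lambda>w. (\<Sum>ks\<in>vectors J. c ks * A (shiftl w ks) * ee (\<phi> ks * w)) / of_nat (card (vectors J)))"
    unfolding structured_def by blast
  have "per G" unfolding G divide_inverse
    by (intro per_mult per_const per_sum per_eec cgp_intros per_fun[OF per_shiftl])
  moreover have "cmod (G w) \<le> 1" for w
    unfolding G using c A by (intro avg_vectors_le) (simp add: norm_mult mult_le_one)
  ultimately show ?thesis by (simp add: bd_def)
qed

lemma structured_cnj: "structured G \<Longrightarrow> structured (\<lambda>w. cnj (G w))"
proof -
  assume "structured G"
  then obtain J c A \<phi> where c: "\<And>ks. cmod (c ks) \<le> 1" and A: "\<And>ks. cmod (A ks) \<le> 1"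
    and G: "G = (\<lambda>w. (\<Sum>ks\<in>vectors J. c ks * A (shiftl w ks) * ee (\<phi> ks * w)) / of_nat (card (vectors J)))"
    unfolding structured_def by blast
  show ?thesis unfolding structured_def
    by (rule exI[of _ J], rule exI[of _ "\<lambda>ks. cnj (c ks)"], rule exI[of _ "\<lambda>ks. cnj (A ks)"], rule exI[of _ "\<lambda>ks. - \<phi> ks"])
      (simp add: c A G cnj_sum cnj_ee)
qed

lemma structured_cmult: "structured G \<Longrightarrow> cmod b \<le> 1 \<Longrightarrow> structured (\<lambda>w. b * G w)"
proof -
  assume "structured G" and b: "cmod b \<le> 1"
  then obtain J c A \<phi> where c: "\<And>ks. cmod (c ks) \<le> 1" and A: "\<And>ks. cmod (A ks) \<le> 1"
    and G: "G = (\<lambda>w. (\<Sum>ks\<in>vectors J. c ks * A (shiftl w ks) * ee (\<phi> ks * w)) / of_nat (card (vectors J)))"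
    unfolding structured_def by blast
  show ?thesis unfolding structured_def
    by (rule exI[of _ J], rule exI[of _ "\<lambda>ks. b * c ks"], rule exI[of _ A], rule exI[of _ \<phi>])
      (simp add: c A b G sum_distrib_left norm_mult mult_le_one mult.assoc)
qed

lemma sum_vectors_append: "(\<Sum>ks\<in>vectors (J + K). f (take J ks) (drop J ks)) = (\<Sum>x\<in>vectors J. \<Sum>y\<in>vectors K. f x y)"
proof -
  have "(\<Sum>ks\<in>vectors (J + K). f (take J ks) (drop J ks)) = (\<Sum>(x, y)\<in>vectors J \<times> vectors K. f x y)"
    by (rule sum.reindex_bij_witness[where i="\<lambda>(x, y). x @ y" and j="\<lambda>ks. (take J ks, drop J ks)"])
      (auto simp: vectors_def dest: in_set_takeD in_set_dropD)
  then show ?thesis by (simp add: sum.cartesian_product)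
qed

lemma card_vectors_add: "card (vectors (J + K)) = card (vectors J) * card (vectors K)"
  using sum_vectors_append[of "\<lambda>_ _. 1 :: nat" J K] by simp

lemma structured_mult: "structured G \<Longrightarrow> structured H \<Longrightarrow> structured (\<lambda>w. G w * H w)"
proof -
  assume "structured G" and H: "structured H"
  then obtain J c A \<phi> where c: "\<And>ks. cmod (c ks) \<le> 1" and A: "\<And>ks. cmod (A ks) \<le> 1"
    and G: "G = (\<lambda>w. (\<Sum>ks\<in>vectors J. c ks * A (shiftl w ks) * ee (\<phi> ks * w)) / of_nat (card (vectors J)))"
    unfolding structured_def by blast
  from H obtain K d B \<psi> where d: "\<And>ks. cmod (d ks) \<le> 1" and B: "\<And>ks. cmod (B ks) \<le> 1"
    and H: "H = (\<lambda>w. (\<Sum>ks\<in>vectors K. d ks * B (shiftl w ks) * ee (\<psi> ks * w)) / of_nat (card (vectors K)))"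
    unfolding structured_def by blast
  have tk: "take J (shiftl w ks) = shiftl w (take J ks)" "drop J (shiftl w ks) = shiftl w (drop J ks)" for w ks
    by (simp_all add: shiftl_def take_map drop_map)
  have eq: "G w * H w = (\<Sum>ks\<in>vectors (J + K). (c (take J ks) * d (drop J ks)) * (A (take J (shiftl w ks)) * B (drop J (shiftl w ks))) * ee ((\<phi> (take J ks) + \<psi> (drop J ks)) * w)) / of_nat (card (vectors (J + K)))" for w
  proof -
    have "G w * H w = (\<Sum>x\<in>vectors J. \<Sum>y\<in>vectors K. (c x * d y) * (A (shiftl w x) * B (shiftl w y)) * ee ((\<phi> x + \<psi> y) * w)) / of_nat (card (vectors (J + K)))"
      unfolding G H card_vectors_add times_divide_times_eq sum_product of_nat_mult
      by (intro arg_cong2[where f="(/)"] sum.cong refl) (simp add: ee_add ring_distribs mult_ac)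
    then show ?thesis
      unfolding tk sum_vectors_append[where f="\<lambda>x y. (c x * d y) * (A (shiftl w x) * B (shiftl w y)) * ee ((\<phi> x + \<psi> y) * w)"] .
  qed
  show ?thesis unfolding structured_def
    by (rule exI[of _ "J + K"], rule exI[of _ "\<lambda>ks. c (take J ks) * d (drop J ks)"], rule exI[of _ "\<lambda>ks. A (take J ks) * B (drop J ks)"], rule exI[of _ "\<lambda>ks. \<phi> (take J ks) + \<psi> (drop J ks)"])
      (simp add: eq[abs_def] c A d B norm_mult mult_le_one)
qed

lemma structured_basic:
  assumes c: "\<And>k. cmod (c k) \<le> 1" and A: "bd A"
  shows "structured (\<lambda>x. (AV k. c k * A (x + k) * ee (\<phi> k * x)))"
proof -
  have l1: "(\<Sum>ks\<in>vectors 1. f (hd ks)) = (\<Sum>k\<in>{0..<int p}. f k)" for f :: "int \<Rightarrow> complex"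
    by (rule sum.reindex_bij_witness[where j=hd and i="\<lambda>k. [k]"]) (auto simp: vectors_def length_Suc_conv)
  from l1[of "\<lambda>_. 1"] have card: "of_nat (card (vectors 1)) = (of_nat p :: complex)" by simp
  have hd: "A (hd (shiftl x ks)) = A (x + hd ks)" if "ks \<in> vectors 1" for x ks
    using that per_mod[OF bd_per[OF A]] by (auto simp: vectors_def length_Suc_conv shiftl_def add.commute)
  have "(AV k. c k * A (x + k) * ee (\<phi> k * x)) = (\<Sum>ks\<in>vectors 1. c (hd ks) * A (hd (shiftl x ks)) * ee (\<phi> (hd ks) * x)) / of_nat (card (vectors 1))" for x
    unfolding E_def card l1[symmetric] by (simp add: hd cong: sum.cong)
  then have eq: "(\<lambda>x. (AV k. c k * A (x + k) * ee (\<phi> k * x))) = (\<lambda>x. (\<Sum>ks\<in>vectors 1. c (hd ks) * A (hd (shiftl x ks)) * ee (\<phi> (hd ks) * x)) / of_nat (card (vectors 1)))"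
    by (rule ext)
  show ?thesis unfolding structured_def
    by (rule exI[of _ 1], rule exI[of _ "\<lambda>ks. c (hd ks)"], rule exI[of _ "\<lambda>ks. A (hd ks)"], rule exI[of _ "\<lambda>ks. \<phi> (hd ks)"])
      (simp add: eq c bd_le[OF A])
qed

lemma ex_ge_avg_vectors: "\<exists>ks. cmod ((\<Sum>ks\<in>vectors J. f ks) / of_nat (card (vectors J))) \<le> cmod (f ks)"
proof (rule ccontr)
  let ?a = "cmod ((\<Sum>ks\<in>vectors J. f ks) / of_nat (card (vectors J)))"
  assume "\<not> ?thesis"
  then have "\<And>ks. cmod (f ks) < ?a" by (simp add: not_le)
  then have "(\<Sum>ks\<in>vectors J. cmod (f ks)) < (\<Sum>ks\<in>vectors J. ?a)"
    by (intro sum_strict_mono finite_vectors vectors_ne)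
  moreover have "(\<Sum>ks\<in>vectors J. ?a) = cmod (\<Sum>ks\<in>vectors J. f ks)"
    using card_vectors[of J] by (simp add: norm_divide)
  ultimately show False using norm_sum[of f "vectors J"] by simp
qed

text \<open>Writing \<open>z = x + y\<^sup>2\<close>, the shift of the averaging variable of \<open>G\<close> by \<open>- y\<close> makes its
  unstructured part depend on \<open>z\<close> only, so one application of the Cauchy--Schwarz inequality removes
  it together with \<open>g2\<close>.\<close>

lemma structured_elimination:
  assumes g0: "bd g0" and g1: "bd g1" and g2: "bd g2" and G: "structured G"
  shows "\<exists>\<xi>. per \<xi> \<and> (cmod (pavg g0 g1 g2 G))\<^sup>2 \<le> (AV d. cmod ((AV z. (AV y. g0 z * cnj (g0 (z - 2 * d * y - d\<^sup>2)) *
     (g1 (z + y) * cnj (g1 (z + y - 2 * d * y + d - d\<^sup>2))) * ee (\<xi> d * (z + y + y\<^sup>2))))))"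
proof -
  from G obtain J c A \<phi> where c: "\<And>ks. cmod (c ks) \<le> 1" and A: "\<And>ks. cmod (A ks) \<le> 1"
    and Geq: "G = (\<lambda>w. (\<Sum>ks\<in>vectors J. c ks * A (shiftl w ks) * ee (\<phi> ks * w)) / of_nat (card (vectors J)))"
    unfolding structured_def by blast
  let ?N = "of_nat (card (vectors J)) :: complex"
  define P where "P z y = g0 (z - y\<^sup>2) * g1 (z - y\<^sup>2 + y)" for z y
  have pP: "per (P z)" "per (\<lambda>z. P z y)" for z y
    unfolding P_def by (intro per_mult bdc[OF g0] bdc[OF g1] cgp_intros)+
  have Gzy: "G (z + y) = (\<Sum>ks\<in>vectors J. c (shiftl (- y) ks) * A (shiftl z ks) * ee (\<phi> (shiftl (- y) ks) * (z + y))) / ?N" for z y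
  proof -
    have "(\<Sum>ks\<in>vectors J. c ks * A (shiftl (z + y) ks) * ee (\<phi> ks * (z + y)))
       = (\<Sum>ks\<in>vectors J. c (shiftl (- y) ks) * A (shiftl (z + y) (shiftl (- y) ks)) * ee (\<phi> (shiftl (- y) ks) * (z + y)))"
      by (rule sum_shiftl[symmetric])
    then show ?thesis by (simp add: Geq shiftl_shiftl add.commute)
  qed
  define S where "S = {0..<int p} \<times> vectors J"
  have S: "finite S" "S \<noteq> {}" "card S = p * card (vectors J)"
    using p_pos finite_vectors vectors_ne by (auto simp: S_def card_cartesian_product)
  \<comment> \<open>Both factors of \<open>a\<close> are independent of \<open>y\<close>. The
    coefficient and the frequency of \<open>G\<close> do depend on \<open>y\<close> after the shift
    and go into \<open>T\<close>.\<close>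
  define a where "a s = g2 (fst s) * A (shiftl (fst s) (snd s))" for s
  define T where "T s y = P (fst s) y * c (shiftl (- y) (snd s)) * ee (\<phi> (shiftl (- y) (snd s)) * (fst s + y))" for s y
  have "pavg g0 g1 g2 G = (AV z. (AV y. P z y * g2 z * G (z + y)))"
  proof -
    have "per (\<lambda>x. g0 x * g1 (x + y) * g2 (x + y\<^sup>2) * G (x + y + y\<^sup>2))" for y
      by (intro per_mult bd_per[OF g0] bdc[OF g1] bdc[OF g2] bdc[OF structured_bd[OF G]] cgp_intros)
    from E_shear[of "\<lambda>x y. g0 x * g1 (x + y) * g2 (x + y\<^sup>2) * G (x + y + y\<^sup>2)" "\<lambda>y. - y\<^sup>2", OF this] show ?thesis
      by (simp add: pavg_def P_def)
  qed
  also have "\<dots> = (\<Sum>s\<in>S. a s * E (T s)) / of_nat (card S)"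
  proof -
    have "(AV y. P z y * g2 z * G (z + y)) = (\<Sum>ks\<in>vectors J. a (z, ks) * E (T (z, ks))) / ?N" for z
    proof -
      have "(AV y. P z y * g2 z * G (z + y)) = (AV y. \<Sum>ks\<in>vectors J. a (z, ks) * T (z, ks) y / ?N)"
        unfolding Gzy a_def T_def by (simp add: sum_distrib_left sum_divide_distrib mult_ac)
      then show ?thesis by (simp add: E_sum E_cmult_left E_cmult_right divide_inverse sum_distrib_right)
    qed
    then have "(AV z. (AV y. P z y * g2 z * G (z + y))) = (\<Sum>z\<in>{0..<int p}. (\<Sum>ks\<in>vectors J. a (z, ks) * E (T (z, ks))) / ?N) / of_nat p"
      by (simp only: E_def[of "\<lambda>z. (\<Sum>ks\<in>vectors J. a (z, ks) * E (T (z, ks))) / ?N"])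
    moreover have "(\<Sum>s\<in>S. a s * E (T s)) = (\<Sum>z\<in>{0..<int p}. \<Sum>ks\<in>vectors J. a (z, ks) * E (T (z, ks)))"
      by (simp add: S_def sum.cartesian_product case_prod_unfold)
    ultimately show ?thesis by (simp add: S(3) sum_divide_distrib[symmetric] mult.commute)
  qed
  finally have pavg: "pavg g0 g1 g2 G = (\<Sum>s\<in>S. a s * E (T s)) / of_nat (card S)" .
  define X where "X d \<xi> = (AV z. (AV y. P z y * cnj (P z (y + d)) * ee (\<xi> * (z + y))))" for d \<xi>
  define C where "C ks d = c ks * cnj (c (shiftl (- d) ks)) * ee (- (\<phi> (shiftl (- d) ks) * d))" for ks d
  have C: "cmod (C ks d) \<le> 1" for ks d
    unfolding C_def using c by (simp add: norm_mult mult_le_one)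
  have TT: "(\<Sum>s\<in>S. (AV y. T s y * cnj (T s (y + d)))) / of_nat (card S) = (\<Sum>ks\<in>vectors J. C ks d * X d (\<phi> ks - \<phi> (shiftl (- d) ks))) / ?N" for d
  proof -
    \<comment> \<open>Shifting the list by \<open>y\<close> once more moves the coefficient and
      frequency back to \<open>ks\<close> and \<open>shiftl (- d) ks\<close>, which are independent
      of \<open>y\<close>. What remains is a genuine linear phase in \<open>z + y\<close>.\<close>
    have inner: "(\<Sum>ks\<in>vectors J. T (z, ks) y * cnj (T (z, ks) (y + d))) = (\<Sum>ks\<in>vectors J. C ks d * (P z y * cnj (P z (y + d)) * ee ((\<phi> ks - \<phi> (shiftl (- d) ks)) * (z + y))))" for z y
    proof -
      have "(\<Sum>ks\<in>vectors J. T (z, ks) y * cnj (T (z, ks) (y + d))) = (\<Sum>ks\<in>vectors J. T (z, shiftl y ks) y * cnj (T (z, shiftl y ks) (y + d)))"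
        by (rule sum_shiftl[symmetric])
      also have "\<dots> = (\<Sum>ks\<in>vectors J. C ks d * (P z y * cnj (P z (y + d)) * ee ((\<phi> ks - \<phi> (shiftl (- d) ks)) * (z + y))))"
      proof (rule sum.cong[OF refl])
        fix ks assume ks: "ks \<in> vectors J"
        have s: "shiftl (- y) (shiftl y ks) = ks" "shiftl (- (y + d)) (shiftl y ks) = shiftl (- d) ks"
          using ks by (simp_all add: shiftl_shiftl shiftl_0)
        have "ee (\<phi> ks * (z + y)) * cnj (ee (\<phi> (shiftl (- d) ks) * (z + (y + d)))) = ee (- (\<phi> (shiftl (- d) ks) * d)) * ee ((\<phi> ks - \<phi> (shiftl (- d) ks)) * (z + y))"
          by (simp add: cnj_ee ee_add[symmetric] algebra_simps)
        then show "T (z, shiftl y ks) y * cnj (T (z, shiftl y ks) (y + d)) = C ks d * (P z y * cnj (P z (y + d)) * ee ((\<phi> ks - \<phi> (shiftl (- d) ks)) * (z + y)))"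
          unfolding T_def C_def fst_conv snd_conv s complex_cnj_mult by (simp only: mult_ac)
      qed
      finally show ?thesis .
    qed
    have "(\<Sum>s\<in>S. (AV y. T s y * cnj (T s (y + d)))) = (\<Sum>z\<in>{0..<int p}. (AV y. \<Sum>ks\<in>vectors J. T (z, ks) y * cnj (T (z, ks) (y + d))))"
      by (simp add: S_def sum.cartesian_product E_sum case_prod_unfold)
    also have "\<dots> = of_nat p * (AV z. (AV y. \<Sum>ks\<in>vectors J. C ks d * (P z y * cnj (P z (y + d)) * ee ((\<phi> ks - \<phi> (shiftl (- d) ks)) * (z + y)))))"
      unfolding inner sum_E ..
    also have "\<dots> = of_nat p * (\<Sum>ks\<in>vectors J. C ks d * X d (\<phi> ks - \<phi> (shiftl (- d) ks)))"
      by (simp only: X_def E_sum E_cmult_left)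
    finally show ?thesis using p_pos by (simp add: S(3))
  qed
  \<comment> \<open>The list enters only through a bounded coefficient and one frequency difference,
    so some frequency does at least as well as the average over lists.\<close>
  have "\<exists>\<xi>. cmod ((\<Sum>ks\<in>vectors J. C ks d * X d (\<phi> ks - \<phi> (shiftl (- d) ks))) / ?N) \<le> cmod (X d \<xi>)" for d
  proof -
    obtain ks where "cmod ((\<Sum>ks\<in>vectors J. C ks d * X d (\<phi> ks - \<phi> (shiftl (- d) ks))) / ?N) \<le> cmod (C ks d * X d (\<phi> ks - \<phi> (shiftl (- d) ks)))"
      using ex_ge_avg_vectors by blast
    also have "\<dots> \<le> cmod (X d (\<phi> ks - \<phi> (shiftl (- d) ks)))"
      using C by (simp add: norm_mult mult_left_le_one_le)
    finally show ?thesis by blast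
  qed
  then obtain \<xi> where \<xi>: "\<And>d. cmod ((\<Sum>ks\<in>vectors J. C ks d * X d (\<phi> ks - \<phi> (shiftl (- d) ks))) / ?N) \<le> cmod (X d (\<xi> d))"
    by metis
  \<comment> \<open>Periodicity of the frequency in \<open>d\<close> is what permits
    \<open>phase_1\<close> to replace \<open>d\<close> by \<open>- d\<close>.\<close>
  define \<xi>' where "\<xi>' d = \<xi> (d mod int p)" for d
  have per: "per \<xi>'" unfolding per_def \<xi>'_def by (simp add: cong_def)
  have "(cmod (pavg g0 g1 g2 G))\<^sup>2 \<le> cmod ((AV d. (\<Sum>s\<in>S. (AV y. T s y * cnj (T s (y + d)))) / of_nat (card S)))"
    unfolding pavg
  proof (rule vdC_sum[OF S(1,2)])
    show "cmod (a s) \<le> 1" for s unfolding a_def using A bd_le[OF g2] by (simp add: norm_mult mult_le_one)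
    show "per (T s)" for s
      unfolding T_def[abs_def]
    proof (intro per_mult pP)
      have "per (\<lambda>x. shiftl (- x) (snd s))" by (intro per_shiftl cgp_intros)
      then show "per (\<lambda>x. c (shiftl (- x) (snd s)))" by (rule per_fun)
      show "per (\<lambda>x. ee (\<phi> (shiftl (- x) (snd s)) * (fst s + x)))"
        unfolding per_def
      proof (intro allI impI)
        fix x y assume xy: "[x = y] (mod int p)"
        then have 1: "shiftl (- x) (snd s) = shiftl (- y) (snd s)" using \<open>per (\<lambda>x. shiftl (- x) (snd s))\<close> by (simp add: per_def)
        show "ee (\<phi> (shiftl (- x) (snd s)) * (fst s + x)) = ee (\<phi> (shiftl (- y) (snd s)) * (fst s + y))"
          unfolding 1 by (rule per_cong[OF per_ee cong_mult[OF cong_refl cong_add[OF cong_refl xy]]])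
      qed
    qed
  qed
  also have "\<dots> \<le> (AV d. cmod (X d (\<xi>' d)))"
    unfolding TT by (rule order_trans[OF cmod_E E_mono]) (use \<xi> in \<open>simp add: \<xi>'_def\<close>)
  finally have bound: "(cmod (pavg g0 g1 g2 G))\<^sup>2 \<le> (AV d. cmod (X d (\<xi>' d)))" .
  have X: "X d (\<xi>' d) = (AV z. (AV y. g0 z * cnj (g0 (z - 2 * d * y - d\<^sup>2)) *
     (g1 (z + y) * cnj (g1 (z + y - 2 * d * y + d - d\<^sup>2))) * ee (\<xi>' d * (z + y + y\<^sup>2))))" for d
  proof -
    have "per (\<lambda>z. P z y * cnj (P z (y + d)) * ee (\<xi>' d * (z + y)))" for y
      by (intro per_mult per_cnj pP per_eec cgp_intros)
    from E_shear[of "\<lambda>z y. P z y * cnj (P z (y + d)) * ee (\<xi>' d * (z + y))" "\<lambda>y. y\<^sup>2", OF this] show ?thesis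
      unfolding X_def by (simp add: P_def algebra_simps power2_eq_square)
  qed
  show ?thesis using per bound unfolding X by blast
qed

subsection \<open>Replacing functions by quadratic phases\<close>

text \<open>The bound of \<open>quadratic_phase\<close> at \<open>c\<^sup>2\<close>, since
  \<open>structured_elimination\<close> squares the average; \<open>large\<close> collects its
  conditions on \<open>p\<close> at the same value.\<close>

definition gain :: "real \<Rightarrow> real"
  where "gain c = (c ^ 8 / 2) ^ 8 / 2"

definition large :: "real \<Rightarrow> bool"
  where "large c \<longleftrightarrow> 6 / real p \<le> c ^ 8 \<and> 4 / real p < (c ^ 8 / 2) ^ 8"

text \<open>In \<open>structured_elimination\<close> the copies of \<open>g1\<close> sit at
  \<open>z + y\<close> and, up to a translation, at \<open>z + (1 - 2 * d) * y\<close>. They take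
  the parts of the arbitrary functions in \<open>quadratic_phase\<close>, whose \<open>u\<close> is
  \<open>g0\<close>.\<close>

lemma phase_0:
  assumes g: "bd g0" "bd g1" "bd g2" "structured G" and c: "0 \<le> c" "c \<le> cmod (pavg g0 g1 g2 G)" and l: "large c"
  shows "\<exists>\<omega> \<beta>. gain c \<le> (cmod ((AV x. g0 x * ee (\<omega> * x\<^sup>2 + \<beta> * x))))\<^sup>2"
proof -
  from structured_elimination[OF g] obtain \<xi> where \<xi>: "(cmod (pavg g0 g1 g2 G))\<^sup>2 \<le> (AV d. cmod ((AV z. (AV y. g0 z * cnj (g0 (z - 2 * d * y - d\<^sup>2)) *
     (g1 (z + y) * cnj (g1 (z + y - 2 * d * y + d - d\<^sup>2))) * ee (\<xi> d * (z + y + y\<^sup>2))))))"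
    by blast
  have "c\<^sup>2 \<le> (cmod (pavg g0 g1 g2 G))\<^sup>2" using c by (intro power_mono)
  also note \<xi>
  also have "(\<lambda>d z y. g0 z * cnj (g0 (z - 2 * d * y - d\<^sup>2)) * (g1 (z + y) * cnj (g1 (z + y - 2 * d * y + d - d\<^sup>2))) * ee (\<xi> d * (z + y + y\<^sup>2)))
    = (\<lambda>d z y. g0 z * cnj (g0 (z - 2 * d * y + - (d\<^sup>2))) * g1 (z + y) * cnj (g1 ((z + (1 - 2 * d) * y) + (d - d\<^sup>2))) * ee (\<xi> d * (z + 1 * y + y\<^sup>2)))"
    by (intro ext) (simp add: algebra_simps)
  finally have "\<exists>\<omega> \<beta>. ((c\<^sup>2) ^ 4 / 2) ^ 8 / 2 \<le> (cmod ((AV x. g0 x * ee (\<omega> * x\<^sup>2 + \<beta> * x))))\<^sup>2"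
    using l g
    by (intro quadratic_phase[where a="\<lambda>_. g1" and b="\<lambda>d v. cnj (g1 (v + (d - d\<^sup>2)))" and \<delta>="\<lambda>d. - (d\<^sup>2)" and \<xi>=\<xi> and \<kappa>=1])
      (auto simp: large_def power_mult[symmetric] intro!: bd_cnj bd_comp[of g1] cgp_intros)
  then show ?thesis by (simp add: gain_def power_mult[symmetric])
qed

text \<open>Replacing \<open>z\<close> by \<open>z + y\<close> and \<open>y\<close> by
  \<open>- y\<close> exchanges the roles of \<open>g0\<close> and \<open>g1\<close>. Replacing
  \<open>d\<close> by \<open>- d\<close> as well restores the forms \<open>z - 2 * d * y\<close> and
  \<open>z + (1 - 2 * d) * y\<close>; the phase then has \<open>\<kappa> = 0\<close>.\<close>

lemma phase_1:
  assumes g: "bd g0" "bd g1" "bd g2" "structured G" and c: "0 \<le> c" "c \<le> cmod (pavg g0 g1 g2 G)" and l: "large c"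
  shows "\<exists>\<omega> \<beta>. gain c \<le> (cmod ((AV x. g1 x * ee (\<omega> * x\<^sup>2 + \<beta> * x))))\<^sup>2"
proof -
  from structured_elimination[OF g] obtain \<xi> where p\<xi>: "per \<xi>" and \<xi>: "(cmod (pavg g0 g1 g2 G))\<^sup>2 \<le> (AV d. cmod ((AV z. (AV y. g0 z * cnj (g0 (z - 2 * d * y - d\<^sup>2)) *
     (g1 (z + y) * cnj (g1 (z + y - 2 * d * y + d - d\<^sup>2))) * ee (\<xi> d * (z + y + y\<^sup>2))))))"
    by blast
  define T where "T d z y = g0 z * cnj (g0 (z - 2 * d * y - d\<^sup>2)) * (g1 (z + y) * cnj (g1 (z + y - 2 * d * y + d - d\<^sup>2))) * ee (\<xi> d * (z + y + y\<^sup>2))" for d z y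
  have p1: "per (\<lambda>z. T d z y)" for d y
    unfolding T_def by (intro per_mult per_cnj bd_per[OF g(1)] bdc[OF g(1)] bdc[OF g(2)] per_eec cgp_intros)
  have p2: "per (\<lambda>y. T d (z - y) y)" for d z
    unfolding T_def by (intro per_mult per_cnj bdc[OF g(1)] bdc[OF g(2)] per_eec cgp_intros)
  have eq: "(AV z. (AV y. T d z y)) = (AV z. (AV y. T d (z + y) (- y)))" for d
  proof -
    have "(AV z. (AV y. T d z y)) = (AV z. (AV y. T d (z - y) y))"
      using E_shear[of "T d" "\<lambda>y. - y", OF p1] by simp
    also have "\<dots> = (AV z. (AV y. T d (z + y) (- y)))"
      using E_neg[OF p2] by simp
    finally show ?thesis .
  qed
  have "(\<lambda>d. cmod ((AV z. (AV y. T d z y)))) = (\<lambda>d. cmod ((AV z. E (T d z))))" by simp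
  have "per (\<lambda>d. cmod ((AV z. (AV y. T d z y))))"
  proof (intro per_cmod per_E)
    fix z y
    have cx: "cgp \<xi>" using p\<xi> by (auto simp: per_def cgp_def)
    show "per (\<lambda>d. T d z y)"
      unfolding T_def by (intro per_mult per_const per_cnj bdc[OF g(1)] bdc[OF g(2)] per_eec cx cgp_intros)
  qed
  from E_neg[OF this] have neg: "(AV d. cmod ((AV z. (AV y. T d z y)))) = (AV d. cmod ((AV z. (AV y. T (- d) (z + y) (- y)))))"
    unfolding eq by (simp only: minus_minus)
  have T: "T (- d) (z + y) (- y)
    = g1 z * cnj (g1 (z - 2 * d * y + (- d - d\<^sup>2))) * g0 (z + y) * cnj (g0 ((z + (1 - 2 * d) * y) - d\<^sup>2)) * ee (\<xi> (- d) * (z + 0 * y + y\<^sup>2))" for d z y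
  proof -
    have e: "z + y - 2 * - d * - y - (- d)\<^sup>2 = z + (1 - 2 * d) * y - d\<^sup>2" "z + y + - y = z"
      "z - 2 * - d * - y + - d - (- d)\<^sup>2 = z - 2 * d * y + (- d - d\<^sup>2)" "z + (- y)\<^sup>2 = z + 0 * y + y\<^sup>2"
      by (simp_all add: algebra_simps)
    show ?thesis unfolding T_def e by (simp only: mult_ac)
  qed
  have "c\<^sup>2 \<le> (cmod (pavg g0 g1 g2 G))\<^sup>2" using c by (intro power_mono)
  also have "\<dots> \<le> (AV d. cmod ((AV z. (AV y. T d z y))))" using \<xi> unfolding T_def .
  finally have "c\<^sup>2 \<le> (AV d. cmod ((AV z. (AV y. g1 z * cnj (g1 (z - 2 * d * y + (- d - d\<^sup>2))) * g0 (z + y) * cnj (g0 ((z + (1 - 2 * d) * y) - d\<^sup>2)) * ee (\<xi> (- d) * (z + 0 * y + y\<^sup>2))))))"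
    unfolding neg T .
  then have "\<exists>\<omega> \<beta>. ((c\<^sup>2) ^ 4 / 2) ^ 8 / 2 \<le> (cmod ((AV x. g1 x * ee (\<omega> * x\<^sup>2 + \<beta> * x))))\<^sup>2"
    using l g
    by (intro quadratic_phase[where a="\<lambda>_. g0" and b="\<lambda>d v. cnj (g0 (v - d\<^sup>2))" and \<delta>="\<lambda>d. - d - d\<^sup>2" and \<xi>="\<lambda>d. \<xi> (- d)" and \<kappa>=0])
      (auto simp: large_def power_mult[symmetric] intro!: bd_cnj bd_comp[of g0] cgp_intros)
  then show ?thesis by (simp add: gain_def power_mult[symmetric])
qed

definition qp :: "int \<Rightarrow> int \<Rightarrow> int \<Rightarrow> complex"
  where "qp \<omega> \<beta> x = ee (\<omega> * x\<^sup>2 + \<beta> * x)"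

lemma bd_qp: "bd (qp \<omega> \<beta>)"
  unfolding qp_def by (intro bd_ee cgp_intros)

text \<open>The functional is at most the mean of \<open>cmod (H x)\<close> on bounded functions,
  while at the conjugate of its kernel it equals the mean square. So the argument may be exchanged
  for the dual function at the price of squaring \<open>c\<close>.\<close>

lemma dual_trick:
  assumes L: "\<And>f. L f = (AV x. f x * H x)" and f: "bd f" and c: "0 \<le> c" "c \<le> cmod (L f)"
  shows "c\<^sup>2 \<le> cmod (L (\<lambda>x. cnj (H x)))"
proof -
  have "cmod (L f) \<le> (AV x. cmod (H x))"
    unfolding L by (rule order_trans[OF cmod_E E_mono]) (simp add: norm_mult bd_le[OF f] mult_left_le_one_le)
  with c have "c\<^sup>2 \<le> ((AV x. cmod (H x)))\<^sup>2" by (intro power_mono) auto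
  also have "\<dots> \<le> (AV x. (cmod (H x))\<^sup>2)" by (rule E_sq_le)
  also have "\<dots> = Re (L (\<lambda>x. cnj (H x)))"
  proof -
    have "L (\<lambda>x. cnj (H x)) = complex_of_real ((AV x. (cmod (H x))\<^sup>2))"
      unfolding L E_of_real[symmetric] complex_norm_square by (simp add: mult.commute)
    then show ?thesis by simp
  qed
  also have "\<dots> \<le> cmod (L (\<lambda>x. cnj (H x)))" by (rule complex_Re_le_cmod)
  finally show ?thesis .
qed

lemma dual_phase:
  assumes L: "\<And>f. L f = (AV x. f x * H x)"
    and "c \<le> (cmod ((AV x. cnj (H x) * ee (\<omega> * x\<^sup>2 + \<beta> * x))))\<^sup>2"
  shows "sqrt c \<le> cmod (L (qp (- \<omega>) (- \<beta>)))"
proof -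
  have "cnj ((AV x. cnj (H x) * ee (\<omega> * x\<^sup>2 + \<beta> * x))) = L (qp (- \<omega>) (- \<beta>))"
    unfolding L cnj_E qp_def by (simp add: cnj_ee mult.commute)
  then have "cmod ((AV x. cnj (H x) * ee (\<omega> * x\<^sup>2 + \<beta> * x))) = cmod (L (qp (- \<omega>) (- \<beta>)))"
    by (metis complex_mod_cnj)
  with assms(2) show ?thesis by (intro real_le_lsqrt) auto
qed

lemma pavg_dual_0: "pavg f g1 g2 G = (AV x. f x * (AV y. g1 (x + y) * g2 (x + y\<^sup>2) * G (x + y + y\<^sup>2)))"
  unfolding pavg_def by (simp add: E_cmult_left mult.assoc)

lemma pavg_dual_1:
  assumes "bd g0" "bd f" "bd g2" "bd G"
  shows "pavg g0 f g2 G = (AV x. f x * (AV y. g0 (x - y) * g2 (x - y + y\<^sup>2) * G (x + y\<^sup>2)))"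
proof -
  have "per (\<lambda>x. g0 x * f (x + y) * g2 (x + y\<^sup>2) * G (x + y + y\<^sup>2))" for y
    by (intro per_mult bd_per[OF assms(1)] bdc[OF assms(2)] bdc[OF assms(3)] bdc[OF assms(4)] cgp_intros)
  from E_shear[of "\<lambda>x y. g0 x * f (x + y) * g2 (x + y\<^sup>2) * G (x + y + y\<^sup>2)" "\<lambda>y. - y", OF this]
  have "pavg g0 f g2 G = (AV x. (AV y. g0 (x - y) * f x * g2 (x - y + y\<^sup>2) * G (x + y\<^sup>2)))"
    by (simp add: pavg_def)
  also have "\<dots> = (AV x. (AV y. f x * (g0 (x - y) * g2 (x - y + y\<^sup>2) * G (x + y\<^sup>2))))"
    by (simp only: mult_ac)
  finally show ?thesis by (simp only: E_cmult_left)
qed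

text \<open>\<open>phase_0\<close> is applied to the dual function in the place of
  \<open>g0\<close>, not to \<open>g0\<close>: correlation of the dual function with a phase is
  exactly a large average with the conjugate phase in that place. \<open>replace_1\<close> is the
  same for \<open>g1\<close>.\<close>

lemma replace_0:
  assumes g: "bd g0" "bd g1" "bd g2" "structured G" and c: "0 \<le> c" "c \<le> cmod (pavg g0 g1 g2 G)" and l: "large (c\<^sup>2)"
  shows "\<exists>\<omega> \<beta>. sqrt (gain (c\<^sup>2)) \<le> cmod (pavg (qp \<omega> \<beta>) g1 g2 G)"
proof -
  define H where "H x = (AV y. g1 (x + y) * g2 (x + y\<^sup>2) * G (x + y + y\<^sup>2))" for x
  note bG = structured_bd[OF g(4)]
  have L: "pavg f g1 g2 G = (AV x. f x * H x)" for f
    unfolding pavg_dual_0 H_def ..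
  have "per H" unfolding H_def
    by (intro per_E per_mult bdc[OF g(2)] bdc[OF g(3)] bdc[OF bG] cgp_intros)
  moreover have "cmod (H x) \<le> 1" for x
    unfolding H_def using g bG by (intro cmod_E_le_1) (simp add: norm_mult bd_le mult_le_one)
  ultimately have H: "bd (\<lambda>x. cnj (H x))" by (intro bd_cnj) (simp add: bd_def)
  have "c\<^sup>2 \<le> cmod (pavg (\<lambda>x. cnj (H x)) g1 g2 G)"
    by (rule dual_trick[OF L g(1) c])
  from phase_0[OF H g(2-4) _ this l] obtain \<omega> \<beta>
    where "gain (c\<^sup>2) \<le> (cmod ((AV x. cnj (H x) * ee (\<omega> * x\<^sup>2 + \<beta> * x))))\<^sup>2" by auto
  from dual_phase[OF L this] show ?thesis by blast
qed

lemma replace_1: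
  assumes g: "bd g0" "bd g1" "bd g2" "structured G" and c: "0 \<le> c" "c \<le> cmod (pavg g0 g1 g2 G)" and l: "large (c\<^sup>2)"
  shows "\<exists>\<omega> \<beta>. sqrt (gain (c\<^sup>2)) \<le> cmod (pavg g0 (qp \<omega> \<beta>) g2 G)"
proof -
  define H where "H x = (AV y. g0 (x - y) * g2 (x - y + y\<^sup>2) * G (x + y\<^sup>2))" for x
  note bG = structured_bd[OF g(4)]
  define L where "L f = (AV x. f x * H x)" for f
  have L: "pavg g0 f g2 G = L f" if "bd f" for f
    unfolding L_def H_def by (rule pavg_dual_1[OF g(1) that g(3) bG])
  have "per H" unfolding H_def
    by (intro per_E per_mult bdc[OF g(1)] bdc[OF g(3)] bdc[OF bG] cgp_intros)
  moreover have "cmod (H x) \<le> 1" for x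
    unfolding H_def using g bG by (intro cmod_E_le_1) (simp add: norm_mult bd_le mult_le_one)
  ultimately have H: "bd (\<lambda>x. cnj (H x))" by (intro bd_cnj) (simp add: bd_def)
  have "c\<^sup>2 \<le> cmod (pavg g0 (\<lambda>x. cnj (H x)) g2 G)"
    unfolding L[OF H] by (rule dual_trick[OF L_def g(2) c(1)]) (use c(2) L[OF g(2)] in simp)
  from phase_1[OF g(1) H g(3-4) _ this l] obtain \<omega> \<beta>
    where "gain (c\<^sup>2) \<le> (cmod ((AV x. cnj (H x) * ee (\<omega> * x\<^sup>2 + \<beta> * x))))\<^sup>2" by auto
  from dual_phase[OF L_def this] show ?thesis unfolding L[OF bd_qp, symmetric] by blast
qed

text \<open>With \<open>z = x + y\<^sup>2\<close> the two phases combine to \<open>q z y\<close>,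
  and the box differences leave a phase linear in \<open>z\<close> with coefficient
  \<open>- 4 * W * k * l\<close>. If \<open>W\<close> vanishes, the cubic term leaves one linear in
  \<open>y\<close> with coefficient \<open>- 12 * \<omega>\<^sub>1 * k * l\<close>; invertibility of
  12 is where \<open>p > 3\<close> enters. If both quadratic coefficients vanish, removing
  \<open>g2\<close> alone leaves the linear phase \<open>2 * B * k * y\<close>. If \<open>B\<close>
  vanishes too, the phase splits into functions of \<open>z\<close> and of \<open>z + y\<close>, and
  a Fourier coefficient of \<open>g2\<close> factors out.\<close>

lemma phases_vanish:
  assumes g2: "bd g2" and G: "bd G"
  shows "cmod (pavg (qp \<omega>\<^sub>0 \<beta>\<^sub>0) (qp \<omega>\<^sub>1 \<beta>\<^sub>1) g2 G) ^ 4 \<le> 2 / real p + gowers 1 g2"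
proof -
  let ?L = "pavg (qp \<omega>\<^sub>0 \<beta>\<^sub>0) (qp \<omega>\<^sub>1 \<beta>\<^sub>1) g2 G"
  define W where "W = \<omega>\<^sub>0 + \<omega>\<^sub>1"
  define B where "B = \<beta>\<^sub>0 + \<beta>\<^sub>1"
  define q where "q z y = W * (z - y\<^sup>2)\<^sup>2 + \<omega>\<^sub>1 * (2 * y * z - 2 * y ^ 3 + y\<^sup>2) + B * (z - y\<^sup>2) + \<beta>\<^sub>1 * y" for z y
  have L: "?L = (AV z. (AV y. g2 z * G (z + y) * ee (q z y)))"
  proof -
    have "per (\<lambda>x. qp \<omega>\<^sub>0 \<beta>\<^sub>0 x * qp \<omega>\<^sub>1 \<beta>\<^sub>1 (x + y) * g2 (x + y\<^sup>2) * G (x + y + y\<^sup>2))" for y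
      by (intro per_mult bd_per[OF bd_qp] bdc[OF bd_qp] bdc[OF g2] bdc[OF G] cgp_intros)
    from E_shear[of "\<lambda>x y. qp \<omega>\<^sub>0 \<beta>\<^sub>0 x * qp \<omega>\<^sub>1 \<beta>\<^sub>1 (x + y) * g2 (x + y\<^sup>2) * G (x + y + y\<^sup>2)" "\<lambda>y. - y\<^sup>2", OF this]
    have "?L = (AV z. (AV y. qp \<omega>\<^sub>0 \<beta>\<^sub>0 (z - y\<^sup>2) * qp \<omega>\<^sub>1 \<beta>\<^sub>1 (z - y\<^sup>2 + y) * g2 z * G (z + y)))"
      by (simp add: pavg_def)
    moreover have "qp \<omega>\<^sub>0 \<beta>\<^sub>0 (z - y\<^sup>2) * qp \<omega>\<^sub>1 \<beta>\<^sub>1 (z - y\<^sup>2 + y) = ee (q z y)" for z y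
      unfolding qp_def ee_add[symmetric] q_def W_def B_def by (simp add: algebra_simps power2_eq_square power3_eq_cube)
    ultimately show ?thesis by (simp add: mult_ac)
  qed
  have pq: "per (\<lambda>y. ee (q z y))" "per (\<lambda>z. ee (q z y))" for z y
    unfolding q_def by (intro per_eec cgp_intros)+
  define D where "D z y k l = q z y - q z (y + k) - q (z - l) (y + l) + q (z - l) (y + l + k)" for z y k l
  define r where "r y k l = D 0 y k l" for y k l
  define i :: "int \<Rightarrow> real" where "i n = (if int p dvd n then 1 else 0)" for n
  have D_W: "D z y k l = r y k l + (- (4 * W * k * l)) * z" for z y k l
    unfolding r_def D_def q_def by (simp add: algebra_simps power2_eq_square power3_eq_cube)
  \<comment> \<open>The part of the difference multiplied by \<open>W\<close>; it drops out modulo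
    \<open>p\<close> in the case where \<open>r_\<omega>\<close> is applied.\<close>
  define s where "s y k l = (- y\<^sup>2)\<^sup>2 - (- (y + k)\<^sup>2)\<^sup>2 - (- l - (y + l)\<^sup>2)\<^sup>2 + (- l - (y + l + k)\<^sup>2)\<^sup>2" for y k l :: int
  have r_\<omega>: "r y k l = W * s y k l + ((- (12 * \<omega>\<^sub>1 * k * l)) * y + (- (6 * \<omega>\<^sub>1 * k * l * (k + l)) - 2 * B * k * l))" for y k l
    unfolding r_def D_def q_def s_def by (simp add: algebra_simps power2_eq_square power3_eq_cube)
  have box: "cmod ?L ^ 4 \<le> (AV k. (AV l. cmod ((AV z. (AV y. ee (D z y k l))))))"
  proof -
    have "ee (q z y) * cnj (ee (q z (y + k))) * cnj (ee (q (z - l) (y + l))) * ee (q (z - l) (y + l + k)) = ee (D z y k l)" for z y k l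
      unfolding D_def cnj_ee ee_add[symmetric] by (simp add: algebra_simps)
    then show ?thesis unfolding L using box_bound[OF g2 G pq] by simp
  qed
  have ind: "(AV k. (AV l. i k + i l)) = 2 / real p"
  proof -
    have "E i = 1 / real p" using E_dvd[OF not_dvd_1, of 0] by (simp add: i_def[abs_def])
    then show ?thesis by (simp add: E_add)
  qed
  have from_small: "cmod ?L ^ 4 \<le> 2 / real p" if "\<And>k l. \<not> int p dvd k \<Longrightarrow> \<not> int p dvd l \<Longrightarrow> (AV z. (AV y. ee (D z y k l))) = 0"
  proof -
    have "cmod ((AV z. (AV y. ee (D z y k l)))) \<le> i k + i l" for k l
    proof (cases "int p dvd k \<or> int p dvd l")
      case True
      then have "1 \<le> i k + i l" by (auto simp: i_def)
      moreover have "cmod ((AV z. (AV y. ee (D z y k l)))) \<le> 1" by (intro cmod_E_le_1) simp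
      ultimately show ?thesis by linarith
    next
      case False
      then show ?thesis using that by (simp add: i_def)
    qed
    then have "(AV k. (AV l. cmod ((AV z. (AV y. ee (D z y k l)))))) \<le> (AV k. (AV l. i k + i l))"
      by (intro E_mono)
    with box show ?thesis unfolding ind by linarith
  qed
  have gowers: "0 \<le> gowers 1 g2" by (rule gowers_nonneg)
  consider "\<not> int p dvd W" | "int p dvd W" "\<not> int p dvd \<omega>\<^sub>1" | "int p dvd W" "int p dvd \<omega>\<^sub>1" "\<not> int p dvd B"
    | "int p dvd W" "int p dvd \<omega>\<^sub>1" "int p dvd B" by blast
  then show ?thesis
  proof cases
    case 1
    have "(AV z. (AV y. ee (D z y k l))) = 0" if kl: "\<not> int p dvd k" "\<not> int p dvd l" for k l
    proof -
      have "\<not> int p dvd 4 * W * k * l" using 1 kl not_dvd_4 dvd_cancel by blast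
      then have "\<not> int p dvd - (4 * W * k * l)" by simp
      then have "(AV z. ee (- (4 * W * k * l) * z)) = 0" by (subst E_ee) simp
      then show ?thesis unfolding D_W ee_add by (subst E_swap) (simp only: E_cmult_left E_const mult_zero_right)
    qed
    from from_small[OF this] gowers show ?thesis by linarith
  next
    case 2
    have "(AV z. (AV y. ee (D z y k l))) = 0" if kl: "\<not> int p dvd k" "\<not> int p dvd l" for k l
    proof -
      have "int p dvd 4 * 3 * \<omega>\<^sub>1 * k * l \<Longrightarrow> False" using 2 kl not_dvd_4 not_dvd_3 dvd_cancel by blast
      then have "\<not> int p dvd - (12 * \<omega>\<^sub>1 * k * l)" by auto
      then have 0: "(AV y. ee (- (12 * \<omega>\<^sub>1 * k * l) * y)) = 0" by (subst E_ee) simp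
      have "ee (D z y k l) = ee (- (12 * \<omega>\<^sub>1 * k * l) * y) * ee (- (6 * \<omega>\<^sub>1 * k * l * (k + l)) - 2 * B * k * l)" for z y
      proof -
        have "[D z y k l = - (12 * \<omega>\<^sub>1 * k * l) * y + (- (6 * \<omega>\<^sub>1 * k * l * (k + l)) - 2 * B * k * l)] (mod int p)"
          unfolding D_W r_\<omega> using 2(1) by (auto simp: cong_iff_dvd_diff)
        from per_cong[OF per_ee this] show ?thesis by (simp only: ee_add)
      qed
      then show ?thesis by (simp only: E_cmult_right 0 E_const mult_zero_left)
    qed
    from from_small[OF this] gowers show ?thesis by linarith
  next
    case 3
    have eq: "ee (q z y) = ee (B * (z - y\<^sup>2) + \<beta>\<^sub>1 * y)" for z y
      using 3 by (intro per_cong[OF per_ee]) (auto simp: q_def cong_iff_dvd_diff)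
    define b where "b k w = G w * cnj (G (w + k))" for k w
    have b: "bd (b k)" for k unfolding b_def by (rule bd_deriv[OF G])
    have "(cmod ?L)\<^sup>2 \<le> (AV k. cmod ((AV z. (AV y. (G (z + y) * ee (q z y)) * cnj (G (z + (y + k)) * ee (q z (y + k)))))))"
    proof -
      have "?L = (AV z. g2 z * (AV y. G (z + y) * ee (q z y)))"
        unfolding L by (simp add: E_cmult_left mult.assoc)
      then show ?thesis
        by (simp only:) (rule vdC[OF bd_le[OF g2]], intro per_mult bdc[OF G] pq cgp_intros)
    qed
    also have "\<dots> \<le> E i"
    proof (rule E_mono)
      fix k
      have "(G (z + y) * ee (q z y)) * cnj (G (z + (y + k)) * ee (q z (y + k))) = b k (z + y) * ee (2 * B * k * y + (B * k\<^sup>2 - \<beta>\<^sub>1 * k))" for z y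
      proof -
        have "ee (q z y) * cnj (ee (q z (y + k))) = ee (2 * B * k * y + (B * k\<^sup>2 - \<beta>\<^sub>1 * k))"
          unfolding eq cnj_ee ee_add[symmetric] by (simp add: algebra_simps power2_eq_square)
        then show ?thesis unfolding b_def complex_cnj_mult by (simp add: mult_ac add_ac)
      qed
      then have "(AV z. (AV y. (G (z + y) * ee (q z y)) * cnj (G (z + (y + k)) * ee (q z (y + k)))))
        = (AV z. (AV y. b k (z + y) * ee (2 * B * k * y + (B * k\<^sup>2 - \<beta>\<^sub>1 * k))))" by simp
      also have "\<dots> = (AV y. E (b k) * ee (2 * B * k * y + (B * k\<^sup>2 - \<beta>\<^sub>1 * k)))"
        by (subst E_swap) (simp add: E_cmult_right E_shift[OF bd_per[OF b]])
      also have "\<dots> = E (b k) * (AV y. ee (2 * B * k * y)) * ee (B * k\<^sup>2 - \<beta>\<^sub>1 * k)"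
        unfolding ee_add by (simp add: E_cmult_left E_cmult_right)
      finally have *: "cmod ((AV z. (AV y. (G (z + y) * ee (q z y)) * cnj (G (z + (y + k)) * ee (q z (y + k)))))) = cmod (E (b k)) * cmod ((AV y. ee (2 * B * k * y)))"
        by (simp add: norm_mult)
      show "cmod ((AV z. (AV y. (G (z + y) * ee (q z y)) * cnj (G (z + (y + k)) * ee (q z (y + k)))))) \<le> i k"
      proof (cases "int p dvd k")
        case True
        have "cmod (E (b k)) * cmod ((AV y. ee (2 * B * k * y))) \<le> 1"
          by (intro mult_le_one cmod_E_le_1 bd_le[OF b]) auto
        with True show ?thesis unfolding * by (simp add: i_def)
      next
        case False
        then have "\<not> int p dvd 2 * B * k" using 3 not_dvd_2 dvd_cancel by blast
        then show ?thesis unfolding * E_ee by (simp add: i_def)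
      qed
    qed
    also have "E i = 1 / real p" using E_dvd[OF not_dvd_1, of 0] by (simp add: i_def[abs_def])
    finally have "(cmod ?L)\<^sup>2 \<le> 1 / real p" .
    moreover have "cmod ?L \<le> 1"
      unfolding L by (intro cmod_E_le_1) (simp add: norm_mult bd_le[OF g2] bd_le[OF G] mult_le_one)
    then have "cmod ?L ^ 4 \<le> (cmod ?L)\<^sup>2" by (intro power_decreasing) auto
    moreover have "1 / real p \<le> 2 / real p" by (simp add: divide_right_mono)
    ultimately show ?thesis using gowers by linarith
  next
    case 4
    have eq: "ee (q z y) = ee (- (\<beta>\<^sub>1 * z)) * ee (\<beta>\<^sub>1 * (z + y))" for z y
      unfolding ee_add[symmetric]
      using 4 by (intro per_cong[OF per_ee]) (auto simp: q_def cong_iff_dvd_diff algebra_simps)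
    define a where "a z = g2 z * ee (- (\<beta>\<^sub>1 * z))" for z
    define b where "b w = G w * ee (\<beta>\<^sub>1 * w)" for w
    have ab: "bd a" "bd b" unfolding a_def b_def by (intro bd_mult g2 G bd_ee cgp_intros)+
    have "?L = (AV z. (AV y. a (z + 0 * y) * b (z + 1 * y)))"
      unfolding L eq a_def b_def by (simp add: mult_ac)
    also have "\<dots> = E a * E b" using not_dvd_1 by (intro linear_forms_2 ab bd_per[OF ab(2)]) auto
    finally have "cmod ?L \<le> cmod (E a) * 1"
      using cmod_E_le_1[of b, OF bd_le[OF ab(2)]] by (simp add: norm_mult mult_left_le)
    then have "cmod ?L ^ 4 \<le> cmod (E a) ^ 4" by (intro power_mono) auto
    also have "\<dots> = (four_sq g2 \<beta>\<^sub>1)\<^sup>2" by (simp add: four_sq_def a_def[abs_def])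
    also have "\<dots> \<le> gowers 1 g2" by (rule four_sq_le_gowers_1[OF bd_per[OF g2]])
    finally have "cmod ?L ^ 4 \<le> gowers 1 g2" .
    moreover have "0 \<le> 2 / real p" by simp
    ultimately show ?thesis by linarith
  qed
qed

definition gain2 :: "real \<Rightarrow> real"
  where "gain2 c = sqrt (gain ((sqrt (gain (c\<^sup>2)))\<^sup>2))"

lemma structured_control:
  assumes g: "bd g0" "bd g1" "bd g2" "structured G" and c: "0 \<le> c" "c \<le> cmod (pavg g0 g1 g2 G)"
    and l: "large (c\<^sup>2)" "large ((sqrt (gain (c\<^sup>2)))\<^sup>2)"
  shows "gain2 c ^ 4 \<le> 2 / real p + gowers 1 g2"
proof -
  from replace_0[OF g c l(1)] obtain \<omega>\<^sub>0 \<beta>\<^sub>0 where 0: "sqrt (gain (c\<^sup>2)) \<le> cmod (pavg (qp \<omega>\<^sub>0 \<beta>\<^sub>0) g1 g2 G)" by blast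
  have pos: "0 \<le> gain x" for x by (simp add: gain_def)
  from replace_1[OF bd_qp g(2-4) _ 0 l(2)] pos obtain \<omega>\<^sub>1 \<beta>\<^sub>1
    where "gain2 c \<le> cmod (pavg (qp \<omega>\<^sub>0 \<beta>\<^sub>0) (qp \<omega>\<^sub>1 \<beta>\<^sub>1) g2 G)"
    unfolding gain2_def by auto
  then have "gain2 c ^ 4 \<le> cmod (pavg (qp \<omega>\<^sub>0 \<beta>\<^sub>0) (qp \<omega>\<^sub>1 \<beta>\<^sub>1) g2 G) ^ 4"
    using pos by (intro power_mono) (simp_all add: gain2_def)
  also have "\<dots> \<le> 2 / real p + gowers 1 g2" by (rule phases_vanish[OF g(3) structured_bd[OF g(4)]])
  finally show ?thesis .
qed

subsection \<open>Interchanging duals and differences\<close>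

text \<open>A norm-like quantity for the mean of \<open>K y\<close> over \<open>y\<close>, with the
  derivatives taken of each \<open>K y\<close> before averaging over \<open>y\<close>. For the
  family \<open>dual_fam\<close> such derivatives are again of the form \<open>dual_fam\<close>,
  which fails for derivatives of the mean.\<close>

primrec dcorr :: "nat \<Rightarrow> (int \<Rightarrow> int \<Rightarrow> complex) \<Rightarrow> real" where
  "dcorr 0 K = (SUP G\<in>Collect structured. cmod ((AV x. (AV y. K y x * G x))))"
| "dcorr (Suc m) K = (AV h. (AV h'. dcorr m (\<lambda>y x. K y (x + h) * cnj (K y (x + h')))))"

lemma structured_one: "structured (\<lambda>x. 1)"
  using structured_basic[of "\<lambda>_. 1" "\<lambda>_. 1" "\<lambda>_. 0"] by (simp add: bd_def per_const)

lemma dcorr_0_bdd: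
  assumes K: "\<And>y. bd (K y)"
  shows "bdd_above ((\<lambda>G. cmod ((AV x. (AV y. K y x * G x)))) ` Collect structured)"
proof (rule bdd_aboveI2[of _ _ 1])
  fix G assume "G \<in> Collect structured"
  then have "bd G" by (simp add: structured_bd)
  then show "cmod ((AV x. (AV y. K y x * G x))) \<le> 1"
    using K by (intro cmod_E_le_1) (simp add: norm_mult bd_le mult_le_one)
qed

lemma dcorr_0_upper:
  assumes "\<And>y. bd (K y)" "structured G"
  shows "cmod ((AV x. (AV y. K y x * G x))) \<le> dcorr 0 K"
  unfolding dcorr.simps using assms by (intro cSUP_upper dcorr_0_bdd) auto

lemma dcorr_0_approx:
  assumes K: "\<And>y. bd (K y)" and e: "0 < e"
  shows "\<exists>G. structured G \<and> dcorr 0 K \<le> cmod ((AV x. (AV y. K y x * G x))) + e"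
proof -
  have "\<exists>G\<in>Collect structured. dcorr 0 K - e < cmod ((AV x. (AV y. K y x * G x)))"
    using less_cSUP_iff[OF _ dcorr_0_bdd[of K, OF K], of "dcorr 0 K - e"] e structured_one by auto
  then show ?thesis by force
qed

lemma bd_pair_shift: "bd f \<Longrightarrow> bd (\<lambda>x. f (x + h) * cnj (f (x + h')))"
proof -
  assume f: "bd f"
  show ?thesis by (intro bd_mult bd_cnj bd_comp[OF f] cgp_intros)
qed

lemma dcorr_bounds:
  assumes K: "\<And>y. bd (K y)"
  shows "0 \<le> dcorr m K \<and> dcorr m K \<le> 1"
  using K
proof (induction m arbitrary: K)
  case 0
  have "0 \<le> cmod ((AV x. (AV y. K y x * 1)))" by simp
  also have "\<dots> \<le> dcorr 0 K" using 0 structured_one by (intro dcorr_0_upper)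
  finally have "0 \<le> dcorr 0 K" .
  moreover have "dcorr 0 K \<le> 1"
    unfolding dcorr.simps
  proof (rule cSUP_least)
    fix G assume "G \<in> Collect structured"
    then have "bd G" by (simp add: structured_bd)
    then show "cmod ((AV x. (AV y. K y x * G x))) \<le> 1"
      using 0 by (intro cmod_E_le_1) (simp add: norm_mult bd_le mult_le_one)
  qed (use structured_one in auto)
  ultimately show ?case by simp
next
  case (Suc m)
  then have "0 \<le> dcorr m (\<lambda>y x. K y (x + h) * cnj (K y (x + h'))) \<and> dcorr m (\<lambda>y x. K y (x + h) * cnj (K y (x + h'))) \<le> 1" for h h'
    by (intro Suc.IH bd_pair_shift)
  then show ?case by (auto intro!: E_nonneg E_le_const)
qed

lemma E_swap4: "(AV a. (AV b. (AV c. (AV d. T a b c d)))) = (AV c. (AV d. (AV a. (AV b. T a b c d))))"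
proof -
  have "(AV a. (AV b. (AV c. (AV d. T a b c d)))) = (AV a. (AV c. (AV b. (AV d. T a b c d))))"
    by (intro E_cong E_swap)
  also have "\<dots> = (AV c. (AV a. (AV b. (AV d. T a b c d))))" by (rule E_swap)
  also have "\<dots> = (AV c. (AV a. (AV d. (AV b. T a b c d))))" by (intro E_cong E_swap)
  also have "\<dots> = (AV c. (AV d. (AV a. (AV b. T a b c d))))" by (intro E_cong E_swap)
  finally show ?thesis .
qed

lemma cmod_E_sq': "complex_of_real ((cmod (E w))\<^sup>2) = (AV h. (AV h'. w h * cnj (w h')))"
  unfolding complex_norm_square cnj_E by (simp add: E_cmult_left E_cmult_right)

lemma ex_phase: "\<exists>b. cmod b \<le> 1 \<and> complex_of_real (cmod z) = b * z"
proof (cases "z = 0")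
  case False
  then have "complex_of_real (cmod z) = (cnj z / cmod z) * z"
    using complex_norm_square[of z] by (simp add: power2_eq_square field_simps)
  with False show ?thesis by (intro exI[of _ "cnj z / cmod z"]) (simp add: norm_divide)
qed (auto intro: exI[of _ 0])

text \<open>After aligning phases and moving the average over \<open>h\<close> inside,
  \<open>a\<close> no longer interferes and Cauchy--Schwarz in \<open>x\<close> and \<open>y\<close>
  removes it. The test functions for \<open>h\<close> and \<open>h'\<close> then multiply, hence the
  need for closure of \<open>structured\<close> under products and conjugates.\<close>

lemma interchange_0:
  assumes K: "\<And>y. bd (K y)" and a: "bd a" and G: "\<And>h. structured (G h)"
  shows "((AV h. cmod ((AV x. (AV y. K y (x + h) * a x * G h x)))))\<^sup>2 \<le> dcorr 1 K"
proof -
  define V where "V h = (AV x. (AV y. K y (x + h) * a x * G h x))" for h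
  obtain b where b: "\<And>h. cmod (b h) \<le> 1" "\<And>h. complex_of_real (cmod (V h)) = b h * V h"
    using ex_phase[of "V _"] by metis
  define w where "w x y h = b h * (K y (x + h) * G h x)" for x y h
  have "complex_of_real ((AV h. cmod (V h))) = (AV h. (AV x. (AV y. a x * w x y h)))"
    unfolding E_of_real[symmetric] b(2)
    unfolding V_def w_def E_cmult_left[symmetric] by (simp only: mult_ac)
  also have "\<dots> = (AV x. (AV h. (AV y. a x * w x y h)))" by (rule E_swap)
  also have "\<dots> = (AV x. (AV y. (AV h. a x * w x y h)))" by (intro E_cong E_swap)
  also have "\<dots> = (AV x. (AV y. a x * E (w x y)))" by (simp only: E_cmult_left)
  finally have eq: "complex_of_real ((AV h. cmod (V h))) = (AV x. (AV y. a x * E (w x y)))" .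
  have "\<bar>(AV h. cmod (V h))\<bar> = cmod ((AV x. (AV y. a x * E (w x y))))"
    unfolding eq[symmetric] by simp
  also have "\<dots> \<le> (AV x. (AV y. cmod (E (w x y))))"
    by (rule order_trans[OF cmod_E E_mono], rule order_trans[OF cmod_E E_mono])
      (simp add: norm_mult mult_left_le_one_le bd_le[OF a])
  finally have "\<bar>(AV h. cmod (V h))\<bar>\<^sup>2 \<le> ((AV x. (AV y. cmod (E (w x y)))))\<^sup>2"
    by (rule power_mono) simp
  also have "\<dots> \<le> (AV x. ((AV y. cmod (E (w x y))))\<^sup>2)" by (rule E_sq_le)
  also have "\<dots> \<le> (AV x. (AV y. (cmod (E (w x y)))\<^sup>2))" by (intro E_mono E_sq_le)
  also have "\<dots> = Re ((AV h. (AV h'. (AV x. (AV y. w x y h * cnj (w x y h'))))))"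
  proof -
    have "complex_of_real ((AV x. (AV y. (cmod (E (w x y)))\<^sup>2))) = (AV x. (AV y. (AV h. (AV h'. w x y h * cnj (w x y h')))))"
      unfolding E_of_real[symmetric] cmod_E_sq' ..
    also have "\<dots> = (AV h. (AV h'. (AV x. (AV y. w x y h * cnj (w x y h')))))" by (rule E_swap4)
    finally show ?thesis by (metis Re_complex_of_real)
  qed
  also have "\<dots> \<le> cmod ((AV h. (AV h'. (AV x. (AV y. w x y h * cnj (w x y h'))))))" by (rule complex_Re_le_cmod)
  also have "\<dots> \<le> (AV h. (AV h'. cmod ((AV x. (AV y. w x y h * cnj (w x y h'))))))"
    by (rule order_trans[OF cmod_E E_mono], rule cmod_E)
  also have "\<dots> \<le> (AV h. (AV h'. dcorr 0 (\<lambda>y x. K y (x + h) * cnj (K y (x + h')))))"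
  proof (intro E_mono)
    fix h h'
    have "w x y h * cnj (w x y h') = (K y (x + h) * cnj (K y (x + h'))) * ((b h * G h x) * cnj (b h' * G h' x))" for x y
      by (simp add: w_def mult_ac)
    moreover have "structured (\<lambda>x. (b h * G h x) * cnj (b h' * G h' x))"
      by (intro structured_mult structured_cnj structured_cmult G b)
    ultimately show "cmod ((AV x. (AV y. w x y h * cnj (w x y h')))) \<le> dcorr 0 (\<lambda>y x. K y (x + h) * cnj (K y (x + h')))"
      using dcorr_0_upper[of "\<lambda>y x. K y (x + h) * cnj (K y (x + h'))"] K by (simp only: bd_pair_shift)
  qed
  also have "\<dots> = dcorr 1 K" by (simp only: One_nat_def dcorr.simps(2))
  finally show ?thesis unfolding V_def by simp
qed

text \<open>Differencing \<open>K y (x + h) * a x\<close> gives a product of the same shape, so the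
  induction runs with \<open>K\<close> and \<open>a\<close> replaced by their derivatives.\<close>

lemma interchange:
  assumes K: "\<And>y. bd (K y)" and a: "bd a"
  shows "((AV h. dcorr m (\<lambda>y x. K y (x + h) * a x)))\<^sup>2 \<le> dcorr (Suc m) K"
  using assms
proof (induction m arbitrary: K a)
  case 0
  have bK: "bd (\<lambda>x. K y (x + h) * a x)" for y h
    by (intro bd_mult 0 bd_comp[OF 0(1)] cgp_intros)
  \<comment> \<open>The supremum over structured functions need not be attained, so near-maximisers
    are chosen for each \<open>h\<close>.\<close>
  have "(AV h. dcorr 0 (\<lambda>y x. K y (x + h) * a x)) \<le> sqrt (dcorr 1 K) + e" if e: "0 < e" for e
  proof -
    have "\<forall>h. \<exists>G. structured G \<and> dcorr 0 (\<lambda>y x. K y (x + h) * a x) \<le> cmod ((AV x. (AV y. K y (x + h) * a x * G x))) + e"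
      by (rule allI, rule dcorr_0_approx[OF bK e])
    from choice[OF this] obtain G where "\<forall>h. structured (G h) \<and> dcorr 0 (\<lambda>y x. K y (x + h) * a x) \<le> cmod ((AV x. (AV y. K y (x + h) * a x * G h x))) + e"
      by blast
    then have G: "structured (G h)" "dcorr 0 (\<lambda>y x. K y (x + h) * a x) \<le> cmod ((AV x. (AV y. K y (x + h) * a x * G h x))) + e" for h
      by blast+
    have "(AV h. dcorr 0 (\<lambda>y x. K y (x + h) * a x)) \<le> (AV h. cmod ((AV x. (AV y. K y (x + h) * a x * G h x))) + e)"
      by (intro E_mono G)
    also have "\<dots> = (AV h. cmod ((AV x. (AV y. K y (x + h) * a x * G h x)))) + e"
      by (simp add: E_add)
    also have "\<dots> \<le> sqrt (dcorr 1 K) + e"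
      using interchange_0[OF 0 G(1)] by (intro add_right_mono real_le_rsqrt)
    finally show ?thesis .
  qed
  then have "(AV h. dcorr 0 (\<lambda>y x. K y (x + h) * a x)) \<le> sqrt (dcorr 1 K)"
    by (rule field_le_epsilon)
  moreover have "0 \<le> (AV h. dcorr 0 (\<lambda>y x. K y (x + h) * a x))"
    using dcorr_bounds[of "\<lambda>y x. K y (x + _) * a x" 0, OF bK] by (intro E_nonneg) (rule conjunct1)
  ultimately have "((AV h. dcorr 0 (\<lambda>y x. K y (x + h) * a x)))\<^sup>2 \<le> (sqrt (dcorr 1 K))\<^sup>2"
    by (rule power_mono)
  also have "\<dots> = dcorr 1 K" using dcorr_bounds[of K 1, OF 0(1)] by simp
  finally show ?case by (simp only: One_nat_def)
next
  case (Suc m)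
  define K' where "K' u u' y x = K y (x + u) * cnj (K y (x + u'))" for u u' y x
  define a' where "a' u u' x = a (x + u) * cnj (a (x + u'))" for u u' x
  have bK': "bd (K' u u' y)" and ba': "bd (a' u u')" for u u' y
    unfolding K'_def a'_def using Suc.prems by (auto intro: bd_pair_shift)
  have "(AV h. dcorr (Suc m) (\<lambda>y x. K y (x + h) * a x)) = (AV h. (AV u. (AV u'. dcorr m (\<lambda>y x. K' u u' y (x + h) * a' u u' x))))"
    by (simp add: K'_def a'_def mult_ac add_ac)
  also have "\<dots> = (AV u. (AV h. (AV u'. dcorr m (\<lambda>y x. K' u u' y (x + h) * a' u u' x))))" by (rule E_swap)
  also have "\<dots> = (AV u. (AV u'. (AV h. dcorr m (\<lambda>y x. K' u u' y (x + h) * a' u u' x))))" by (intro E_cong E_swap)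
  finally have "((AV h. dcorr (Suc m) (\<lambda>y x. K y (x + h) * a x)))\<^sup>2 = ((AV u. (AV u'. (AV h. dcorr m (\<lambda>y x. K' u u' y (x + h) * a' u u' x)))))\<^sup>2"
    by simp
  also have "\<dots> \<le> (AV u. ((AV u'. (AV h. dcorr m (\<lambda>y x. K' u u' y (x + h) * a' u u' x))))\<^sup>2)" by (rule E_sq_le)
  also have "\<dots> \<le> (AV u. (AV u'. ((AV h. dcorr m (\<lambda>y x. K' u u' y (x + h) * a' u u' x)))\<^sup>2))" by (intro E_mono E_sq_le)
  also have "\<dots> \<le> (AV u. (AV u'. dcorr (Suc m) (K' u u')))"
    by (intro E_mono Suc.IH bK' ba')
  also have "\<dots> = (AV u. (AV u'. (AV h. (AV h'. dcorr m (\<lambda>y x. K' u u' y (x + h) * cnj (K' u u' y (x + h')))))))" by simp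
  also have "\<dots> = (AV h. (AV h'. (AV u. (AV u'. dcorr m (\<lambda>y x. K' u u' y (x + h) * cnj (K' u u' y (x + h')))))))" by (rule E_swap4)
  also have "\<dots> = dcorr (Suc (Suc m)) K"
    by (simp add: K'_def mult_ac add_ac)
  finally show ?case .
qed

lemma bd_E_fam:
  assumes "\<And>y. bd (K y)" shows "bd (\<lambda>x. (AV y. K y x))"
  using assms unfolding bd_def by (auto intro!: per_E cmod_E_le_1)

text \<open>For each \<open>h\<close> the derivative of \<open>F\<close> correlates with a linear
  phase of some frequency \<open>\<beta> h\<close>. Collecting \<open>cnj (F (x + h))\<close> with
  these phases over all \<open>h\<close> gives a structured function that correlates with
  \<open>F\<close> itself; this is the source of the arbitrary frequencies.\<close>

lemma gowers_2_le_dcorr: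
  assumes K: "\<And>y. bd (K y)" and F: "F = (\<lambda>x. (AV y. K y x))"
  shows "gowers 2 F \<le> dcorr 0 K"
proof -
  have bF: "bd F" unfolding F by (rule bd_E_fam[OF K])
  define \<Delta> where "\<Delta> h x = F x * cnj (F (x + h))" for h x
  have b\<Delta>: "bd (\<Delta> h)" for h unfolding \<Delta>_def by (rule bd_deriv[OF bF])
  have "\<exists>\<beta>. gowers 1 (\<Delta> h) \<le> four_sq (\<Delta> h) \<beta>" for h by (rule gowers_1_le_four_sq[OF b\<Delta>]) blast
  then obtain \<beta> where \<beta>: "\<And>h. gowers 1 (\<Delta> h) \<le> four_sq (\<Delta> h) (\<beta> h)" by metis
  define V where "V h = (AV x. \<Delta> h x * ee (- (\<beta> h * x)))" for h
  have V: "cmod (V h) \<le> 1" for h unfolding V_def by (intro cmod_E_le_1) (simp add: norm_mult bd_le[OF b\<Delta>])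
  obtain b where b: "\<And>h. cmod (b h) \<le> 1" "\<And>h. complex_of_real (cmod (V h)) = b h * V h"
    using ex_phase[of "V _"] by metis
  define S where "S x = (AV h. b h * cnj (F (x + h)) * ee (- \<beta> h * x))" for x
  have S: "structured S" unfolding S_def by (rule structured_basic[where A="\<lambda>x. cnj (F x)"]) (auto intro: b bd_cnj bF)
  have "gowers 2 F = (AV h. gowers 1 (\<Delta> h))" by (simp only: numeral_2_eq_2 One_nat_def gowers.simps(2) \<Delta>_def[abs_def])
  also have "\<dots> \<le> (AV h. cmod (V h))"
  proof (rule E_mono)
    fix h
    have "four_sq (\<Delta> h) (\<beta> h) = (cmod (V h))\<^sup>2" by (simp add: four_sq_def V_def)
    also have "\<dots> \<le> cmod (V h)" using V[of h] by (simp add: power2_eq_square mult_left_le)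
    finally show "gowers 1 (\<Delta> h) \<le> cmod (V h)" using \<beta>[of h] by linarith
  qed
  also have "\<dots> \<le> cmod ((AV x. (AV y. K y x * S x)))"
  proof -
    have "complex_of_real ((AV h. cmod (V h))) = (AV h. (AV x. F x * (b h * cnj (F (x + h)) * ee (- \<beta> h * x))))"
      unfolding E_of_real[symmetric] b(2)
      unfolding V_def \<Delta>_def E_cmult_left[symmetric] minus_mult_left by (simp only: mult_ac)
    also have "\<dots> = (AV x. (AV y. K y x * S x))"
      by (subst E_swap) (simp add: E_cmult_left E_cmult_right S_def F)
    finally show ?thesis by (metis abs_ge_self norm_of_real)
  qed
  also have "\<dots> \<le> dcorr 0 K" by (rule dcorr_0_upper[OF K S])
  finally show ?thesis .
qed

text \<open>In each derivative only one of the two copies of \<open>F\<close> is expanded as an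
  average over \<open>y\<close>. The other plays the part of \<open>a\<close> in
  \<open>interchange\<close>, and every level costs one squaring.\<close>

lemma gowers_le_dcorr:
  assumes "\<And>y. bd (K y)" and "F = (\<lambda>x. (AV y. K y x))"
  shows "gowers (m + 2) F ^ (2 ^ m) \<le> dcorr m K"
  using assms
proof (induction m arbitrary: K F)
  case 0
  have "gowers 2 F \<le> dcorr 0 K" by (rule gowers_2_le_dcorr[OF 0])
  then show ?case by (simp only: add_0 power_0 power_one_right)
next
  case (Suc m)
  note K = Suc.prems(1)
  have bF: "bd F" unfolding Suc.prems(2) by (rule bd_E_fam[OF K])
  let ?R = "\<lambda>h. gowers (m + 2) (\<lambda>x. F (x + h) * cnj (F x))"
  have "gowers (Suc m + 2) F = (AV h. gowers (m + 2) (\<lambda>x. F x * cnj (F (x + h))))" by (simp only: add_Suc gowers.simps(2))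
  \<comment> \<open>Reversing \<open>h\<close> puts the shift on the unconjugated copy, the one to
    be expanded.\<close>
  also have "\<dots> = (AV h. ?R (- h))"
  proof (rule E_cong)
    fix h
    have "per (\<lambda>x. F (x - h) * cnj (F x))" by (intro per_mult per_cnj bd_per[OF bF] bdc[OF bF] cgp_intros)
    from gowers_shift[OF this, of "m + 2" h] show "gowers (m + 2) (\<lambda>x. F x * cnj (F (x + h))) = ?R (- h)" by simp
  qed
  also have "\<dots> = E ?R"
  proof (rule E_neg)
    show "per ?R" by (intro per_gowers per_mult per_const bdc[OF bF] cgp_intros)
  qed
  finally have "gowers (Suc m + 2) F ^ (2 ^ Suc m) = ((E ?R) ^ (2 ^ m))\<^sup>2" by (simp add: power_mult[symmetric] mult.commute)
  also have "\<dots> \<le> ((AV h. ?R h ^ (2 ^ m)))\<^sup>2"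
    by (intro power_mono E_pow2_le) (auto intro!: E_nonneg gowers_nonneg zero_le_power)
  also have "\<dots> \<le> ((AV h. dcorr m (\<lambda>y x. K y (x + h) * cnj (F x))))\<^sup>2"
  proof (intro power_mono E_mono Suc.IH)
    show "bd (\<lambda>x. K y (x + h) * cnj (F x))" for y h
      by (intro bd_mult bd_cnj bF bd_comp[OF K] cgp_intros)
    show "(\<lambda>x. F (x + h) * cnj (F x)) = (\<lambda>x. (AV y. K y (x + h) * cnj (F x)))" for h
      unfolding E_cmult_right Suc.prems(2) ..
    show "0 \<le> (AV h. ?R h ^ (2 ^ m))" by (intro E_nonneg zero_le_power gowers_nonneg)
  qed
  also have "\<dots> \<le> dcorr (Suc m) K" by (rule interchange[OF K bd_cnj[OF bF]])
  finally show ?case .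
qed

section \<open>The dual family and the symmetries of the progression\<close>

definition dual_fam :: "(int \<Rightarrow> complex) \<Rightarrow> (int \<Rightarrow> complex) \<Rightarrow> (int \<Rightarrow> complex) \<Rightarrow> int \<Rightarrow> int \<Rightarrow> complex"
  where "dual_fam f0 f1 f2 y x = f0 (x - y - y\<^sup>2) * f1 (x - y\<^sup>2) * f2 (x - y)"

lemma bd_dual_fam:
  assumes "bd f0" "bd f1" "bd f2" shows "bd (dual_fam f0 f1 f2 y)"
  unfolding dual_fam_def by (intro bd_mult bd_comp[OF assms(1)] bd_comp[OF assms(2)] bd_comp[OF assms(3)] cgp_intros)

lemma pavg_dual_fam:
  assumes "bd f0" "bd f1" "bd f2" "bd G"
  shows "pavg f0 f1 f2 G = (AV x. (AV y. dual_fam f0 f1 f2 y x * G x))"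
proof -
  have "per (\<lambda>x. dual_fam f0 f1 f2 y x * G x)" for y
    by (intro per_mult bd_per[OF bd_dual_fam] bd_per assms)
  from E_shear[of "\<lambda>x y. dual_fam f0 f1 f2 y x * G x" "\<lambda>y. y + y\<^sup>2", OF this] show ?thesis
    by (simp add: pavg_def dual_fam_def algebra_simps)
qed

lemma E_gowers_pair_shift:
  assumes f: "bd f"
  shows "(AV h. (AV h'. gowers n (\<lambda>x. f (x + h) * cnj (f (x + h'))))) = gowers (Suc n) f"
proof -
  let ?R = "\<lambda>k. gowers n (\<lambda>x. f x * cnj (f (x + k)))"
  have per: "per ?R" by (intro per_gowers per_mult per_const per_cnj bdc[OF f] cgp_intros)
  have "gowers n (\<lambda>x. f (x + h) * cnj (f (x + h'))) = ?R (h' - h)" for h h'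
  proof -
    have "per (\<lambda>x. f x * cnj (f (x + (h' - h))))" by (intro per_mult per_cnj bd_per[OF f] bdc[OF f] cgp_intros)
    from gowers_shift[OF this, of n h] show ?thesis by (simp add: algebra_simps)
  qed
  then show ?thesis using E_shift'[OF per] by simp
qed

text \<open>The substitution of \<open>x + y\<close> for \<open>x\<close> and \<open>- y\<close> for
  \<open>y\<close> keeps \<open>y\<^sup>2\<close>. Together with \<open>pavg_reflect\<close> it lets
  a bound for the last function reach every position.\<close>

lemma pavg_swap:
  assumes f: "bd f0" "bd f1" "bd f2" "bd f3"
  shows "pavg f0 f1 f2 f3 = pavg f1 f0 f3 f2"
proof -
  have p: "per (\<lambda>x. f0 x * f1 (x + y) * f2 (x + y\<^sup>2) * f3 (x + y + y\<^sup>2))" for y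
    by (intro per_mult bd_per[OF f(1)] bdc[OF f(2)] bdc[OF f(3)] bdc[OF f(4)] cgp_intros)
  from E_shear[of "\<lambda>x y. f0 x * f1 (x + y) * f2 (x + y\<^sup>2) * f3 (x + y + y\<^sup>2)" "\<lambda>y. - y", OF p]
  have "pavg f0 f1 f2 f3 = (AV x. (AV y. f0 (x - y) * f1 x * f2 (x - y + y\<^sup>2) * f3 (x + y\<^sup>2)))"
    by (simp add: pavg_def)
  also have "\<dots> = (AV x. (AV y. f0 (x - - y) * f1 x * f2 (x - - y + (- y)\<^sup>2) * f3 (x + (- y)\<^sup>2)))"
  proof (rule E_cong, rule E_neg[symmetric])
    fix x
    show "per (\<lambda>y. f0 (x - y) * f1 x * f2 (x - y + y\<^sup>2) * f3 (x + y\<^sup>2))"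
      by (intro per_mult per_const bdc[OF f(1)] bdc[OF f(3)] bdc[OF f(4)] cgp_intros)
  qed
  finally show ?thesis by (simp add: pavg_def mult_ac)
qed

lemma pavg_reflect:
  assumes f: "bd f0" "bd f1" "bd f2" "bd f3"
  shows "pavg f0 f1 f2 f3 = pavg (\<lambda>x. f3 (- x)) (\<lambda>x. f2 (- x)) (\<lambda>x. f1 (- x)) (\<lambda>x. f0 (- x))"
proof -
  have p: "per (\<lambda>x. f0 x * f1 (x + y) * f2 (x + y\<^sup>2) * f3 (x + y + y\<^sup>2))" for y
    by (intro per_mult bd_per[OF f(1)] bdc[OF f(2)] bdc[OF f(3)] bdc[OF f(4)] cgp_intros)
  from E_shear[of "\<lambda>x y. f0 x * f1 (x + y) * f2 (x + y\<^sup>2) * f3 (x + y + y\<^sup>2)" "\<lambda>y. - y - y\<^sup>2", OF p]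
  have "pavg f0 f1 f2 f3 = (AV x. (AV y. f0 (x - y - y\<^sup>2) * f1 (x - y\<^sup>2) * f2 (x - y) * f3 x))"
    by (simp add: pavg_def algebra_simps)
  also have "\<dots> = (AV x. (AV y. f0 (- x - y - y\<^sup>2) * f1 (- x - y\<^sup>2) * f2 (- x - y) * f3 (- x)))"
  proof (rule E_neg[symmetric])
    show "per (\<lambda>x. (AV y. f0 (x - y - y\<^sup>2) * f1 (x - y\<^sup>2) * f2 (x - y) * f3 x))"
      by (intro per_E per_mult bdc[OF f(1)] bdc[OF f(2)] bdc[OF f(3)] bd_per[OF f(4)] cgp_intros)
  qed
  finally show ?thesis by (simp add: pavg_def mult_ac)
qed

lemma gowers_1_reflect:
  assumes f: "bd f" shows "gowers 1 (\<lambda>x. f (- x)) = gowers 1 f"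
proof -
  have "gowers 1 (\<lambda>x. f (- x)) = (AV h. (cmod ((AV x. f (- x) * cnj (f (- x - h)))))\<^sup>2)" by simp
  also have "\<dots> = (AV h. (cmod ((AV x. f x * cnj (f (x - h)))))\<^sup>2)"
  proof (rule E_cong)
    fix h
    have "per (\<lambda>x. f x * cnj (f (x - h)))" by (intro per_mult per_cnj bd_per[OF f] bdc[OF f] cgp_intros)
    from E_neg[OF this] show "(cmod ((AV x. f (- x) * cnj (f (- x - h)))))\<^sup>2 = (cmod ((AV x. f x * cnj (f (x - h)))))\<^sup>2" by simp
  qed
  also have "\<dots> = (AV h. (cmod ((AV x. f x * cnj (f (x + h)))))\<^sup>2)"
  proof -
    have "per (\<lambda>h. (cmod ((AV x. f x * cnj (f (x + h)))))\<^sup>2)"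
      by (intro per_power per_cmod per_E per_mult per_const per_cnj bdc[OF f] cgp_intros)
    from E_neg[OF this] show ?thesis by simp
  qed
  finally show ?thesis by simp
qed

subsection \<open>Translation to residue rings\<close>

lemma residues_p: "residues (int p)"
  using p_gt_3 by unfold_locales simp

lemma carrier_F: "carrier (\<F> p) = {0..<int p}"
  by (auto simp: residue_ring_def)

lemma average_pairs: "average (carrier (\<F> p) \<times> carrier (\<F> p)) (\<lambda>(x, y). f x y) = (AV x. (AV y. f x y))"
  unfolding average_def carrier_F E_def
  by (simp add: card_cartesian_product sum.cartesian_product[symmetric] sum_divide_distrib[symmetric] mult.commute)

definition periodize :: "(int \<Rightarrow> complex) \<Rightarrow> int \<Rightarrow> complex"
  where "periodize f x = f (x mod int p)"

lemma bd_periodize: "one_bounded (\<F> p) f \<Longrightarrow> bd (periodize f)"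
  unfolding one_bounded_def bd_def per_def carrier_F periodize_def using p_pos by (auto simp: cong_def)

lemma average_eq_pavg:
  "average (carrier (\<F> p) \<times> carrier (\<F> p))
     (\<lambda>(x, y). f\<^sub>0 x * f\<^sub>1 (x \<oplus>\<^bsub>\<F> p\<^esub> y) * f\<^sub>2 (x \<oplus>\<^bsub>\<F> p\<^esub> y [^]\<^bsub>\<F> p\<^esub> (2::nat)) *
        f\<^sub>3 (x \<oplus>\<^bsub>\<F> p\<^esub> y \<oplus>\<^bsub>\<F> p\<^esub> y [^]\<^bsub>\<F> p\<^esub> (2::nat))) = pavg (periodize f\<^sub>0) (periodize f\<^sub>1) (periodize f\<^sub>2) (periodize f\<^sub>3)"
proof -
  have pow: "y [^]\<^bsub>\<F> p\<^esub> (2::nat) = y\<^sup>2 mod int p" if "0 \<le> y" "y < int p" for y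
    using residues.pow_cong[OF residues_p, of y 2] that by simp
  show ?thesis
    unfolding average_pairs pavg_def periodize_def
    by (intro E_cong) (simp add: pow residues.res_add_eq[OF residues_p] mod_simps)
qed

text \<open>The value \<open>undefined\<close> off the two indices matches the extensional function
  space in \<open>gowers_average\<close>, so that its functions correspond exactly to pairs.\<close>

definition pair_fun :: "'a \<times> 'a \<Rightarrow> nat \<Rightarrow> 'a"
  where "pair_fun ab = (\<lambda>i. if i = 1 then fst ab else if i = 2 then snd ab else undefined)"

lemma pair_fun_simps [simp]: "pair_fun (a, b) 1 = a" "pair_fun (a, b) (Suc 0) = a" "pair_fun (a, b) 2 = b"
  by (simp_all add: pair_fun_def)

lemma atLeastAtMost_1_2: "{1..2::nat} = {1, 2}"
  by auto

lemma bij_pair_fun: "bij_betw pair_fun (S \<times> S) ({1..2} \<rightarrow>\<^sub>E S)"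
proof (rule bij_betwI[where g="\<lambda>h. (h 1, h 2)"])
  show "pair_fun \<in> S \<times> S \<rightarrow> ({1..2} \<rightarrow>\<^sub>E S)"
    by (auto simp: pair_fun_def PiE_def extensional_def split: if_splits)
  show "(\<lambda>h::nat \<Rightarrow> 'a. (h 1, h 2)) \<in> ({1..2} \<rightarrow>\<^sub>E S) \<rightarrow> S \<times> S"
    unfolding atLeastAtMost_1_2 by (auto simp: PiE_def Pi_def)
  show "(pair_fun x 1, pair_fun x 2) = x" for x :: "'a \<times> 'a" by (simp add: pair_fun_def)
  show "pair_fun (h 1, h 2) = h" if "h \<in> {1..2} \<rightarrow>\<^sub>E S" for h
    using that unfolding atLeastAtMost_1_2 by (auto simp: pair_fun_def PiE_def extensional_def)
qed

lemma sum_pair_fun: "(\<Sum>h\<in>{1..2} \<rightarrow>\<^sub>E S. g h) = (\<Sum>a\<in>S. \<Sum>b\<in>S. g (pair_fun (a, b)))"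
  unfolding sum.reindex_bij_betw[OF bij_pair_fun, symmetric] by (simp add: sum.cartesian_product case_prod_unfold)

lemma prod_pair_fun:
  fixes g :: "(nat \<Rightarrow> nat) \<Rightarrow> complex"
  shows "(\<Prod>h\<in>{1..2} \<rightarrow>\<^sub>E {0, 1::nat}. g h) = g (pair_fun (0, 0)) * g (pair_fun (0, 1)) * (g (pair_fun (1, 0)) * g (pair_fun (1, 1)))"
proof -
  have "(\<Prod>h\<in>{1..2} \<rightarrow>\<^sub>E {0, 1::nat}. g h) = (\<Prod>a\<in>{0, 1}. \<Prod>b\<in>{0, 1}. g (pair_fun (a, b)))"
    unfolding prod.reindex_bij_betw[OF bij_pair_fun, symmetric] by (simp add: prod.cartesian_product case_prod_unfold)
  then show ?thesis by (simp add: mult.assoc)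
qed

text \<open>The product over the cube is grouped as the derivative with shift \<open>a\<close> times
  the conjugate of its translate by \<open>b\<close>; averaging over \<open>x\<close> and
  \<open>b\<close> makes it a squared modulus.\<close>

lemma gowers_average_eq: "gowers_average (\<F> p) 2 f = complex_of_real (gowers 1 (periodize f))"
proof -
  interpret R: residues "int p" "\<F> p" by (rule residues_p) simp
  let ?Z = "{0..<int p}"
  let ?F = "periodize f"
  have pF: "per ?F" by (auto simp: per_def periodize_def cong_def)
  define g where "g x h = (\<Prod>w\<in>{1..2} \<rightarrow>\<^sub>E {0, 1::nat}. (cnj ^^ (\<Sum>i\<in>{1..2}. w i)) (f (x \<oplus>\<^bsub>\<F> p\<^esub> (\<Oplus>\<^bsub>\<F> p\<^esub>i\<in>{1..2}. [w i] \<cdot>\<^bsub>\<F> p\<^esub> h i))))" for x :: int and h :: "nat \<Rightarrow> int"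
  have g: "g x (pair_fun (a, b)) = ?F x * cnj (?F (x + a)) * cnj (?F (x + b) * cnj (?F (x + b + a)))"
    if xab: "x \<in> ?Z" "a \<in> ?Z" "b \<in> ?Z" for x a b
  proof -
    have car: "a \<in> carrier (\<F> p)" "b \<in> carrier (\<F> p)" using xab by (auto simp: carrier_F)
    have fs: "(\<Oplus>\<^bsub>\<F> p\<^esub>i\<in>{1..2}. [pair_fun (u, v) i] \<cdot>\<^bsub>\<F> p\<^esub> pair_fun (a, b) i) = ([u] \<cdot>\<^bsub>\<F> p\<^esub> a) \<oplus>\<^bsub>\<F> p\<^esub> ([v] \<cdot>\<^bsub>\<F> p\<^esub> b)" for u v :: nat
      unfolding atLeastAtMost_1_2 using car by (subst R.finsum_insert) (auto simp: pair_fun_def)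
    have sm: "(\<Sum>i\<in>{1..2}. pair_fun (u, v) i) = u + v" for u v :: nat
      unfolding atLeastAtMost_1_2 by simp
    have n: "add_pow (\<F> p) (0 :: nat) y = 0" "add_pow (\<F> p) (1 :: nat) y = y" if "y \<in> carrier (\<F> p)" for y
      using that R.add.nat_pow_0[of y] R.add.nat_pow_eone[of y] R.res_zero_eq by simp_all
    show ?thesis unfolding g_def prod_pair_fun fs sm n[OF car(1)] n[OF car(2)]
      using xab by (simp add: R.res_add_eq periodize_def mod_simps add_ac mult_ac numeral_2_eq_2)
  qed
  have card: "card (?Z \<times> ({1..2::nat} \<rightarrow>\<^sub>E ?Z)) = p * (p * p)"
    unfolding card_cartesian_product bij_betw_same_card[OF bij_pair_fun, symmetric] by simp
  have "gowers_average (\<F> p) 2 f = (\<Sum>(x, h)\<in>?Z \<times> ({1..2} \<rightarrow>\<^sub>E ?Z). g x h) / of_nat (p * (p * p))"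
    unfolding gowers_average_def average_def carrier_F card g_def ..
  also have "(\<Sum>(x, h)\<in>?Z \<times> ({1..2} \<rightarrow>\<^sub>E ?Z). g x h) = (\<Sum>x\<in>?Z. \<Sum>a\<in>?Z. \<Sum>b\<in>?Z. g x (pair_fun (a, b)))"
    unfolding sum.cartesian_product[symmetric] sum_pair_fun ..
  also have "\<dots> = (\<Sum>x\<in>?Z. \<Sum>a\<in>?Z. \<Sum>b\<in>?Z. ?F x * cnj (?F (x + a)) * cnj (?F (x + b) * cnj (?F (x + b + a))))"
    by (intro sum.cong refl g)
  also have "\<dots> / of_nat (p * (p * p)) = (AV x. (AV a. (AV b. ?F x * cnj (?F (x + a)) * cnj (?F (x + b) * cnj (?F (x + b + a))))))"
    by (simp add: E_def sum_divide_distrib[symmetric])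
  also have "\<dots> = (AV a. (AV x. (AV b. ?F x * cnj (?F (x + a)) * cnj (?F (x + b) * cnj (?F (x + b + a))))))"
    by (rule E_swap)
  also have "\<dots> = (AV a. (AV b. (AV x. ?F x * cnj (?F (x + a)) * cnj (?F (x + b) * cnj (?F (x + b + a))))))"
    by (intro E_cong E_swap)
  also have "\<dots> = (AV a. complex_of_real ((cmod ((AV x. ?F x * cnj (?F (x + a)))))\<^sup>2))"
  proof (rule E_cong)
    fix a
    show "(AV b. (AV x. ?F x * cnj (?F (x + a)) * cnj (?F (x + b) * cnj (?F (x + b + a)))))
      = complex_of_real ((cmod ((AV x. ?F x * cnj (?F (x + a)))))\<^sup>2)"
      by (rule cmod_E_sq[symmetric]) (intro per_mult per_cnj pF per_comp[OF pF] cgp_intros)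
  qed
  also have "\<dots> = complex_of_real (gowers 1 ?F)" unfolding E_of_real by simp
  finally show ?thesis .
qed

lemma gowers_norm_le:
  assumes "gowers_norm (\<F> p) 2 f \<le> \<delta>"
  shows "gowers 1 (periodize f) \<le> \<delta> ^ 4"
proof -
  have "gowers_norm (\<F> p) 2 f = root 4 (gowers 1 (periodize f))"
    unfolding gowers_norm_def gowers_average_eq by simp
  with assms have "root 4 (gowers 1 (periodize f)) \<le> \<delta>" by simp
  moreover have "0 \<le> root 4 (gowers 1 (periodize f))" by (rule real_root_ge_zero[OF gowers_nonneg])
  ultimately have "root 4 (gowers 1 (periodize f)) ^ 4 \<le> \<delta> ^ 4" by (intro power_mono)
  then show ?thesis using real_root_pow_pos2[of 4 "gowers 1 (periodize f)"] gowers_nonneg[of 1 "periodize f"] by simp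
qed

end

subsection \<open>Degree lowering\<close>

lemma eventually_inverse_less:
  assumes "0 < (c::real)"
  obtains P :: nat where "\<And>p. P < p \<Longrightarrow> 6 / real p < c"
proof -
  obtain P :: nat where P: "6 / c < real P" using reals_Archimedean2 by blast
  have "6 / real p < c" if "P < p" for p
  proof -
    have "6 / c < real p" using P that by linarith
    then show ?thesis using assms that by (simp add: field_simps)
  qed
  then show ?thesis by (rule that)
qed

lemma large_eventually:
  assumes "0 < c"
  obtains P where "\<And>p. prime_mod p \<Longrightarrow> P < p \<Longrightarrow> prime_mod.large p c"
proof -
  have pos: "0 < c ^ 8" "0 < (c ^ 8 / 2) ^ 8" using assms by auto
  obtain P1 where P1: "\<And>p. P1 < p \<Longrightarrow> 6 / real p < c ^ 8" using eventually_inverse_less[OF pos(1)] by blast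
  obtain P2 where P2: "\<And>p. P2 < p \<Longrightarrow> 6 / real p < (c ^ 8 / 2) ^ 8" using eventually_inverse_less[OF pos(2)] by blast
  have "prime_mod.large p c" if "prime_mod p" "max P1 P2 < p" for p
  proof -
    have "4 / real p \<le> 6 / real p" by (simp add: divide_right_mono)
    with P1[of p] P2[of p] that show ?thesis by (simp add: prime_mod.large_def)
  qed
  then show ?thesis by (rule that)
qed

lemma dcorr_0_control:
  assumes c: "0 < c"
  shows "\<exists>c'>0. \<exists>P. \<forall>p f0 f1 f2. prime_mod p \<and> P < p \<and> prime_mod.bd p f0 \<and> prime_mod.bd p f1 \<and> prime_mod.bd p f2 \<and>
    c \<le> prime_mod.dcorr p 0 (prime_mod.dual_fam f0 f1 f2) \<longrightarrow> c' \<le> prime_mod.gowers p 1 f2"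
proof -
  \<comment> \<open>The formula of \<open>gain\<close>, written out because the constants are fixed
    before \<open>p\<close>.\<close>
  define g where "g x = (x ^ 8 / 2) ^ 8 / 2" for x :: real
  define c1 where "c1 = (c / 2)\<^sup>2"
  define c2 where "c2 = (sqrt (g c1))\<^sup>2"
  define c3 where "c3 = sqrt (g c2)"
  have pos: "0 < c1" "0 < c2" "0 < c3" using c by (simp_all add: c1_def c2_def c3_def g_def)
  obtain P1 where P1: "\<And>p. prime_mod p \<Longrightarrow> P1 < p \<Longrightarrow> prime_mod.large p c1" by (rule large_eventually[OF pos(1)]) blast
  obtain P2 where P2: "\<And>p. prime_mod p \<Longrightarrow> P2 < p \<Longrightarrow> prime_mod.large p c2" by (rule large_eventually[OF pos(2)]) blast
  have pos3: "0 < c3 ^ 4 / 2" using pos by simp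
  obtain P3 where P3: "\<And>p. P3 < p \<Longrightarrow> 6 / real p < c3 ^ 4 / 2" by (rule eventually_inverse_less[OF pos3]) blast
  have "c3 ^ 4 / 2 \<le> prime_mod.gowers p 1 f2"
    if p: "prime_mod p" "max P1 (max P2 P3) < p" and f: "prime_mod.bd p f0" "prime_mod.bd p f1" "prime_mod.bd p f2" and dcorr: "c \<le> prime_mod.dcorr p 0 (prime_mod.dual_fam f0 f1 f2)"
    for p f0 f1 f2
  proof -
    interpret prime_mod p by fact
    obtain G where G: "structured G" "dcorr 0 (dual_fam f0 f1 f2) \<le> cmod (E (\<lambda>x. E (\<lambda>y. dual_fam f0 f1 f2 y x * G x))) + c / 2"
      using dcorr_0_approx[of "dual_fam f0 f1 f2" "c / 2"] c bd_dual_fam[OF f] by auto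
    then have "c / 2 \<le> cmod (pavg f0 f1 f2 G)"
      using dcorr by (simp add: pavg_dual_fam[OF f structured_bd])
    have e: "gain x = g x" for x by (simp add: gain_def g_def)
    have l: "large ((c / 2)\<^sup>2)" "large ((sqrt (gain ((c / 2)\<^sup>2)))\<^sup>2)"
      unfolding e using P1[OF p(1)] P2[OF p(1)] p(2) by (simp_all add: c1_def c2_def)
    have "gain2 (c / 2) = c3" unfolding gain2_def e c3_def c2_def c1_def ..
    with structured_control[OF f G(1) _ \<open>c / 2 \<le> cmod (pavg f0 f1 f2 G)\<close> l] c
    have "c3 ^ 4 \<le> 2 / real p + gowers 1 f2" by (simp del: gowers.simps One_nat_def)
    moreover have "2 / real p \<le> 6 / real p" by (simp add: divide_right_mono)
    moreover have "6 / real p < c3 ^ 4 / 2" using P3[of p] p(2) by simp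
    ultimately show ?thesis by linarith
  qed
  then show ?thesis using pos3 by blast
qed

context prime_mod begin

lemma dcorr_dual_fam_Suc:
  "dcorr (Suc m) (dual_fam f0 f1 f2) = E (\<lambda>h. E (\<lambda>h'. dcorr m (dual_fam (\<lambda>x. f0 (x + h) * cnj (f0 (x + h'))) (\<lambda>x. f1 (x + h) * cnj (f1 (x + h'))) (\<lambda>x. f2 (x + h) * cnj (f2 (x + h'))))))"
proof -
  have "(\<lambda>y x. dual_fam f0 f1 f2 y (x + h) * cnj (dual_fam f0 f1 f2 y (x + h')))
    = dual_fam (\<lambda>x. f0 (x + h) * cnj (f0 (x + h'))) (\<lambda>x. f1 (x + h) * cnj (f1 (x + h'))) (\<lambda>x. f2 (x + h) * cnj (f2 (x + h')))" for h h'
    by (intro ext) (simp add: dual_fam_def algebra_simps)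
  then show ?thesis by simp
qed

text \<open>A pigeonhole argument in pointwise form: for each pair of shifts the correlation is
  either at most \<open>c / 2\<close>, or, being at most one, bounded by \<open>gowers n\<close> of
  the derivative divided by \<open>c'\<close>. Averaging over the shifts raises the order by
  one.\<close>

lemma dcorr_Suc_control:
  assumes f: "bd f0" "bd f1" "bd f2" and c0: "0 \<le> c" and c: "c \<le> dcorr (Suc m) (dual_fam f0 f1 f2)" and c': "0 < c'"
    and IH: "\<And>g0 g1 g2. bd g0 \<Longrightarrow> bd g1 \<Longrightarrow> bd g2 \<Longrightarrow> c / 2 \<le> dcorr m (dual_fam g0 g1 g2) \<Longrightarrow> c' \<le> gowers n g2"
  shows "c / 2 * c' \<le> gowers (Suc n) f2"
proof -
  define g where "g f h h' x = f (x + h) * cnj (f (x + h'))" for f :: "int \<Rightarrow> complex" and h h' x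
  have bg: "bd (g f0 h h')" "bd (g f1 h h')" "bd (g f2 h h')" for h h'
    unfolding g_def using f by (auto intro: bd_pair_shift)
  have "dcorr m (dual_fam (g f0 h h') (g f1 h h') (g f2 h h')) \<le> c / 2 + 1 / c' * gowers n (g f2 h h')" for h h'
  proof (cases "c / 2 \<le> dcorr m (dual_fam (g f0 h h') (g f1 h h') (g f2 h h'))")
    case True
    from IH[OF bg this] c' have "1 \<le> 1 / c' * gowers n (g f2 h h')" by (simp add: field_simps)
    moreover have "0 \<le> dcorr m (dual_fam (g f0 h h') (g f1 h h') (g f2 h h')) \<and> dcorr m (dual_fam (g f0 h h') (g f1 h h') (g f2 h h')) \<le> 1"
      by (intro dcorr_bounds bd_dual_fam bg)
    ultimately show ?thesis using c0 by linarith
  next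
    case False
    moreover have "0 \<le> 1 / c' * gowers n (g f2 h h')" using c' gowers_nonneg by simp
    ultimately show ?thesis by linarith
  qed
  then have "E (\<lambda>h. E (\<lambda>h'. dcorr m (dual_fam (g f0 h h') (g f1 h h') (g f2 h h')))) \<le> E (\<lambda>h. E (\<lambda>h'. c / 2 + 1 / c' * gowers n (g f2 h h')))"
    by (intro E_mono)
  also have "E (\<lambda>h. E (\<lambda>h'. c / 2 + 1 / c' * gowers n (g f2 h h'))) = c / 2 + 1 / c' * gowers (Suc n) f2"
    unfolding g_def E_gowers_pair_shift[OF f(3), symmetric] by (simp only: E_add E_const E_cmult_left)
  finally have "c \<le> c / 2 + 1 / c' * gowers (Suc n) f2"
    using c unfolding dcorr_dual_fam_Suc g_def by linarith
  then show ?thesis using c' by (simp add: field_simps)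
qed

end

lemma dcorr_control:
  assumes "0 < c"
  shows "\<exists>c'>0. \<exists>P. \<forall>p f0 f1 f2. prime_mod p \<and> P < p \<and> prime_mod.bd p f0 \<and> prime_mod.bd p f1 \<and> prime_mod.bd p f2 \<and>
    c \<le> prime_mod.dcorr p m (prime_mod.dual_fam f0 f1 f2) \<longrightarrow> c' \<le> prime_mod.gowers p (Suc m) f2"
  using assms
proof (induction m arbitrary: c)
  case 0
  then show ?case using dcorr_0_control by simp
next
  case (Suc m)
  from Suc.prems have "0 < c / 2" by simp
  from Suc.IH[OF this] obtain c' P where c': "0 < c'"
    and P: "\<And>p f0 f1 f2. prime_mod p \<Longrightarrow> P < p \<Longrightarrow> prime_mod.bd p f0 \<Longrightarrow> prime_mod.bd p f1 \<Longrightarrow> prime_mod.bd p f2 \<Longrightarrow>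
      c / 2 \<le> prime_mod.dcorr p m (prime_mod.dual_fam f0 f1 f2) \<Longrightarrow> c' \<le> prime_mod.gowers p (Suc m) f2" by blast
  have "c / 2 * c' \<le> prime_mod.gowers p (Suc (Suc m)) f2"
    if p: "prime_mod p" "P < p" and f: "prime_mod.bd p f0" "prime_mod.bd p f1" "prime_mod.bd p f2" and dcorr: "c \<le> prime_mod.dcorr p (Suc m) (prime_mod.dual_fam f0 f1 f2)" for p f0 f1 f2
    by (rule prime_mod.dcorr_Suc_control[OF p(1) f less_imp_le[OF Suc.prems] dcorr c' P[OF p]])
  moreover have "0 < c / 2 * c'" using Suc.prems c' by simp
  ultimately show ?case by blast
qed

text \<open>Stated outside the locale because \<open>c\<close> and \<open>P\<close> must not depend
  on \<open>p\<close>.\<close>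

definition controlled :: "nat \<Rightarrow> bool"
  where "controlled n \<longleftrightarrow> (\<forall>\<epsilon>>0. \<exists>c>0. \<exists>P. \<forall>p f0 f1 f2 f3. prime_mod p \<and> P < p \<and>
    prime_mod.bd p f0 \<and> prime_mod.bd p f1 \<and> prime_mod.bd p f2 \<and> prime_mod.bd p f3 \<and> \<epsilon> \<le> cmod (prime_mod.pavg p f0 f1 f2 f3) \<longrightarrow> c \<le> prime_mod.gowers p n f3)"

lemma controlledE:
  assumes "controlled n" "0 < \<epsilon>"
  obtains c P where "0 < c" "\<And>p f0 f1 f2 f3. prime_mod p \<Longrightarrow> P < p \<Longrightarrow>
    prime_mod.bd p f0 \<Longrightarrow> prime_mod.bd p f1 \<Longrightarrow> prime_mod.bd p f2 \<Longrightarrow> prime_mod.bd p f3 \<Longrightarrow> \<epsilon> \<le> cmod (prime_mod.pavg p f0 f1 f2 f3) \<Longrightarrow> c \<le> prime_mod.gowers p n f3"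
proof -
  from assms(1)[unfolded controlled_def, rule_format, OF assms(2)]
  obtain c P where c: "0 < c" and P: "\<forall>p f0 f1 f2 f3. prime_mod p \<and> P < p \<and>
    prime_mod.bd p f0 \<and> prime_mod.bd p f1 \<and> prime_mod.bd p f2 \<and> prime_mod.bd p f3 \<and> \<epsilon> \<le> cmod (prime_mod.pavg p f0 f1 f2 f3) \<longrightarrow> c \<le> prime_mod.gowers p n f3"
    by (elim exE conjE)
  show ?thesis by (rule that[OF c P[rule_format]]) simp
qed

lemma controlled_6: "controlled 6"
  unfolding controlled_def
proof (intro allI impI)
  fix \<epsilon> :: real assume e: "0 < \<epsilon>"
  then have e4: "0 < \<epsilon> ^ 4 / 2" by simp
  obtain P where P: "\<And>p. P < p \<Longrightarrow> 6 / real p < \<epsilon> ^ 4 / 2" by (rule eventually_inverse_less[OF e4]) blast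
  have "(\<epsilon> ^ 4 / 2) ^ 128 \<le> prime_mod.gowers p 6 f3"
    if p: "prime_mod p" "P < p" and f: "prime_mod.bd p f0" "prime_mod.bd p f1" "prime_mod.bd p f2" "prime_mod.bd p f3" and L: "\<epsilon> \<le> cmod (prime_mod.pavg p f0 f1 f2 f3)" for p f0 f1 f2 f3
  proof (rule ccontr)
    assume "\<not> (\<epsilon> ^ 4 / 2) ^ 128 \<le> prime_mod.gowers p 6 f3"
    then have "cmod (prime_mod.pavg p f0 f1 f2 f3) ^ 4 \<le> \<epsilon> ^ 4 / 2 + 6 / real p"
      using e by (intro prime_mod.gowers_control[OF p(1) f]) auto
    moreover have "\<epsilon> ^ 4 \<le> cmod (prime_mod.pavg p f0 f1 f2 f3) ^ 4" using L e by (intro power_mono) auto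
    ultimately show False using P[OF p(2)] by linarith
  qed
  moreover have "0 < (\<epsilon> ^ 4 / 2) ^ 128" using e4 by (rule zero_less_power)
  ultimately show "\<exists>c>0. \<exists>P. \<forall>p f0 f1 f2 f3. prime_mod p \<and> P < p \<and>
    prime_mod.bd p f0 \<and> prime_mod.bd p f1 \<and> prime_mod.bd p f2 \<and> prime_mod.bd p f3 \<and> \<epsilon> \<le> cmod (prime_mod.pavg p f0 f1 f2 f3) \<longrightarrow> c \<le> prime_mod.gowers p 6 f3"
    by blast
qed

text \<open>The swap moves \<open>f3\<close> to the third place, the one that
  \<open>dcorr_control\<close> bounds, and \<open>f2\<close> to the last, where the dual function
  \<open>F\<close> replaces it. The hypothesis makes the norm of \<open>F\<close> of order
  \<open>m + 3\<close> large, and \<open>gowers_le_dcorr\<close> with \<open>dcorr_control\<close>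
  returns a norm of \<open>f3\<close> of order \<open>m + 2\<close>.\<close>

lemma degree_lowering:
  assumes "controlled (m + 2)"
  shows "controlled (Suc m)"
  unfolding controlled_def
proof (intro allI impI)
  fix \<epsilon> :: real assume e: "0 < \<epsilon>"
  then have e2: "0 < \<epsilon>\<^sup>2" by simp
  obtain c1 P1 where c1: "0 < c1" and P1: "\<And>p f0 f1 f2 f3. prime_mod p \<Longrightarrow> P1 < p \<Longrightarrow>
    prime_mod.bd p f0 \<Longrightarrow> prime_mod.bd p f1 \<Longrightarrow> prime_mod.bd p f2 \<Longrightarrow> prime_mod.bd p f3 \<Longrightarrow> \<epsilon>\<^sup>2 \<le> cmod (prime_mod.pavg p f0 f1 f2 f3) \<Longrightarrow> c1 \<le> prime_mod.gowers p (m + 2) f3"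
    by (rule controlledE[OF assms e2]) blast
  from c1 have "0 < c1 ^ (2 ^ m)" by simp
  from dcorr_control[OF this, of m] obtain c2 P2 where c2: "0 < c2" and P2: "\<And>p f0 f1 f2. prime_mod p \<Longrightarrow> P2 < p \<Longrightarrow> prime_mod.bd p f0 \<Longrightarrow> prime_mod.bd p f1 \<Longrightarrow> prime_mod.bd p f2 \<Longrightarrow>
    c1 ^ (2 ^ m) \<le> prime_mod.dcorr p m (prime_mod.dual_fam f0 f1 f2) \<Longrightarrow> c2 \<le> prime_mod.gowers p (Suc m) f2" by blast
  have "c2 \<le> prime_mod.gowers p (Suc m) f3"
    if p: "prime_mod p" "max P1 P2 < p" and f: "prime_mod.bd p f0" "prime_mod.bd p f1" "prime_mod.bd p f2" "prime_mod.bd p f3" and L: "\<epsilon> \<le> cmod (prime_mod.pavg p f0 f1 f2 f3)" for p f0 f1 f2 f3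
  proof -
    interpret prime_mod p by fact
    define F where "F = (\<lambda>x. E (\<lambda>y. dual_fam f1 f0 f3 y x))"
    have bK: "bd (dual_fam f1 f0 f3 y)" for y by (rule bd_dual_fam[OF f(2,1,4)])
    have bF: "bd F" unfolding F_def by (rule bd_E_fam[OF bK])
    define L' where "L' g = E (\<lambda>x. g x * F x)" for g
    have L': "pavg f1 f0 f3 g = L' g" if "bd g" for g
      unfolding pavg_dual_fam[OF f(2,1,4) that] L'_def F_def by (simp add: E_cmult_left mult.commute)
    have "\<epsilon> \<le> cmod (L' f2)" using L unfolding pavg_swap[OF f] L'[OF f(3)] .
    from dual_trick[OF L'_def f(3) _ this] e have "\<epsilon>\<^sup>2 \<le> cmod (L' (\<lambda>x. cnj (F x)))" by simp
    moreover have "cnj (L' (\<lambda>x. cnj (F x))) = pavg (\<lambda>x. cnj (f1 x)) (\<lambda>x. cnj (f0 x)) (\<lambda>x. cnj (f3 x)) F"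
      unfolding L'[OF bd_cnj[OF bF], symmetric] pavg_def cnj_E by simp
    ultimately have "\<epsilon>\<^sup>2 \<le> cmod (pavg (\<lambda>x. cnj (f1 x)) (\<lambda>x. cnj (f0 x)) (\<lambda>x. cnj (f3 x)) F)"
      by (metis complex_mod_cnj)
    from P1[OF p(1) _ bd_cnj[OF f(2)] bd_cnj[OF f(1)] bd_cnj[OF f(4)] bF this] p(2)
    have "c1 \<le> gowers (m + 2) F" by simp
    then have "c1 ^ (2 ^ m) \<le> gowers (m + 2) F ^ (2 ^ m)" using c1 by (intro power_mono) auto
    also have "\<dots> \<le> dcorr m (dual_fam f1 f0 f3)" by (rule gowers_le_dcorr[OF bK F_def])
    finally show ?thesis using P2[OF p(1) _ f(2,1,4)] p(2) by simp
  qed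
  with c2 show "\<exists>c>0. \<exists>P. \<forall>p f0 f1 f2 f3. prime_mod p \<and> P < p \<and>
    prime_mod.bd p f0 \<and> prime_mod.bd p f1 \<and> prime_mod.bd p f2 \<and> prime_mod.bd p f3 \<and> \<epsilon> \<le> cmod (prime_mod.pavg p f0 f1 f2 f3) \<longrightarrow> c \<le> prime_mod.gowers p (Suc m) f3"
    by blast
qed

lemma controlled_1: "controlled 1"
proof -
  have "controlled 6 \<Longrightarrow> controlled 1"
    \<comment> \<open>Five steps lead from index 6 down to 1, the norms of order seven and
      two.\<close>
    using degree_lowering[of 4] degree_lowering[of 3] degree_lowering[of 2] degree_lowering[of 1] degree_lowering[of 0]
    by (simp add: eval_nat_numeral)
  then show ?thesis using controlled_6 by simp
qed

text \<open>The swap, the reflection and their composition bring each function to the last place,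
  and \<open>gowers_1_reflect\<close> undoes the sign in its argument.\<close>

lemma control_all:
  assumes "0 < \<epsilon>"
  shows "\<exists>c>0. \<exists>P. \<forall>p f0 f1 f2 f3 f. prime_mod p \<and> P < p \<and>
    prime_mod.bd p f0 \<and> prime_mod.bd p f1 \<and> prime_mod.bd p f2 \<and> prime_mod.bd p f3 \<and> \<epsilon> \<le> cmod (prime_mod.pavg p f0 f1 f2 f3) \<and> f \<in> {f0, f1, f2, f3}
      \<longrightarrow> c \<le> prime_mod.gowers p 1 f"
proof -
  obtain c P where c: "0 < c" and P: "\<And>p f0 f1 f2 f3. prime_mod p \<Longrightarrow> P < p \<Longrightarrow>
    prime_mod.bd p f0 \<Longrightarrow> prime_mod.bd p f1 \<Longrightarrow> prime_mod.bd p f2 \<Longrightarrow> prime_mod.bd p f3 \<Longrightarrow> \<epsilon> \<le> cmod (prime_mod.pavg p f0 f1 f2 f3) \<Longrightarrow> c \<le> prime_mod.gowers p 1 f3"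
    by (rule controlledE[OF controlled_1 assms]) blast
  have "c \<le> prime_mod.gowers p 1 f0 \<and> c \<le> prime_mod.gowers p 1 f1 \<and> c \<le> prime_mod.gowers p 1 f2 \<and> c \<le> prime_mod.gowers p 1 f3"
    if p: "prime_mod p" "P < p" and f: "prime_mod.bd p f0" "prime_mod.bd p f1" "prime_mod.bd p f2" "prime_mod.bd p f3" and L: "\<epsilon> \<le> cmod (prime_mod.pavg p f0 f1 f2 f3)" for p f0 f1 f2 f3
  proof -
    interpret prime_mod p by fact
    have r: "bd (\<lambda>x. f (- x))" if "bd f" for f by (intro bd_comp[OF that] cgp_intros)
    note r' = r[OF f(1)] r[OF f(2)] r[OF f(3)] r[OF f(4)]
    have "c \<le> gowers 1 f3" by (rule P[OF p f L])
    moreover have "c \<le> gowers 1 f2"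
      using L unfolding pavg_swap[OF f] by (rule P[OF p f(2,1,4,3)])
    moreover have "c \<le> gowers 1 (\<lambda>x. f0 (- x))"
      using L unfolding pavg_reflect[OF f] by (rule P[OF p r'(4,3,2,1)])
    moreover have "c \<le> gowers 1 (\<lambda>x. f1 (- x))"
      using L unfolding pavg_reflect[OF f] pavg_swap[OF r'(4,3,2,1)] by (rule P[OF p r'(3,4,1,2)])
    ultimately show ?thesis by (simp only: gowers_1_reflect f)
  qed
  with c show ?thesis by blast
qed

theorem theorem1p2:
  fixes \<epsilon> :: real
  assumes "\<epsilon> > 0"
  shows "\<exists>\<delta>::real. \<delta> > 0 \<and> (\<exists>p\<^sub>0::nat. \<forall>p::nat. prime p \<and> p > p\<^sub>0 \<longrightarrow>
    (\<forall>f\<^sub>0 f\<^sub>1 f\<^sub>2 f\<^sub>3 :: int \<Rightarrow> complex.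
      one_bounded (\<F> p) f\<^sub>0 \<and> one_bounded (\<F> p) f\<^sub>1 \<and>
      one_bounded (\<F> p) f\<^sub>2 \<and> one_bounded (\<F> p) f\<^sub>3 \<and>
      (\<exists>f\<in>{f\<^sub>0, f\<^sub>1, f\<^sub>2, f\<^sub>3}. gowers_norm (\<F> p) 2 f \<le> \<delta>) \<longrightarrow>
      cmod (average (carrier (\<F> p) \<times> carrier (\<F> p))
        (\<lambda>(x, y). f\<^sub>0 x * f\<^sub>1 (x \<oplus>\<^bsub>\<F> p\<^esub> y) * f\<^sub>2 (x \<oplus>\<^bsub>\<F> p\<^esub> y [^]\<^bsub>\<F> p\<^esub> (2::nat)) *
           f\<^sub>3 (x \<oplus>\<^bsub>\<F> p\<^esub> y \<oplus>\<^bsub>\<F> p\<^esub> y [^]\<^bsub>\<F> p\<^esub> (2::nat)))) \<le> \<epsilon>))"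
proof -
  from control_all[OF assms] obtain c P where c: "0 < c" and P: "\<And>p f0 f1 f2 f3 f. prime_mod p \<Longrightarrow> P < p \<Longrightarrow>
    prime_mod.bd p f0 \<Longrightarrow> prime_mod.bd p f1 \<Longrightarrow> prime_mod.bd p f2 \<Longrightarrow> prime_mod.bd p f3 \<Longrightarrow> \<epsilon> \<le> cmod (prime_mod.pavg p f0 f1 f2 f3) \<Longrightarrow> f \<in> {f0, f1, f2, f3}
      \<Longrightarrow> c \<le> prime_mod.gowers p 1 f"
    by blast
  \<comment> \<open>The fourth power undoes the root in the norm; halving \<open>c\<close> makes the
    final contradiction strict.\<close>
  define \<delta> where "\<delta> = root 4 (c / 2)"
  have \<delta>: "0 < \<delta>" "\<delta> ^ 4 < c" using c by (simp_all add: \<delta>_def real_root_pow_pos2)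
  have "cmod (average (carrier (\<F> p) \<times> carrier (\<F> p))
        (\<lambda>(x, y). f\<^sub>0 x * f\<^sub>1 (x \<oplus>\<^bsub>\<F> p\<^esub> y) * f\<^sub>2 (x \<oplus>\<^bsub>\<F> p\<^esub> y [^]\<^bsub>\<F> p\<^esub> (2::nat)) *
           f\<^sub>3 (x \<oplus>\<^bsub>\<F> p\<^esub> y \<oplus>\<^bsub>\<F> p\<^esub> y [^]\<^bsub>\<F> p\<^esub> (2::nat)))) \<le> \<epsilon>"
    if p: "prime p" "max 3 P < p" and f: "one_bounded (\<F> p) f\<^sub>0" "one_bounded (\<F> p) f\<^sub>1" "one_bounded (\<F> p) f\<^sub>2" "one_bounded (\<F> p) f\<^sub>3"
      and g: "g \<in> {f\<^sub>0, f\<^sub>1, f\<^sub>2, f\<^sub>3}" "gowers_norm (\<F> p) 2 g \<le> \<delta>" for p f\<^sub>0 f\<^sub>1 f\<^sub>2 f\<^sub>3 g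
  proof (rule ccontr)
    interpret prime_mod p using p by unfold_locales auto
    assume "\<not> ?thesis"
    then have "\<epsilon> \<le> cmod (pavg (periodize f\<^sub>0) (periodize f\<^sub>1) (periodize f\<^sub>2) (periodize f\<^sub>3))" by (simp add: average_eq_pavg)
    from P[OF prime_mod_axioms _ bd_periodize[OF f(1)] bd_periodize[OF f(2)] bd_periodize[OF f(3)] bd_periodize[OF f(4)] this, of "periodize g"] p g(1)
    have "c \<le> gowers 1 (periodize g)" by auto
    with gowers_norm_le[OF g(2)] \<delta>(2) show False by linarith
  qed
  with \<delta>(1) show ?thesis by blast
qed

end
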